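(* Let $\Theta_\approx$ be a first-order signature with equality and let $\Gamma\cup\{\varphi\}\subseteq For(\Theta_\approx)$. If $\Gamma\models_{\mathbf{QmbC}^\approx}\varphi$ (semantical consequence with respect to first-order swap structures with standard equality), then $\Gamma\vdash_{\mathbf{QmbC}^\approx}\varphi$.
   Context: **Language.** $Var$ is a denumerable set of individual variables. A first-order signature $\Theta$ consists of a set of individual constants and, for each $n\ge 1$, sets of function and predicate symbols of arity $n$. The signature with equality $\Theta_\approx$ is $\Theta$ plus a new binary predicate symbol $\approx$ (written infix). Formulas are built with binary connectives $\wedge,\vee,\to$, unary connectives $\neg,\circ$, and quantifiers $\forall,\exists$. For a signature $\Xi$, $For(\Xi)$ and $Sen(\Xi)$ are the sets of formulas and sentences. $\varphi[x/t]$ is the result of replacing every free occurrence of $x$ in $\varphi$ by $t$. If $y$ is a variable free for $x$ in $\varphi$, $\varphi[x\wr y]$ denotes any formula obtained from $\varphi$ by replacing some, not necessarily all (maybe none), free occurrences of $x$ by $y$. Two formulas are *variants* if one is obtained from the other by addition or deletion of void quantifiers, or by renaming bound variables (keeping the same free variables in the same places). **Calculus $\mathbf{QmbC}^\approx$** (Hilbert calculus over $For(\Theta_\approx)$). Axiom schemas: (A1) $\alpha\to(\beta\to\alpha)$; (A2) $(\alpha\to(\beta\to\gamma))\to((\alpha\to\beta)\to(\alpha\to\gamma))$; (A3) $\alpha\to(\beta\to(\alpha\wedge\beta))$; (A4) $(\alpha\wedge\beta)\to\alpha$; (A5) $(\alpha\wedge\beta)\to\beta$; (A6) $\alpha\to(\alpha\vee\beta)$;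 (A7) $\beta\to(\alpha\vee\beta)$; (A8) $(\alpha\to\gamma)\to((\beta\to\gamma)\to((\alpha\vee\beta)\to\gamma))$; (A9) $\alpha\vee(\alpha\to\beta)$; (A10) $\alpha\vee\neg\alpha$; (A11) $\circ\alpha\to(\alpha\to(\neg\alpha\to\beta))$; (Ax12) $\varphi[x/t]\to\exists x\varphi$ if $t$ is free for $x$ in $\varphi$; (Ax13) $\forall x\varphi\to\varphi[x/t]$ if $t$ is free for $x$ in $\varphi$; (Ax14) $\alpha\to\beta$ whenever $\alpha$ is a variant of $\beta$; (AxEq1) $\forall x(x\approx x)$; (AxEq2) $(x\approx y)\to(\varphi\to\varphi[x\wr y])$ if $y$ is a variable free for $x$ in $\varphi$. Rules: (MP) from $\alpha$, $\alpha\to\beta$ infer $\beta$; ($\exists$-In) from $\varphi\to\psi$ infer $\exists x\varphi\to\psi$ if $x$ is not free in $\psi$; ($\forall$-In) from $\varphi\to\psi$ infer $\varphi\to\forall x\psi$ if $x$ is not free in $\varphi$. $\Gamma\vdash_{\mathbf{QmbC}^\approx}\varphi$ means there is a finite derivation of $\varphi$ whose steps are axiom instances, members of $\Gamma$, or follow from earlier steps by a rule. **Swap structures.** For a Boolean algebra $\mathcal A$ with domain $A$, let $B_{\mathcal A}=\{x\in A^3: x_1\vee x_2=1,\ x_1\wedge x_2\wedge x_3=0\}$, where $x_i$ is the $i$-th coordinate. A *swap structure for mbC over $\mathcal A$* is a multialgebra $\mathcal B=(B,\tilde\wedge,\tilde\vee,\tilde\to,\tilde\neg,\tilde\circ)$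 with $\emptyset\neq B\subseteq B_{\mathcal A}$ (write $|\mathcal B|=B$) such that for all $x,y\in B$: $\emptyset\ne x\tilde\# y\subseteq\{z\in B: z_1=x_1\# y_1\}$ for $\#\in\{\wedge,\vee,\to\}$; $\emptyset\neq\tilde\neg x\subseteq\{z\in B: z_1=x_2\}$; $\emptyset\ne\tilde\circ x\subseteq\{z\in B: z_1=x_3\}$. Its Nmatrix is $\mathcal M(\mathcal B)=(\mathcal B,D)$ with $D=\{x\in B: x_1=1\}$. **Structures and valuations.** Let $\mathcal B$ be a swap structure for mbC over a *complete* Boolean algebra. A structure $\mathfrak A=\langle U,I_{\mathfrak A}\rangle$ over $\mathcal M(\mathcal B)$ and $\Theta_\approx$ has a nonempty domain $U$ and assigns $c^{\mathfrak A}\in U$ to constants, $f^{\mathfrak A}:U^n\to U$ to $n$-ary function symbols, and $P^{\mathfrak A}:U^n\to|\mathcal B|$ to $n$-ary predicate symbols (including $\approx$). It is a structure *with standard equality* if $I_{\mathfrak A}(\approx)(a,b)\in D$ iff $a=b$, for all $a,b\in U$. $\Theta_U^\approx$ is $\Theta_\approx$ plus a new constant $\bar a$ for each $a\in U$; $\widehat{\mathfrak A}$ extends $\mathfrak A$ by interpreting $\bar a$ as $a$. An assignment is a map $\mu:Var\to U$; $[\![t]\!]^{\widehat{\mathfrak A}}_\mu\in U$ is the usual value of a term $t$ (the subscript is omitted for closed terms); $\widehat\mu(s)$ is obtained from a term or formula $s$ over $\Theta_U^\approx$ by replacing each free variable $x$ by $\overline{\mu(x)}$; $\mu^x_a$ is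 $\mu$ changed to take value $a$ at $x$; $v_\mu(\varphi)=v(\widehat\mu(\varphi))$. A *QmbC-valuation* over $\mathfrak A$ and $\mathcal M(\mathcal B)$ is a map $v:Sen(\Theta_U^\approx)\to|\mathcal B|$ such that: (i) $v(P(t_1,\dots,t_n))=P^{\mathfrak A}([\![t_1]\!]^{\widehat{\mathfrak A}},\dots,[\![t_n]\!]^{\widehat{\mathfrak A}})$; (ii) $v(\#\varphi)\in\tilde\# v(\varphi)$ for $\#\in\{\neg,\circ\}$; (iii) $v(\varphi\#\psi)\in v(\varphi)\tilde\# v(\psi)$ for $\#\in\{\wedge,\vee,\to\}$; (iv) $(v(\forall x\varphi))_1=\bigwedge_{a\in U}(v(\varphi[x/\bar a]))_1$; (v) $(v(\exists x\varphi))_1=\bigvee_{a\in U}(v(\varphi[x/\bar a]))_1$; (vi) whenever $t$ is free for $z$ in $\varphi$ and $\psi$, $\mu$ is an assignment and $b=[\![t]\!]^{\widehat{\mathfrak A}}_\mu$: (vi.1) if $v(\widehat\mu(\varphi[z/t]))=v(\widehat\mu(\varphi[z/\bar b]))$ then $v(\widehat\mu((\#\varphi)[z/t]))=v(\widehat\mu((\#\varphi)[z/\bar b]))$ for $\#\in\{\neg,\circ\}$; (vi.2) if $v(\widehat\mu(\varphi[z/t]))=v(\widehat\mu(\varphi[z/\bar b]))$ and $v(\widehat\mu(\psi[z/t]))=v(\widehat\mu(\psi[z/\bar b]))$ then $v(\widehat\mu((\varphi\#\psi)[z/t]))=v(\widehat\mu((\varphi\#\psi)[z/\bar b]))$ for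 $\#\in\{\wedge,\vee,\to\}$; (vi.3) if $x\ne z$, $x$ does not occur in $t$, and $v(\widehat{\mu^x_a}(\varphi[z/t]))=v(\widehat{\mu^x_a}(\varphi[z/\bar b]))$ for every $a\in U$, then $v(\widehat\mu((Qx\varphi)[z/t]))=v(\widehat\mu((Qx\varphi)[z/\bar b]))$ for $Q\in\{\forall,\exists\}$; (vii) $v(\varphi)=v(\varphi')$ if $\varphi,\varphi'$ are variants. If $\mathfrak A$ has standard equality, a *$\mathbf{QmbC}^\approx$-valuation* over $\mathfrak A$ and $\mathcal M(\mathcal B)$ is a QmbC-valuation that also satisfies (viii) $v_\mu((x\approx y)\to(\varphi\to\varphi[x\wr y]))\in D$ for every $\mu$, if $y$ is a variable free for $x$ in $\varphi$. **Consequence.** $\Gamma\models^\approx_{(\mathfrak A,\mathcal M(\mathcal B))}\varphi$ iff for every $\mathbf{QmbC}^\approx$-valuation $v$ over $\mathfrak A$ and $\mathcal M(\mathcal B)$: if $v_\mu(\gamma)\in D$ for all $\gamma\in\Gamma$ and all $\mu$, then $v_\mu(\varphi)\in D$ for all $\mu$. $\Gamma\models_{\mathbf{QmbC}^\approx}\varphi$ iff $\Gamma\models^\approx_{(\mathfrak A,\mathcal M(\mathcal B))}\varphi$ for every swap structure $\mathcal B$ for mbC over a complete Boolean algebra and every structure $\mathfrak A$ with standard equality over $\mathcal M(\mathcal B)$ and $\Theta_\approx$. *)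

theory Defs
  imports "HOL-Algebra.Complete_Lattice"
begin

section \<open>Language\<close>

text \<open>
  Individual variables are natural numbers.  The raw types of terms and formulas do not control
  which symbols are used and with how many arguments; membership in \<open>Ter\<close>, \<open>For\<close>
  and \<open>Sen\<close> does, relative to a signature.
\<close>

datatype ('c, 'f) tm = Var nat | Con 'c | App 'f "('c, 'f) tm list"

datatype unop = Neg | Circ
datatype binop = Conj | Disj | Impl
datatype quant = Forall | Exists

datatype ('c, 'f, 'p) fm =
    Atom 'p "('c, 'f) tm list"
  | Unary unop "('c, 'f, 'p) fm"
  | Binary binop "('c, 'f, 'p) fm" "('c, 'f, 'p) fm"
  | Quant quant nat "('c, 'f, 'p) fm"

text \<open>
  The symbol sets live on fixed types but may be empty.  \<open>fsyms \<Theta> n\<close> and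
  \<open>psyms \<Theta> n\<close> are the function and predicate symbols of arity \<open>n\<close>.
\<close>

record ('c, 'f, 'p) sig =
  csyms :: "'c set"
  fsyms :: "nat \<Rightarrow> 'f set"
  psyms :: "nat \<Rightarrow> 'p set"

definition signature :: "('c, 'f, 'p) sig \<Rightarrow> bool" where
  "signature \<Theta> \<longleftrightarrow> fsyms \<Theta> 0 = {} \<and> psyms \<Theta> 0 = {}"

inductive_set Ter :: "('c, 'f, 'p) sig \<Rightarrow> ('c, 'f) tm set" for \<Theta> where
  "Var x \<in> Ter \<Theta>"
| "c \<in> csyms \<Theta> \<Longrightarrow> Con c \<in> Ter \<Theta>"
| "f \<in> fsyms \<Theta> (length ts) \<Longrightarrow> \<forall>t\<in>set ts. t \<in> Ter \<Theta> \<Longrightarrow> App f ts \<in> Ter \<Theta>"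

inductive_set For :: "('c, 'f, 'p) sig \<Rightarrow> ('c, 'f, 'p) fm set" for \<Theta> where
  "P \<in> psyms \<Theta> (length ts) \<Longrightarrow> set ts \<subseteq> Ter \<Theta> \<Longrightarrow> Atom P ts \<in> For \<Theta>"
| "\<phi> \<in> For \<Theta> \<Longrightarrow> Unary u \<phi> \<in> For \<Theta>"
| "\<phi> \<in> For \<Theta> \<Longrightarrow> \<psi> \<in> For \<Theta> \<Longrightarrow> Binary b \<phi> \<psi> \<in> For \<Theta>"
| "\<phi> \<in> For \<Theta> \<Longrightarrow> Quant q x \<phi> \<in> For \<Theta>"

primrec tvars :: "('c, 'f) tm \<Rightarrow> nat set" where
  "tvars (Var x) = {x}"
| "tvars (Con c) = {}"
| "tvars (App f ts) = \<Union> (set (map tvars ts))"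

primrec fv :: "('c, 'f, 'p) fm \<Rightarrow> nat set" where
  "fv (Atom P ts) = \<Union> (set (map tvars ts))"
| "fv (Unary u \<phi>) = fv \<phi>"
| "fv (Binary b \<phi> \<psi>) = fv \<phi> \<union> fv \<psi>"
| "fv (Quant q x \<phi>) = fv \<phi> - {x}"

definition Sen :: "('c, 'f, 'p) sig \<Rightarrow> ('c, 'f, 'p) fm set" where
  "Sen \<Theta> = {\<phi> \<in> For \<Theta>. fv \<phi> = {}}"

text \<open>The equality symbol is a fresh predicate symbol: the predicate symbols of \<open>with_eq \<Theta>\<close>
  range over the enlarged type \<open>'p eqsym\<close>.\<close>

datatype 'p eqsym = EqSym | Psym 'p

definition with_eq :: "('c, 'f, 'p) sig \<Rightarrow> ('c, 'f, 'p eqsym) sig" where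
  "with_eq \<Theta> = \<lparr>csyms = csyms \<Theta>, fsyms = fsyms \<Theta>,
     psyms = (\<lambda>n. Psym ` psyms \<Theta> n \<union> (if n = 2 then {EqSym} else {}))\<rparr>"

abbreviation fm_neg (\<open>\<^bold>\<not> _\<close> [75] 75) where "\<^bold>\<not> \<phi> \<equiv> Unary Neg \<phi>"
abbreviation fm_circ (\<open>\<^bold>\<circ> _\<close> [75] 75) where "\<^bold>\<circ> \<phi> \<equiv> Unary Circ \<phi>"
abbreviation fm_conj (infixr \<open>\<^bold>\<and>\<close> 70) where "\<phi> \<^bold>\<and> \<psi> \<equiv> Binary Conj \<phi> \<psi>"
abbreviation fm_disj (infixr \<open>\<^bold>\<or>\<close> 69) where "\<phi> \<^bold>\<or> \<psi> \<equiv> Binary Disj \<phi> \<psi>"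
abbreviation fm_impl (infixr \<open>\<^bold>\<longrightarrow>\<close> 68) where "\<phi> \<^bold>\<longrightarrow> \<psi> \<equiv> Binary Impl \<phi> \<psi>"
abbreviation fm_all (\<open>\<^bold>\<forall>_. _\<close> [0, 67] 67) where "\<^bold>\<forall>x. \<phi> \<equiv> Quant Forall x \<phi>"
abbreviation fm_ex (\<open>\<^bold>\<exists>_. _\<close> [0, 67] 67) where "\<^bold>\<exists>x. \<phi> \<equiv> Quant Exists x \<phi>"
abbreviation fm_eq (infix \<open>\<^bold>\<approx>\<close> 76) where "s \<^bold>\<approx> t \<equiv> Atom EqSym [s, t]"


section \<open>Substitution and variants\<close>

text \<open>Simultaneous replacement of free occurrences of variables; bound variables are never renamed,
  so capture must be excluded by \<open>free_for\<close> where it matters.\<close>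

primrec tsubst :: "(nat \<Rightarrow> ('c, 'f) tm) \<Rightarrow> ('c, 'f) tm \<Rightarrow> ('c, 'f) tm" where
  "tsubst \<sigma> (Var x) = \<sigma> x"
| "tsubst \<sigma> (Con c) = Con c"
| "tsubst \<sigma> (App f ts) = App f (map (tsubst \<sigma>) ts)"

primrec psubst :: "(nat \<Rightarrow> ('c, 'f) tm) \<Rightarrow> ('c, 'f, 'p) fm \<Rightarrow> ('c, 'f, 'p) fm" where
  "psubst \<sigma> (Atom P ts) = Atom P (map (tsubst \<sigma>) ts)"
| "psubst \<sigma> (Unary u \<phi>) = Unary u (psubst \<sigma> \<phi>)"
| "psubst \<sigma> (Binary b \<phi> \<psi>) = Binary b (psubst \<sigma> \<phi>) (psubst \<sigma> \<psi>)"
| "psubst \<sigma> (Quant q x \<phi>) = Quant q x (psubst (\<sigma>(x := Var x)) \<phi>)"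

definition subst :: "('c, 'f, 'p) fm \<Rightarrow> nat \<Rightarrow> ('c, 'f) tm \<Rightarrow> ('c, 'f, 'p) fm" where
  "subst \<phi> x t = psubst (Var(x := t)) \<phi>"

primrec free_for :: "('c, 'f) tm \<Rightarrow> nat \<Rightarrow> ('c, 'f, 'p) fm \<Rightarrow> bool" where
  "free_for t x (Atom P ts) \<longleftrightarrow> True"
| "free_for t x (Unary u \<phi>) \<longleftrightarrow> free_for t x \<phi>"
| "free_for t x (Binary b \<phi> \<psi>) \<longleftrightarrow> free_for t x \<phi> \<and> free_for t x \<psi>"
| "free_for t x (Quant q y \<phi>) \<longleftrightarrow> x \<notin> fv (Quant q y \<phi>) \<or> (y \<notin> tvars t \<and> free_for t x \<phi>)"

text \<open>\<open>some_repl x y \<phi> \<phi>'\<close>: the formula \<open>\<phi>'\<close> is one of the formulas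
  \<open>\<phi>[x \<wr> y]\<close>, i.e. some (possibly none, possibly all) free occurrences of \<open>x\<close> in
  \<open>\<phi>\<close> are replaced by \<open>y\<close>.\<close>

inductive some_repl_tm :: "nat \<Rightarrow> nat \<Rightarrow> ('c, 'f) tm \<Rightarrow> ('c, 'f) tm \<Rightarrow> bool" for x y where
  "some_repl_tm x y t t"
| "some_repl_tm x y (Var x) (Var y)"
| "list_all2 (some_repl_tm x y) ts ts' \<Longrightarrow> some_repl_tm x y (App f ts) (App f ts')"

inductive some_repl :: "nat \<Rightarrow> nat \<Rightarrow> ('c, 'f, 'p) fm \<Rightarrow> ('c, 'f, 'p) fm \<Rightarrow> bool" for x y where
  "some_repl x y \<phi> \<phi>"
| "list_all2 (some_repl_tm x y) ts ts' \<Longrightarrow> some_repl x y (Atom P ts) (Atom P ts')"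
| "some_repl x y \<phi> \<phi>' \<Longrightarrow> some_repl x y (Unary u \<phi>) (Unary u \<phi>')"
| "some_repl x y \<phi> \<phi>' \<Longrightarrow> some_repl x y \<psi> \<psi>' \<Longrightarrow> some_repl x y (Binary b \<phi> \<psi>) (Binary b \<phi>' \<psi>')"
| "z \<noteq> x \<Longrightarrow> some_repl x y \<phi> \<phi>' \<Longrightarrow> some_repl x y (Quant q z \<phi>) (Quant q z \<phi>')"

text \<open>Variants: any number of void quantifiers may be added or deleted and any number of bound
  variables renamed, anywhere in the formula.\<close>

inductive variant :: "('c, 'f, 'p) fm \<Rightarrow> ('c, 'f, 'p) fm \<Rightarrow> bool" where
  void: "x \<notin> fv \<phi> \<Longrightarrow> variant (Quant q x \<phi>) \<phi>"
| rename: "y \<notin> fv \<phi> \<Longrightarrow> free_for (Var y) x \<phi> \<Longrightarrow> variant (Quant q x \<phi>) (Quant q y (subst \<phi> x (Var y)))"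
| refl: "variant \<phi> \<phi>"
| sym: "variant \<phi> \<psi> \<Longrightarrow> variant \<psi> \<phi>"
| trans: "variant \<phi> \<psi> \<Longrightarrow> variant \<psi> \<chi> \<Longrightarrow> variant \<phi> \<chi>"
| Unary: "variant \<phi> \<phi>' \<Longrightarrow> variant (Unary u \<phi>) (Unary u \<phi>')"
| Binary: "variant \<phi> \<phi>' \<Longrightarrow> variant \<psi> \<psi>' \<Longrightarrow> variant (Binary b \<phi> \<psi>) (Binary b \<phi>' \<psi>')"
| Quant: "variant \<phi> \<phi>' \<Longrightarrow> variant (Quant q x \<phi>) (Quant q x \<phi>')"


section \<open>The Hilbert calculus\<close>

inductive qmbc_axiom :: "('c, 'f, 'p eqsym) fm \<Rightarrow> bool" where
  A1: "qmbc_axiom (\<alpha> \<^bold>\<longrightarrow> (\<beta> \<^bold>\<longrightarrow> \<alpha>))"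
| A2: "qmbc_axiom ((\<alpha> \<^bold>\<longrightarrow> (\<beta> \<^bold>\<longrightarrow> \<gamma>)) \<^bold>\<longrightarrow> ((\<alpha> \<^bold>\<longrightarrow> \<beta>) \<^bold>\<longrightarrow> (\<alpha> \<^bold>\<longrightarrow> \<gamma>)))"
| A3: "qmbc_axiom (\<alpha> \<^bold>\<longrightarrow> (\<beta> \<^bold>\<longrightarrow> (\<alpha> \<^bold>\<and> \<beta>)))"
| A4: "qmbc_axiom ((\<alpha> \<^bold>\<and> \<beta>) \<^bold>\<longrightarrow> \<alpha>)"
| A5: "qmbc_axiom ((\<alpha> \<^bold>\<and> \<beta>) \<^bold>\<longrightarrow> \<beta>)"
| A6: "qmbc_axiom (\<alpha> \<^bold>\<longrightarrow> (\<alpha> \<^bold>\<or> \<beta>))"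
| A7: "qmbc_axiom (\<beta> \<^bold>\<longrightarrow> (\<alpha> \<^bold>\<or> \<beta>))"
| A8: "qmbc_axiom ((\<alpha> \<^bold>\<longrightarrow> \<gamma>) \<^bold>\<longrightarrow> ((\<beta> \<^bold>\<longrightarrow> \<gamma>) \<^bold>\<longrightarrow> ((\<alpha> \<^bold>\<or> \<beta>) \<^bold>\<longrightarrow> \<gamma>)))"
| A9: "qmbc_axiom (\<alpha> \<^bold>\<or> (\<alpha> \<^bold>\<longrightarrow> \<beta>))"
| A10: "qmbc_axiom (\<alpha> \<^bold>\<or> (\<^bold>\<not> \<alpha>))"
| A11: "qmbc_axiom ((\<^bold>\<circ> \<alpha>) \<^bold>\<longrightarrow> (\<alpha> \<^bold>\<longrightarrow> ((\<^bold>\<not> \<alpha>) \<^bold>\<longrightarrow> \<beta>)))"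
| Ax12: "free_for t x \<phi> \<Longrightarrow> qmbc_axiom (subst \<phi> x t \<^bold>\<longrightarrow> (\<^bold>\<exists>x. \<phi>))"
| Ax13: "free_for t x \<phi> \<Longrightarrow> qmbc_axiom ((\<^bold>\<forall>x. \<phi>) \<^bold>\<longrightarrow> subst \<phi> x t)"
| Ax14: "variant \<alpha> \<beta> \<Longrightarrow> qmbc_axiom (\<alpha> \<^bold>\<longrightarrow> \<beta>)"
| AxEq1: "qmbc_axiom (\<^bold>\<forall>x. (Var x \<^bold>\<approx> Var x))"
| AxEq2: "free_for (Var y) x \<phi> \<Longrightarrow> some_repl x y \<phi> \<phi>' \<Longrightarrow>
           qmbc_axiom ((Var x \<^bold>\<approx> Var y) \<^bold>\<longrightarrow> (\<phi> \<^bold>\<longrightarrow> \<phi>'))"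

inductive qmbc_derives :: "('c, 'f, 'p) sig \<Rightarrow> ('c, 'f, 'p eqsym) fm set \<Rightarrow> ('c, 'f, 'p eqsym) fm \<Rightarrow> bool"
  for \<Theta> \<Gamma> where
  axiom: "qmbc_axiom \<phi> \<Longrightarrow> \<phi> \<in> For (with_eq \<Theta>) \<Longrightarrow> qmbc_derives \<Theta> \<Gamma> \<phi>"
| premise: "\<phi> \<in> \<Gamma> \<Longrightarrow> qmbc_derives \<Theta> \<Gamma> \<phi>"
| MP: "qmbc_derives \<Theta> \<Gamma> \<alpha> \<Longrightarrow> qmbc_derives \<Theta> \<Gamma> (\<alpha> \<^bold>\<longrightarrow> \<beta>) \<Longrightarrow> qmbc_derives \<Theta> \<Gamma> \<beta>"
| Ex_In: "qmbc_derives \<Theta> \<Gamma> (\<phi> \<^bold>\<longrightarrow> \<psi>) \<Longrightarrow> x \<notin> fv \<psi> \<Longrightarrow> qmbc_derives \<Theta> \<Gamma> ((\<^bold>\<exists>x. \<phi>) \<^bold>\<longrightarrow> \<psi>)"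
| All_In: "qmbc_derives \<Theta> \<Gamma> (\<phi> \<^bold>\<longrightarrow> \<psi>) \<Longrightarrow> x \<notin> fv \<phi> \<Longrightarrow> qmbc_derives \<Theta> \<Gamma> (\<phi> \<^bold>\<longrightarrow> (\<^bold>\<forall>x. \<psi>))"


section \<open>Complete Boolean algebras and swap structures\<close>

text \<open>The type class of complete Boolean algebras in the library demands complete distributivity and
  would only admit atomic algebras; moreover, the algebras have to be quantified over.  Hence the
  carrier-based complete lattices are used.\<close>

locale complete_boolean_lattice = complete_lattice L for L (structure) +
  assumes distrib: "\<lbrakk>x \<in> carrier L; y \<in> carrier L; z \<in> carrier L\<rbrakk> \<Longrightarrow>
      x \<sqinter> (y \<squnion> z) = (x \<sqinter> y) \<squnion> (x \<sqinter> z)"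
    and complement_exists: "x \<in> carrier L \<Longrightarrow> \<exists>y\<in>carrier L. x \<sqinter> y = \<bottom> \<and> x \<squnion> y = \<top>"

definition compl :: "'a gorder \<Rightarrow> 'a \<Rightarrow> 'a" where
  "compl L x = (THE y. y \<in> carrier L \<and> x \<sqinter>\<^bsub>L\<^esub> y = \<bottom>\<^bsub>L\<^esub> \<and> x \<squnion>\<^bsub>L\<^esub> y = \<top>\<^bsub>L\<^esub>)"

fun ba_op :: "'a gorder \<Rightarrow> binop \<Rightarrow> 'a \<Rightarrow> 'a \<Rightarrow> 'a" where
  "ba_op L Conj x y = x \<sqinter>\<^bsub>L\<^esub> y"
| "ba_op L Disj x y = x \<squnion>\<^bsub>L\<^esub> y"
| "ba_op L Impl x y = compl L x \<squnion>\<^bsub>L\<^esub> y"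

type_synonym 'a snapshot = "'a \<times> 'a \<times> 'a"

fun crd1 :: "'a snapshot \<Rightarrow> 'a" where "crd1 (a, b, c) = a"
fun crd2 :: "'a snapshot \<Rightarrow> 'a" where "crd2 (a, b, c) = b"
fun crd3 :: "'a snapshot \<Rightarrow> 'a" where "crd3 (a, b, c) = c"

definition snapshots :: "'a gorder \<Rightarrow> 'a snapshot set" where
  "snapshots L = {x. crd1 x \<in> carrier L \<and> crd2 x \<in> carrier L \<and> crd3 x \<in> carrier L \<and>
     crd1 x \<squnion>\<^bsub>L\<^esub> crd2 x = \<top>\<^bsub>L\<^esub> \<and> (crd1 x \<sqinter>\<^bsub>L\<^esub> crd2 x) \<sqinter>\<^bsub>L\<^esub> crd3 x = \<bottom>\<^bsub>L\<^esub>}"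

record 'a multialgebra =
  msupp :: "'a snapshot set"
  mun :: "unop \<Rightarrow> 'a snapshot \<Rightarrow> 'a snapshot set"
  mbin :: "binop \<Rightarrow> 'a snapshot \<Rightarrow> 'a snapshot \<Rightarrow> 'a snapshot set"

locale swap_structure =
  fixes L :: "'a gorder" and B :: "'a multialgebra"
  assumes supp_nonempty: "msupp B \<noteq> {}"
    and supp_subset: "msupp B \<subseteq> snapshots L"
    and bin: "\<And>b x y. x \<in> msupp B \<Longrightarrow> y \<in> msupp B \<Longrightarrow>
      mbin B b x y \<noteq> {} \<and> mbin B b x y \<subseteq> {z \<in> msupp B. crd1 z = ba_op L b (crd1 x) (crd1 y)}"
    and neg: "\<And>x. x \<in> msupp B \<Longrightarrow>
      mun B Neg x \<noteq> {} \<and> mun B Neg x \<subseteq> {z \<in> msupp B. crd1 z = crd2 x}"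
    and circ: "\<And>x. x \<in> msupp B \<Longrightarrow>
      mun B Circ x \<noteq> {} \<and> mun B Circ x \<subseteq> {z \<in> msupp B. crd1 z = crd3 x}"

definition designated :: "'a gorder \<Rightarrow> 'a multialgebra \<Rightarrow> 'a snapshot set" where
  "designated L B = {x \<in> msupp B. crd1 x = \<top>\<^bsub>L\<^esub>}"


section \<open>First-order structures\<close>

record ('c, 'f, 'p, 'u, 'a) fostruct =
  univ :: "'u set"
  cint :: "'c \<Rightarrow> 'u"
  fint :: "'f \<Rightarrow> 'u list \<Rightarrow> 'u"
  pint :: "'p \<Rightarrow> 'u list \<Rightarrow> 'a snapshot"

locale fo_structure =
  fixes \<Theta> :: "('c, 'f, 'p) sig" and B :: "'a multialgebra"
    and S :: "('c, 'f, 'p, 'u, 'a) fostruct"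
  assumes univ_nonempty: "univ S \<noteq> {}"
    and cint_closed: "\<And>c. c \<in> csyms \<Theta> \<Longrightarrow> cint S c \<in> univ S"
    and fint_closed: "\<And>f as. f \<in> fsyms \<Theta> (length as) \<Longrightarrow> set as \<subseteq> univ S \<Longrightarrow> fint S f as \<in> univ S"
    and pint_closed: "\<And>P as. P \<in> psyms \<Theta> (length as) \<Longrightarrow> set as \<subseteq> univ S \<Longrightarrow> pint S P as \<in> msupp B"

definition standard_equality ::
    "'a gorder \<Rightarrow> 'a multialgebra \<Rightarrow> ('c, 'f, 'p eqsym, 'u, 'a) fostruct \<Rightarrow> bool" where
  "standard_equality L B S \<longleftrightarrow>
     (\<forall>a\<in>univ S. \<forall>b\<in>univ S. pint S EqSym [a, b] \<in> designated L B \<longleftrightarrow> a = b)"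

primrec teval :: "('c, 'f, 'p, 'u, 'a) fostruct \<Rightarrow> (nat \<Rightarrow> 'u) \<Rightarrow> ('c, 'f) tm \<Rightarrow> 'u" where
  "teval S \<mu> (Var x) = \<mu> x"
| "teval S \<mu> (Con c) = cint S c"
| "teval S \<mu> (App f ts) = fint S f (map (teval S \<mu>) ts)"

text \<open>Diagram language and expansion: an old constant \<open>c\<close> becomes \<open>Inl c\<close>, and
  \<open>Inr a\<close> is the name of the individual \<open>a\<close>.\<close>

definition diag_sig :: "('c, 'f, 'p) sig \<Rightarrow> 'u set \<Rightarrow> ('c + 'u, 'f, 'p) sig" where
  "diag_sig \<Theta> U = \<lparr>csyms = Inl ` csyms \<Theta> \<union> Inr ` U, fsyms = fsyms \<Theta>, psyms = psyms \<Theta>\<rparr>"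

definition expansion :: "('c, 'f, 'p, 'u, 'a) fostruct \<Rightarrow> ('c + 'u, 'f, 'p, 'u, 'a) fostruct" where
  "expansion S = \<lparr>univ = univ S, cint = case_sum (cint S) (\<lambda>a. a), fint = fint S, pint = pint S\<rparr>"

abbreviation name :: "'u \<Rightarrow> ('c + 'u, 'f) tm" where
  "name a \<equiv> Con (Inr a)"

definition embed :: "('c, 'f, 'p) fm \<Rightarrow> ('c + 'u, 'f, 'p) fm" where
  "embed \<phi> = map_fm Inl id id \<phi>"

definition inst :: "(nat \<Rightarrow> 'u) \<Rightarrow> ('c + 'u, 'f, 'p) fm \<Rightarrow> ('c + 'u, 'f, 'p) fm" where
  "inst \<mu> \<phi> = psubst (\<lambda>x. name (\<mu> x)) \<phi>"

definition assignments :: "('c, 'f, 'p, 'u, 'a) fostruct \<Rightarrow> (nat \<Rightarrow> 'u) set" where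
  "assignments S = {\<mu>. range \<mu> \<subseteq> univ S}"


section \<open>Valuations and consequence\<close>

text \<open>Only the values of a valuation on \<open>Sen (diag_sig \<Theta> (univ S))\<close> matter.  In \<open>atom\<close> the
  assignment is irrelevant, since the terms of an atomic sentence are closed.\<close>

locale qmbc_valuation =
  fixes \<Theta> :: "('c, 'f, 'p) sig" and L :: "'a gorder" and B :: "'a multialgebra"
    and S :: "('c, 'f, 'p, 'u, 'a) fostruct"
    and v :: "('c + 'u, 'f, 'p) fm \<Rightarrow> 'a snapshot"
  assumes range: "\<And>\<phi>. \<phi> \<in> Sen (diag_sig \<Theta> (univ S)) \<Longrightarrow> v \<phi> \<in> msupp B"
    and atom: "\<And>P ts \<mu>. \<lbrakk>Atom P ts \<in> Sen (diag_sig \<Theta> (univ S)); \<mu> \<in> assignments S\<rbrakk> \<Longrightarrow>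
      v (Atom P ts) = pint S P (map (teval (expansion S) \<mu>) ts)"
    and un: "\<And>u \<phi>. \<phi> \<in> Sen (diag_sig \<Theta> (univ S)) \<Longrightarrow> v (Unary u \<phi>) \<in> mun B u (v \<phi>)"
    and bin: "\<And>b \<phi> \<psi>. \<lbrakk>\<phi> \<in> Sen (diag_sig \<Theta> (univ S)); \<psi> \<in> Sen (diag_sig \<Theta> (univ S))\<rbrakk> \<Longrightarrow>
      v (Binary b \<phi> \<psi>) \<in> mbin B b (v \<phi>) (v \<psi>)"
    and all: "\<And>x \<phi>. (\<^bold>\<forall>x. \<phi>) \<in> Sen (diag_sig \<Theta> (univ S)) \<Longrightarrow>
      crd1 (v (\<^bold>\<forall>x. \<phi>)) = \<Sqinter>\<^bsub>L\<^esub> ((\<lambda>a. crd1 (v (subst \<phi> x (name a)))) ` univ S)"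
    and ex: "\<And>x \<phi>. (\<^bold>\<exists>x. \<phi>) \<in> Sen (diag_sig \<Theta> (univ S)) \<Longrightarrow>
      crd1 (v (\<^bold>\<exists>x. \<phi>)) = \<Squnion>\<^bsub>L\<^esub> ((\<lambda>a. crd1 (v (subst \<phi> x (name a)))) ` univ S)"
    and subst_un: "\<And>u \<phi> t z \<mu> b.
      \<lbrakk>\<phi> \<in> For (diag_sig \<Theta> (univ S)); t \<in> Ter (diag_sig \<Theta> (univ S)); free_for t z \<phi>;
       \<mu> \<in> assignments S; b = teval (expansion S) \<mu> t;
       v (inst \<mu> (subst \<phi> z t)) = v (inst \<mu> (subst \<phi> z (name b)))\<rbrakk> \<Longrightarrow>
      v (inst \<mu> (subst (Unary u \<phi>) z t)) = v (inst \<mu> (subst (Unary u \<phi>) z (name b)))"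
    and subst_bin: "\<And>c \<phi> \<psi> t z \<mu> b.
      \<lbrakk>\<phi> \<in> For (diag_sig \<Theta> (univ S)); \<psi> \<in> For (diag_sig \<Theta> (univ S));
       t \<in> Ter (diag_sig \<Theta> (univ S)); free_for t z \<phi>; free_for t z \<psi>;
       \<mu> \<in> assignments S; b = teval (expansion S) \<mu> t;
       v (inst \<mu> (subst \<phi> z t)) = v (inst \<mu> (subst \<phi> z (name b)));
       v (inst \<mu> (subst \<psi> z t)) = v (inst \<mu> (subst \<psi> z (name b)))\<rbrakk> \<Longrightarrow>
      v (inst \<mu> (subst (Binary c \<phi> \<psi>) z t)) = v (inst \<mu> (subst (Binary c \<phi> \<psi>) z (name b)))"
    and subst_qu: "\<And>q x \<phi> t z \<mu> b.
      \<lbrakk>\<phi> \<in> For (diag_sig \<Theta> (univ S)); t \<in> Ter (diag_sig \<Theta> (univ S)); free_for t z \<phi>;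
       \<mu> \<in> assignments S; b = teval (expansion S) \<mu> t; x \<noteq> z; x \<notin> tvars t;
       \<And>a. a \<in> univ S \<Longrightarrow>
         v (inst (\<mu>(x := a)) (subst \<phi> z t)) = v (inst (\<mu>(x := a)) (subst \<phi> z (name b)))\<rbrakk> \<Longrightarrow>
      v (inst \<mu> (subst (Quant q x \<phi>) z t)) = v (inst \<mu> (subst (Quant q x \<phi>) z (name b)))"
    and variants: "\<And>\<phi> \<phi>'. \<lbrakk>\<phi> \<in> Sen (diag_sig \<Theta> (univ S)); \<phi>' \<in> Sen (diag_sig \<Theta> (univ S)); variant \<phi> \<phi>'\<rbrakk> \<Longrightarrow>
      v \<phi> = v \<phi>'"

locale qmbc_eq_valuation = qmbc_valuation "with_eq \<Theta>" L B S v
  for \<Theta> :: "('c, 'f, 'p) sig" and L :: "'a gorder" and B :: "'a multialgebra"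
    and S :: "('c, 'f, 'p eqsym, 'u, 'a) fostruct"
    and v :: "('c + 'u, 'f, 'p eqsym) fm \<Rightarrow> 'a snapshot" +
  assumes leibniz: "\<And>x y \<phi> \<phi>' \<mu>.
      \<lbrakk>\<phi> \<in> For (diag_sig (with_eq \<Theta>) (univ S)); free_for (Var y) x \<phi>; some_repl x y \<phi> \<phi>';
       \<mu> \<in> assignments S\<rbrakk> \<Longrightarrow>
      v (inst \<mu> ((Var x \<^bold>\<approx> Var y) \<^bold>\<longrightarrow> (\<phi> \<^bold>\<longrightarrow> \<phi>'))) \<in> designated L B"

definition consequence_over ::
    "('c, 'f, 'p) sig \<Rightarrow> 'a gorder \<Rightarrow> 'a multialgebra \<Rightarrow> ('c, 'f, 'p eqsym, 'u, 'a) fostruct \<Rightarrow>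
     ('c, 'f, 'p eqsym) fm set \<Rightarrow> ('c, 'f, 'p eqsym) fm \<Rightarrow> bool" where
  "consequence_over \<Theta> L B S \<Gamma> \<phi> \<longleftrightarrow>
     (\<forall>v. qmbc_eq_valuation \<Theta> L B S v \<longrightarrow>
        (\<forall>\<gamma>\<in>\<Gamma>. \<forall>\<mu>\<in>assignments S. v (inst \<mu> (embed \<gamma>)) \<in> designated L B) \<longrightarrow>
        (\<forall>\<mu>\<in>assignments S. v (inst \<mu> (embed \<phi>)) \<in> designated L B))"

text \<open>
  HOL cannot quantify over types inside a formula, so consequence is relative to two types: the
  carriers of the complete Boolean algebras are arbitrary subsets of \<open>'a\<close>, and the domains of the
  structures are arbitrary subsets of \<open>'u\<close>.  Consequence with respect to all swap structures and
  all structures entails \<open>qmbc_consequence TYPE('a) TYPE('u)\<close> for every choice of types.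
\<close>

definition qmbc_consequence ::
    "'a itself \<Rightarrow> 'u itself \<Rightarrow> ('c, 'f, 'p) sig \<Rightarrow>
     ('c, 'f, 'p eqsym) fm set \<Rightarrow> ('c, 'f, 'p eqsym) fm \<Rightarrow> bool" where
  "qmbc_consequence _ _ \<Theta> \<Gamma> \<phi> \<longleftrightarrow>
     (\<forall>(L :: 'a gorder) B (S :: ('c, 'f, 'p eqsym, 'u, 'a) fostruct).
        complete_boolean_lattice L \<longrightarrow> swap_structure L B \<longrightarrow>
        fo_structure (with_eq \<Theta>) B S \<longrightarrow> standard_equality L B S \<longrightarrow>
        consequence_over \<Theta> L B S \<Gamma> \<phi>)"

text \<open>
  The type of sets of formulas is infinite and, by Cantor, larger than the set of formulas.  Up to
  isomorphism its subsets thus include all domains and all algebras whose cardinality is at most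
  that of the power set of the language, for a signature of any cardinality.
\<close>

type_synonym ('c, 'f, 'p) universe = "('c, 'f, 'p eqsym) fm set"

end

theory Submission
  imports Defs
begin

text \<open>
  Completeness is obtained from a Boolean-valued term model; no Henkin constants and no maximal
  theories are needed.  Standard equality only requires \<open>a \<approx> b\<close> to have the value \<open>1\<close> exactly when
  \<open>a = b\<close>, and this holds for terms modulo provable equality if truth values are taken in a completion
  of the Lindenbaum algebra of \<open>\<Gamma>\<close>.  The completion consists of the regular sets of consistent formulas
  ordered by provable implication; a formula \<open>\<phi>\<close> gets the snapshot of the values of \<open>\<phi>\<close>, \<open>\<not>\<phi>\<close> and
  \<open>\<circ>\<phi>\<close>.  A quantified formula is the infimum (supremum) of its term instances, because a variable not
  occurring in a given formula is available and the calculus generalizes over it.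

  To interpret sentences with names of individuals without capture, the individuals are classes of
  terms all of whose variables are odd, while bound variables are renamed to even numbers.
\<close>

section \<open>The regular open algebra of a preorder\<close>

text \<open>The obstacle is that \<open>\<not>\<close> and \<open>\<circ>\<close> are not
  congruential: provably equivalent formulas may have inequivalent negations, so a formula cannot be
  replaced by its class in the Lindenbaum algebra. Swap structures absorb this, because a
  multioperation fixes only the first coordinate of its result; the other two coordinates record the
  independent behaviour of \<open>\<not>\<phi>\<close> and \<open>\<circ>\<phi>\<close>. Provably
  equal terms can still be exchanged in every context, since AxEq2 is a schema over all formulas;
  this makes the term model well defined. Two conditions on valuations ask for equality of whole
  snapshots: for variants, and for a term against the name of its value. The first is met by
  evaluating a normal form that variants share literally. In the second, both sides become normal
  forms of one formula at provably equal terms. The completion must keep those suprema and infima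
  that quantified formulas already are among formulas; the regular sets do so.\<close>

locale forcing =
  fixes P :: "'a set" and le :: "'a \<Rightarrow> 'a \<Rightarrow> bool"  (infix \<open>\<preceq>\<close> 50)
  assumes le_refl: "p \<in> P \<Longrightarrow> p \<preceq> p"
    and le_trans: "p \<preceq> q \<Longrightarrow> q \<preceq> r \<Longrightarrow> p \<in> P \<Longrightarrow> q \<in> P \<Longrightarrow> r \<in> P \<Longrightarrow> p \<preceq> r"
begin

text \<open>These are the regular open sets of the topology whose open sets are the downward closed
  ones: a point belongs to the set iff the set is dense below it. Downward closure is contained in
  the equivalence, by transitivity.\<close>

definition regular :: "'a set \<Rightarrow> bool" where
  "regular X \<longleftrightarrow> X \<subseteq> P \<and>
     (\<forall>p\<in>P. p \<in> X \<longleftrightarrow> (\<forall>q\<in>P. q \<preceq> p \<longrightarrow> (\<exists>r\<in>P. r \<preceq> q \<and> r \<in> X)))"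

definition regulars :: "'a set gorder" where
  "regulars = \<lparr>carrier = {X. regular X}, eq = (=), le = (\<subseteq>)\<rparr>"

text \<open>Interior of the closure in the same topology. It contains \<open>X\<close> if
  \<open>X\<close> is downward closed, but not for arbitrary \<open>X\<close>.\<close>

definition regularization :: "'a set \<Rightarrow> 'a set" where
  "regularization X = {p \<in> P. \<forall>q\<in>P. q \<preceq> p \<longrightarrow> (\<exists>r\<in>P. r \<preceq> q \<and> r \<in> X)}"

definition pseudocomplement :: "'a set \<Rightarrow> 'a set" where
  "pseudocomplement X = {p \<in> P. \<forall>q\<in>P. q \<preceq> p \<longrightarrow> q \<notin> X}"

lemma carrier_regulars [simp]: "X \<in> carrier regulars \<longleftrightarrow> regular X"
  and le_regulars [simp]: "X \<sqsubseteq>\<^bsub>regulars\<^esub> Y \<longleftrightarrow> X \<subseteq> Y"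
  and eq_regulars [simp]: "eq regulars = (=)"
  by (auto simp: regulars_def)

lemma regular_subset: "regular X \<Longrightarrow> X \<subseteq> P"
  by (simp add: regular_def)

lemma regularI:
  assumes "X \<subseteq> P"
    and "\<And>p q. p \<in> X \<Longrightarrow> q \<in> P \<Longrightarrow> q \<preceq> p \<Longrightarrow> q \<in> X"
    and "\<And>p. p \<in> P \<Longrightarrow> (\<And>q. q \<in> P \<Longrightarrow> q \<preceq> p \<Longrightarrow> \<exists>r\<in>P. r \<preceq> q \<and> r \<in> X) \<Longrightarrow> p \<in> X"
  shows "regular X"
  unfolding regular_def using assms le_refl by blast

lemma regular_downD: "regular X \<Longrightarrow> p \<in> X \<Longrightarrow> q \<in> P \<Longrightarrow> q \<preceq> p \<Longrightarrow> q \<in> X"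
  unfolding regular_def by (meson le_trans subsetD)

lemma regular_denseD:
  "regular X \<Longrightarrow> p \<in> P \<Longrightarrow> (\<And>q. q \<in> P \<Longrightarrow> q \<preceq> p \<Longrightarrow> \<exists>r\<in>P. r \<preceq> q \<and> r \<in> X) \<Longrightarrow> p \<in> X"
  unfolding regular_def by blast

lemma regular_carrier: "regular P"
  by (rule regularI) auto

lemma regular_empty: "regular {}"
  by (rule regularI) (use le_refl in auto)

text \<open>The intersection with \<open>P\<close> matters for the empty family, whose infimum has
  to be \<open>P\<close>.\<close>

lemma regular_Inter: "(\<And>X. X \<in> A \<Longrightarrow> regular X) \<Longrightarrow> regular (P \<inter> \<Inter>A)"
proof (rule regularI)
  fix p q assume "\<And>X. X \<in> A \<Longrightarrow> regular X" "p \<in> P \<inter> \<Inter>A" "q \<in> P" "q \<preceq> p"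
  then show "q \<in> P \<inter> \<Inter>A" using regular_downD by blast
next
  fix p assume A: "\<And>X. X \<in> A \<Longrightarrow> regular X" and p: "p \<in> P"
    and *: "\<And>q. q \<in> P \<Longrightarrow> q \<preceq> p \<Longrightarrow> \<exists>r\<in>P. r \<preceq> q \<and> r \<in> P \<inter> \<Inter>A"
  show "p \<in> P \<inter> \<Inter>A"
  proof (intro IntI InterI p)
    fix X assume "X \<in> A"
    then show "p \<in> X" using * by (intro regular_denseD[OF A p]) blast+
  qed
qed simp

lemma regular_Int: "regular X \<Longrightarrow> regular Y \<Longrightarrow> regular (X \<inter> Y)"
  using regular_Inter[of "{X, Y}"] regular_subset[of X] by (auto simp: Int_absorb1 inf.assoc[symmetric])

lemma regular_regularization: "regular (regularization X)"
proof (rule regularI)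
  fix p assume p: "p \<in> P"
    and *: "\<And>q. q \<in> P \<Longrightarrow> q \<preceq> p \<Longrightarrow> \<exists>r\<in>P. r \<preceq> q \<and> r \<in> regularization X"
  show "p \<in> regularization X"
    unfolding regularization_def
  proof (intro CollectI conjI ballI impI p)
    fix q assume q: "q \<in> P" "q \<preceq> p"
    then obtain r where r: "r \<in> P" "r \<preceq> q" "r \<in> regularization X" using * by blast
    then obtain s where "s \<in> P" "s \<preceq> r" "s \<in> X"
      unfolding regularization_def using le_refl by blast
    then show "\<exists>r\<in>P. r \<preceq> q \<and> r \<in> X" using r q le_trans by blast
  qed
qed (auto simp: regularization_def intro: le_trans)

lemma regular_pseudocomplement: "regular X \<Longrightarrow> regular (pseudocomplement X)"
proof (rule regularI)
  fix p assume X: "regular X" and p: "p \<in> P"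
    and *: "\<And>q. q \<in> P \<Longrightarrow> q \<preceq> p \<Longrightarrow> \<exists>r\<in>P. r \<preceq> q \<and> r \<in> pseudocomplement X"
  show "p \<in> pseudocomplement X"
    unfolding pseudocomplement_def
  proof (intro CollectI conjI ballI impI p notI)
    fix q assume q: "q \<in> P" "q \<preceq> p" "q \<in> X"
    then obtain r where "r \<in> P" "r \<preceq> q" "r \<in> pseudocomplement X" using * by blast
    then show False
      using regular_downD[OF X q(3), of r] le_refl[of r] unfolding pseudocomplement_def by blast
  qed
qed (auto simp: pseudocomplement_def intro: le_trans)

lemma subset_regularization: "(\<And>p q. p \<in> X \<Longrightarrow> q \<in> P \<Longrightarrow> q \<preceq> p \<Longrightarrow> q \<in> X) \<Longrightarrow> X \<subseteq> P \<Longrightarrow>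
    X \<subseteq> regularization X"
  unfolding regularization_def using le_refl by blast

lemma regularization_least: "X \<subseteq> Y \<Longrightarrow> regular Y \<Longrightarrow> regularization X \<subseteq> Y"
proof
  fix p assume "X \<subseteq> Y" "regular Y" "p \<in> regularization X"
  then show "p \<in> Y"
    unfolding regularization_def by (intro regular_denseD[of Y p]) blast+
qed

text \<open>A union of regular sets need not be regular; by \<open>regularization_least\<close> its
  regularization is the least regular set above it.\<close>

lemma least_regulars:
  assumes "A \<subseteq> carrier regulars"
  shows "least regulars (regularization (\<Union>A)) (Upper regulars A)"
proof -
  have "regular X" if "X \<in> A" for X
    using that assms by auto
  then have "\<Union>A \<subseteq> regularization (\<Union>A)"
    using regular_downD regular_subset by (intro subset_regularization) blast+
  then have "X \<subseteq> regularization (\<Union>A)" if "X \<in> A" for X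
    using that by blast
  then show ?thesis
    unfolding least_def Upper_def
    using assms by (auto simp: regular_regularization subset_iff) (metis Sup_least regularization_least subsetD subsetI)
qed

lemma greatest_regulars:
  assumes "A \<subseteq> carrier regulars"
  shows "greatest regulars (P \<inter> \<Inter>A) (Lower regulars A)"
proof -
  have "regular (P \<inter> \<Inter>A)" using assms by (auto intro!: regular_Inter)
  then show ?thesis
    unfolding greatest_def Lower_def using assms regular_subset by (auto simp: subset_iff)
qed

lemma least_regulars_unique: "least regulars X A \<Longrightarrow> least regulars Y A \<Longrightarrow> X = Y"
  unfolding least_def le_regulars by blast

lemma greatest_regulars_unique: "greatest regulars X A \<Longrightarrow> greatest regulars Y A \<Longrightarrow> X = Y"
  unfolding greatest_def le_regulars by blast

text \<open>\<open>sup\<close> is a Hilbert choice among least upper bounds, so uniqueness has to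
  accompany existence before an equation results.\<close>

lemma sup_regulars: "A \<subseteq> carrier regulars \<Longrightarrow> \<Squnion>\<^bsub>regulars\<^esub> A = regularization (\<Union>A)"
  unfolding sup_def by (rule some_equality, erule least_regulars) (erule least_regulars_unique, erule least_regulars)

lemma inf_regulars: "A \<subseteq> carrier regulars \<Longrightarrow> \<Sqinter>\<^bsub>regulars\<^esub> A = P \<inter> \<Inter>A"
  unfolding inf_def by (rule some_equality, erule greatest_regulars) (erule greatest_regulars_unique, erule greatest_regulars)

lemma join_regulars: "regular X \<Longrightarrow> regular Y \<Longrightarrow> X \<squnion>\<^bsub>regulars\<^esub> Y = regularization (X \<union> Y)"
  by (simp add: join_def sup_regulars)

lemma meet_regulars: "regular X \<Longrightarrow> regular Y \<Longrightarrow> X \<sqinter>\<^bsub>regulars\<^esub> Y = X \<inter> Y"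
  using regular_subset by (auto simp: meet_def inf_regulars)

section \<open>The regular sets as a complete Boolean lattice\<close>

sublocale regulars: complete_lattice regulars
proof -
  interpret partial_order regulars
    by unfold_locales auto
  show "complete_lattice regulars"
    by unfold_locales (blast dest: least_regulars greatest_regulars)+
qed

lemma top_regulars: "\<top>\<^bsub>regulars\<^esub> = P"
proof -
  have *: "greatest regulars P (carrier regulars)"
    using regular_carrier regular_subset by (auto simp: greatest_def)
  then show ?thesis
    unfolding top_def by (rule some_equality) (rule greatest_regulars_unique[OF _ *])
qed

lemma bottom_regulars: "\<bottom>\<^bsub>regulars\<^esub> = {}"
proof -
  have *: "least regulars {} (carrier regulars)"
    using regular_empty by (auto simp: least_def)
  then show ?thesis
    unfolding bottom_def by (rule some_equality) (rule least_regulars_unique[OF _ *])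
qed

lemma pseudocomplement_meet: "X \<inter> pseudocomplement X = {}"
  unfolding pseudocomplement_def using le_refl by blast

text \<open>Each \<open>q\<close> either avoids \<open>X\<close> everywhere below it or has a point
  of \<open>X\<close> below it. So the union is dense, although in general it is not all of
  \<open>P\<close>.\<close>

lemma pseudocomplement_join: "regularization (X \<union> pseudocomplement X) = P"
proof -
  have "\<exists>r\<in>P. r \<preceq> q \<and> r \<in> X \<union> pseudocomplement X" if "q \<in> P" for q
    using that le_refl[of q] unfolding pseudocomplement_def by (cases "q \<in> pseudocomplement X") auto
  then show ?thesis unfolding regularization_def by blast
qed

text \<open>Below a point of the left-hand side there is a further point in \<open>Y\<close> or
  \<open>Z\<close>, and downward closure keeps it in \<open>X\<close>.\<close>

lemma regularization_distrib:
  assumes "regular X" "regular Y" "regular Z"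
  shows "X \<inter> regularization (Y \<union> Z) = regularization (X \<inter> Y \<union> X \<inter> Z)" (is "?l = ?r")
proof
  show "?l \<subseteq> ?r"
  proof
    fix p assume p: "p \<in> ?l"
    then have "\<exists>r\<in>P. r \<preceq> q \<and> r \<in> X \<inter> Y \<union> X \<inter> Z" if q: "q \<in> P" "q \<preceq> p" for q
    proof -
      obtain r where r: "r \<in> P" "r \<preceq> q" "r \<in> Y \<union> Z"
        using p q unfolding regularization_def by blast
      moreover have "r \<in> X"
        using p q r(1,2) regular_downD[OF assms(1)] by blast
      ultimately show ?thesis by blast
    qed
    then show "p \<in> ?r" using p unfolding regularization_def by blast
  qed
  have "regularization (X \<inter> Y \<union> X \<inter> Z) \<subseteq> X"
    using assms by (intro regularization_least) auto
  moreover have "regularization (X \<inter> Y \<union> X \<inter> Z) \<subseteq> regularization (Y \<union> Z)"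
    unfolding regularization_def by blast
  ultimately show "?r \<subseteq> ?l" by blast
qed

sublocale regulars: complete_boolean_lattice regulars
proof unfold_locales
  fix X Y Z assume "X \<in> carrier regulars" "Y \<in> carrier regulars" "Z \<in> carrier regulars"
  then show "X \<sqinter>\<^bsub>regulars\<^esub> (Y \<squnion>\<^bsub>regulars\<^esub> Z) = (X \<sqinter>\<^bsub>regulars\<^esub> Y) \<squnion>\<^bsub>regulars\<^esub> (X \<sqinter>\<^bsub>regulars\<^esub> Z)"
    by (simp add: join_regulars meet_regulars regular_regularization regular_Int regularization_distrib)
next
  fix X assume "X \<in> carrier regulars"
  then show "\<exists>Y\<in>carrier regulars. X \<sqinter>\<^bsub>regulars\<^esub> Y = \<bottom>\<^bsub>regulars\<^esub> \<and> X \<squnion>\<^bsub>regulars\<^esub> Y = \<top>\<^bsub>regulars\<^esub>"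
    by (intro bexI[of _ "pseudocomplement X"])
      (simp_all add: regular_pseudocomplement meet_regulars join_regulars bottom_regulars top_regulars
        pseudocomplement_meet pseudocomplement_join)
qed

lemma compl_regulars:
  assumes X: "regular X"
  shows "compl regulars X = pseudocomplement X"
  unfolding compl_def
proof (rule the_equality)
  show "pseudocomplement X \<in> carrier regulars \<and> X \<sqinter>\<^bsub>regulars\<^esub> pseudocomplement X = \<bottom>\<^bsub>regulars\<^esub> \<and>
      X \<squnion>\<^bsub>regulars\<^esub> pseudocomplement X = \<top>\<^bsub>regulars\<^esub>"
    using X by (simp add: regular_pseudocomplement meet_regulars join_regulars bottom_regulars top_regulars
        pseudocomplement_meet pseudocomplement_join)
next
  fix Y assume "Y \<in> carrier regulars \<and> X \<sqinter>\<^bsub>regulars\<^esub> Y = \<bottom>\<^bsub>regulars\<^esub> \<and>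
      X \<squnion>\<^bsub>regulars\<^esub> Y = \<top>\<^bsub>regulars\<^esub>"
  then have Y: "regular Y" "X \<inter> Y = {}" "regularization (X \<union> Y) = P"
    using X by (auto simp: meet_regulars join_regulars bottom_regulars top_regulars)
  show "Y = pseudocomplement X"
  proof
    show "Y \<subseteq> pseudocomplement X"
      unfolding pseudocomplement_def using Y regular_subset[OF Y(1)] regular_downD[OF Y(1)] by blast
    show "pseudocomplement X \<subseteq> Y"
    proof
      fix p assume p: "p \<in> pseudocomplement X"
      show "p \<in> Y"
      proof (rule regular_denseD[OF Y(1)])
        show "p \<in> P" using p by (simp add: pseudocomplement_def)
        fix q assume q: "q \<in> P" "q \<preceq> p"
        then obtain r where "r \<in> P" "r \<preceq> q" "r \<in> X \<union> Y"
          using Y(3) le_refl unfolding regularization_def by blast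
        then show "\<exists>r\<in>P. r \<preceq> q \<and> r \<in> Y"
          using p q le_trans \<open>p \<in> P\<close> unfolding pseudocomplement_def by blast
      qed
    qed
  qed
qed

text \<open>The forcing clause for implication. This form, rather than complement joined with
  \<open>Y\<close>, is the one that matches derivability in \<open>val_impl\<close>.\<close>

lemma impl_regulars:
  assumes "regular X" "regular Y"
  shows "ba_op regulars Impl X Y = {p \<in> P. \<forall>q\<in>P. q \<preceq> p \<longrightarrow> q \<in> X \<longrightarrow> q \<in> Y}"
proof -
  have "regularization (pseudocomplement X \<union> Y) \<subseteq> {p \<in> P. \<forall>q\<in>P. q \<preceq> p \<longrightarrow> q \<in> X \<longrightarrow> q \<in> Y}"
  proof (intro subsetI CollectI conjI ballI impI)
    fix p assume p: "p \<in> regularization (pseudocomplement X \<union> Y)"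
    then show pP: "p \<in> P" by (simp add: regularization_def)
    fix q assume q: "q \<in> P" "q \<preceq> p" "q \<in> X"
    show "q \<in> Y"
    proof (rule regular_denseD[OF assms(2) q(1)])
      fix s assume s: "s \<in> P" "s \<preceq> q"
      then have "s \<preceq> p" using q pP le_trans by blast
      then obtain r where r: "r \<in> P" "r \<preceq> s" "r \<in> pseudocomplement X \<union> Y"
        using p s unfolding regularization_def by blast
      then have "r \<in> X"
        using q s le_trans regular_downD[OF assms(1)] by blast
      then show "\<exists>r\<in>P. r \<preceq> s \<and> r \<in> Y"
        using r pseudocomplement_meet by blast
    qed
  qed
  moreover have "{p \<in> P. \<forall>q\<in>P. q \<preceq> p \<longrightarrow> q \<in> X \<longrightarrow> q \<in> Y} \<subseteq> regularization (pseudocomplement X \<union> Y)"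
  proof
    fix p assume p: "p \<in> {p \<in> P. \<forall>q\<in>P. q \<preceq> p \<longrightarrow> q \<in> X \<longrightarrow> q \<in> Y}"
    have "\<exists>r\<in>P. r \<preceq> q \<and> r \<in> pseudocomplement X \<union> Y" if q: "q \<in> P" "q \<preceq> p" for q
    proof (cases "q \<in> pseudocomplement X")
      case True
      then show ?thesis using q le_refl by blast
    next
      case False
      then obtain r where "r \<in> P" "r \<preceq> q" "r \<in> X" using q unfolding pseudocomplement_def by blast
      then show ?thesis using p q le_trans by blast
    qed
    then show "p \<in> regularization (pseudocomplement X \<union> Y)"
      using p unfolding regularization_def by blast
  qed
  ultimately show ?thesis
    using assms by (simp add: compl_regulars join_regulars regular_pseudocomplement)
qed

end

section \<open>Substitution\<close>

primrec avars :: "('c, 'f, 'p) fm \<Rightarrow> nat set" where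
  "avars (Atom P ts) = \<Union> (set (map tvars ts))"
| "avars (Unary u \<phi>) = avars \<phi>"
| "avars (Binary b \<phi> \<psi>) = avars \<phi> \<union> avars \<psi>"
| "avars (Quant q x \<phi>) = insert x (avars \<phi>)"

lemma finite_tvars [simp]: "finite (tvars t)"
  by (induction t) auto

lemma finite_avars [simp]: "finite (avars \<phi>)"
  by (induction \<phi>) auto

lemma fv_subset_avars: "fv \<phi> \<subseteq> avars \<phi>"
  by (induction \<phi>) auto

lemma finite_fv [simp]: "finite (fv \<phi>)"
  using finite_subset[OF fv_subset_avars] by simp

lemma finite_constants_tm [simp]: "finite (set1_tm t)"
  by (induction t) auto

lemma finite_constants [simp]: "finite (set1_fm \<phi>)"
  by (induction \<phi>) auto

lemma tvars_tsubst: "tvars (tsubst \<sigma> t) = (\<Union>x\<in>tvars t. tvars (\<sigma> x))"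
  by (induction t) auto

lemma tsubst_cong: "(\<And>x. x \<in> tvars t \<Longrightarrow> \<sigma> x = \<sigma>' x) \<Longrightarrow> tsubst \<sigma> t = tsubst \<sigma>' t"
  by (induction t) auto

lemma tsubst_Var [simp]: "tsubst Var t = t"
  by (induction t) (auto intro: map_idI)

lemma tsubst_fresh: "x \<notin> tvars t \<Longrightarrow> tsubst (Var(x := s)) t = t"
  by (subst tsubst_cong[of _ _ Var]) auto

lemma psubst_cong: "(\<And>x. x \<in> fv \<phi> \<Longrightarrow> \<sigma> x = \<sigma>' x) \<Longrightarrow> psubst \<sigma> \<phi> = psubst \<sigma>' \<phi>"
proof (induction \<phi> arbitrary: \<sigma> \<sigma>')
  case (Atom P ts)
  then show ?case by (auto intro!: tsubst_cong)
next
  case (Quant q x \<phi>)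
  have "psubst (\<sigma>(x := Var x)) \<phi> = psubst (\<sigma>'(x := Var x)) \<phi>"
    by (rule Quant.IH) (use Quant.prems in auto)
  then show ?case by simp
next
  case (Unary u \<phi>)
  show ?case using Unary.IH[of \<sigma> \<sigma>'] Unary.prems by simp
next
  case (Binary c \<phi> \<psi>)
  show ?case using Binary.IH(1)[of \<sigma> \<sigma>'] Binary.IH(2)[of \<sigma> \<sigma>'] Binary.prems by simp
qed

lemma psubst_Var [simp]: "psubst Var \<phi> = \<phi>"
  by (induction \<phi>) (auto intro: map_idI)

lemma subst_fresh: "x \<notin> fv \<phi> \<Longrightarrow> subst \<phi> x t = \<phi>"
  unfolding subst_def by (subst psubst_cong[of _ _ Var]) auto

lemma subst_simps [simp]:
  "subst (Atom P ts) x t = Atom P (map (tsubst (Var(x := t))) ts)"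
  "subst (Unary u \<phi>) x t = Unary u (subst \<phi> x t)"
  "subst (Binary b \<phi> \<psi>) x t = Binary b (subst \<phi> x t) (subst \<psi> x t)"
  by (simp_all add: subst_def)

lemma subst_Quant: "subst (Quant q y \<phi>) x t = Quant q y (if x = y then \<phi> else subst \<phi> x t)"
proof (cases "x = y")
  case False
  then have "(Var(x := t))(y := Var y) = Var(x := t)" by auto
  then show ?thesis using False by (simp only: subst_def psubst.simps if_False)
qed (simp add: subst_def)

lemma size_tsubst_Var: "(\<And>x. \<exists>y. \<sigma> x = Var y) \<Longrightarrow> size (tsubst \<sigma> t) = size t"
proof (induction t)
  case (Var x)
  then obtain y where "\<sigma> x = Var y" by blast
  then show ?case by simp
next
  case (App f ts)
  then have "map (size \<circ> tsubst \<sigma>) ts = map size ts" by simp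
  then show ?case by (simp add: size_list_conv_sum_list del: map_eq_conv)
qed simp

text \<open>Lets an induction on size pass from the scope of a quantifier to a copy of it with the
  bound variable renamed.\<close>

lemma size_psubst_Var: "(\<And>x. \<exists>y. \<sigma> x = Var y) \<Longrightarrow> size (psubst \<sigma> \<phi>) = size \<phi>"
proof (induction \<phi> arbitrary: \<sigma>)
  case (Atom P ts)
  then have "size \<circ> tsubst \<sigma> = size" by (auto simp: size_tsubst_Var)
  then show ?case by simp
next
  case (Quant q x \<phi>)
  have "size (psubst (\<sigma>(x := Var x)) \<phi>) = size \<phi>"
    by (rule Quant.IH) (use Quant.prems in auto)
  then show ?case by simp
qed auto

text \<open>\<open>no_capture \<tau> \<phi>\<close> is the simultaneous form of \<open>free_for\<close>.\<close>

primrec no_capture :: "(nat \<Rightarrow> ('c, 'f) tm) \<Rightarrow> ('c, 'f, 'p) fm \<Rightarrow> bool" where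
  "no_capture \<tau> (Atom P ts) \<longleftrightarrow> True"
| "no_capture \<tau> (Unary u \<phi>) \<longleftrightarrow> no_capture \<tau> \<phi>"
| "no_capture \<tau> (Binary b \<phi> \<psi>) \<longleftrightarrow> no_capture \<tau> \<phi> \<and> no_capture \<tau> \<psi>"
| "no_capture \<tau> (Quant q x \<phi>) \<longleftrightarrow>
     (\<forall>y\<in>fv \<phi> - {x}. x \<notin> tvars (\<tau> y)) \<and> no_capture (\<tau>(x := Var x)) \<phi>"

lemma no_capture_cong: "(\<And>x. x \<in> fv \<phi> \<Longrightarrow> \<sigma> x = \<sigma>' x) \<Longrightarrow> no_capture \<sigma> \<phi> = no_capture \<sigma>' \<phi>"
proof (induction \<phi> arbitrary: \<sigma> \<sigma>')
  case (Unary u \<phi>)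
  show ?case using Unary.IH[of \<sigma> \<sigma>'] Unary.prems by simp
next
  case (Binary c \<phi> \<psi>)
  show ?case using Binary.IH(1)[of \<sigma> \<sigma>'] Binary.IH(2)[of \<sigma> \<sigma>'] Binary.prems by simp
next
  case (Quant q x \<phi>)
  have "no_capture (\<sigma>(x := Var x)) \<phi> = no_capture (\<sigma>'(x := Var x)) \<phi>"
    by (rule Quant.IH) (use Quant.prems in auto)
  then show ?case using Quant.prems by auto
qed simp

text \<open>Covers the substitutions that cannot capture: the identity, and replacement by names of
  individuals.\<close>

lemma no_capture_closed:
  "(\<And>x. \<sigma> x = Var x \<or> tvars (\<sigma> x) = {}) \<Longrightarrow> no_capture \<sigma> \<phi>"
proof (induction \<phi> arbitrary: \<sigma>)
  case (Quant q x \<phi>)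
  have "no_capture (\<sigma>(x := Var x)) \<phi>"
    by (rule Quant.IH) (use Quant.prems in auto)
  moreover have "x \<notin> tvars (\<sigma> y)" if "y \<noteq> x" for y
    using Quant.prems[of y] that by auto
  ultimately show ?case by auto
qed auto

lemma no_capture_subst: "free_for t x \<phi> \<Longrightarrow> no_capture (Var(x := t)) \<phi>"
proof (induction \<phi>)
  case (Quant q y \<phi>)
  have closed: "no_capture Var \<phi>" by (rule no_capture_closed) simp
  show ?case
  proof (cases "x \<in> fv (Quant q y \<phi>)")
    case True
    then have "(Var(x := t))(y := Var y) = Var(x := t)" by auto
    then show ?thesis using True Quant by (auto simp del: fun_upd_apply) (auto split: if_splits)
  next
    case False
    then have "no_capture ((Var(x := t))(y := Var y)) \<phi> = no_capture Var \<phi>"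
      by (intro no_capture_cong) auto
    moreover have "y \<notin> tvars ((Var(x := t)) z)" if "z \<in> fv \<phi> - {y}" for z
      using that False by auto
    ultimately show ?thesis using closed by (simp only: no_capture.simps) blast
  qed
qed auto

lemma fv_psubst: "no_capture \<tau> \<phi> \<Longrightarrow> fv (psubst \<tau> \<phi>) = (\<Union>x\<in>fv \<phi>. tvars (\<tau> x))"
proof (induction \<phi> arbitrary: \<tau>)
  case (Atom P ts)
  then show ?case by (auto simp: tvars_tsubst)
next
  case (Quant q x \<phi>)
  then have "fv (psubst (\<tau>(x := Var x)) \<phi>) = (\<Union>y\<in>fv \<phi>. tvars ((\<tau>(x := Var x)) y))"
    by (simp del: fun_upd_apply)
  moreover have "\<forall>y\<in>fv \<phi> - {x}. x \<notin> tvars (\<tau> y)" using Quant.prems by simp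
  ultimately show ?case by (auto split: if_splits)
qed auto

section \<open>Partial replacement of a variable\<close>

lemma some_repl_subst: "free_for (Var y) x \<phi> \<Longrightarrow> some_repl x y \<phi> (subst \<phi> x (Var y))"
proof (induction \<phi>)
  case (Atom P ts)
  have "some_repl_tm x y t (tsubst (Var(x := Var y)) t)" for t :: "('a, 'b) tm"
    by (induction t) (auto intro: some_repl_tm.intros simp: list_all2_conv_all_nth)
  then show ?case
    by (auto intro!: some_repl.intros simp: list_all2_conv_all_nth)
next
  case (Quant q z \<phi>)
  show ?case
  proof (cases "x \<in> fv (Quant q z \<phi>)")
    case True
    then show ?thesis using Quant by (auto simp: subst_Quant intro: some_repl.intros)
  next
    case False
    then show ?thesis unfolding subst_fresh[OF False] by (intro some_repl.intros)
  qed
qed (auto intro: some_repl.intros)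

lemma some_repl_tm_obtain:
  assumes "some_repl_tm x y t t'" "w \<notin> tvars t"
  shows "\<exists>s. t = tsubst (Var(w := Var x)) s \<and> t' = tsubst (Var(w := Var y)) s"
  using assms
proof (induction t t' rule: some_repl_tm.induct)
  case (1 t)
  then have "tsubst (Var(w := Var z)) t = t" for z
    by (subst tsubst_cong[of _ _ Var]) auto
  then show ?case by metis
next
  case 2
  show ?case by (rule exI[of _ "Var w"]) simp
next
  case (3 ts ts' f)
  then have "\<forall>i<length ts. \<exists>s. ts ! i = tsubst (Var(w := Var x)) s \<and> ts' ! i = tsubst (Var(w := Var y)) s"
    by (auto simp: list_all2_conv_all_nth simp del: fun_upd_apply)
  then obtain s where "\<forall>i<length ts. ts ! i = tsubst (Var(w := Var x)) (s i) \<and>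
      ts' ! i = tsubst (Var(w := Var y)) (s i)" by metis
  with 3 show ?case
    by (intro exI[of _ "App f (map s [0..<length ts])"])
      (auto intro!: nth_equalityI simp: list_all2_conv_all_nth simp del: fun_upd_apply)
qed

lemma some_repl_fresh: "some_repl x y \<phi> \<phi>' \<Longrightarrow> x \<notin> fv \<phi> \<Longrightarrow> \<phi>' = \<phi>"
proof (induction \<phi> \<phi>' rule: some_repl.induct)
  case (2 ts ts' P)
  have "some_repl_tm x y t t' \<Longrightarrow> x \<notin> tvars t \<Longrightarrow> t' = t" for t t' :: "('a, 'b) tm"
    by (induction t t' rule: some_repl_tm.induct) (auto simp: list_all2_conv_all_nth intro: nth_equalityI)
  with 2 show ?case by (auto simp: list_all2_conv_all_nth intro!: nth_equalityI)
qed auto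

text \<open>The fresh variable \<open>w\<close> marks the occurrences that are actually replaced, so
  both formulas are full substitution instances of one template \<open>\<chi>\<close>. The semantic
  form of AxEq2 thereby reduces to changing the value of \<open>w\<close>.\<close>

lemma some_repl_obtain:
  assumes "some_repl x y \<phi> \<phi>'" "free_for (Var y) x \<phi>" "w \<notin> avars \<phi>" "w \<noteq> x"
  shows "\<exists>\<chi>. \<phi> = subst \<chi> w (Var x) \<and> \<phi>' = subst \<chi> w (Var y) \<and>
    free_for (Var x) w \<chi> \<and> free_for (Var y) w \<chi>"
  using assms
proof (induction \<phi> \<phi>' rule: some_repl.induct)
  case (1 \<phi>)
  have "w \<notin> fv \<phi>" using 1 fv_subset_avars by blast
  moreover from this have "free_for t w \<phi>" for t by (induction \<phi>) auto
  ultimately show ?case by (metis subst_fresh)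
next
  case (2 ts ts' P)
  then have "\<forall>i<length ts. \<exists>s. ts ! i = tsubst (Var(w := Var x)) s \<and> ts' ! i = tsubst (Var(w := Var y)) s"
    by (intro allI impI some_repl_tm_obtain) (auto simp: list_all2_conv_all_nth)
  then obtain s where "\<forall>i<length ts. ts ! i = tsubst (Var(w := Var x)) (s i) \<and>
      ts' ! i = tsubst (Var(w := Var y)) (s i)" by metis
  with 2 show ?case
    by (intro exI[of _ "Atom P (map s [0..<length ts])"])
      (auto intro!: nth_equalityI simp: list_all2_conv_all_nth simp del: fun_upd_apply)
next
  case (3 \<phi> \<phi>' u)
  then obtain \<chi> where "\<phi> = subst \<chi> w (Var x) \<and> \<phi>' = subst \<chi> w (Var y) \<and>
    free_for (Var x) w \<chi> \<and> free_for (Var y) w \<chi>" by auto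
  then show ?case by (intro exI[of _ "Unary u \<chi>"]) simp
next
  case (4 \<phi> \<phi>' \<psi> \<psi>' b)
  then obtain \<chi> \<xi> where "\<phi> = subst \<chi> w (Var x) \<and> \<phi>' = subst \<chi> w (Var y) \<and>
    free_for (Var x) w \<chi> \<and> free_for (Var y) w \<chi>" "\<psi> = subst \<xi> w (Var x) \<and> \<psi>' = subst \<xi> w (Var y) \<and>
    free_for (Var x) w \<xi> \<and> free_for (Var y) w \<xi>" by auto
  then show ?case by (intro exI[of _ "Binary b \<chi> \<xi>"]) simp
next
  case (5 z \<phi> \<phi>' q)
  show ?case
  proof (cases "x \<in> fv \<phi>")
    case True
    \<comment> \<open>A free \<open>x\<close> under the binder together with \<open>free_for\<close>
      forces the bound variable to differ from \<open>y\<close>.\<close>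
    then have "z \<noteq> y" using 5 by auto
    moreover obtain \<chi> where "\<phi> = subst \<chi> w (Var x) \<and> \<phi>' = subst \<chi> w (Var y) \<and>
      free_for (Var x) w \<chi> \<and> free_for (Var y) w \<chi>" using 5 True by auto
    ultimately show ?thesis using 5 by (intro exI[of _ "Quant q z \<chi>"]) (auto simp: subst_Quant)
  next
    case False
    then have "\<phi>' = \<phi>" using 5 some_repl_fresh by blast
    moreover have "w \<notin> fv (Quant q z \<phi>)" using 5 fv_subset_avars by fastforce
    moreover from this have "free_for t w (Quant q z \<phi>)" for t by auto
    ultimately show ?thesis by (metis subst_fresh)
  qed
qed

section \<open>Normal forms of variants\<close>

text \<open>Void quantifiers do not count: variants then have equal heights, and the height drops
  strictly below each quantifier that really binds.\<close>

primrec qheight :: "('c, 'f, 'p) fm \<Rightarrow> nat" where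
  "qheight (Atom P ts) = 0"
| "qheight (Unary u \<phi>) = qheight \<phi>"
| "qheight (Binary b \<phi> \<psi>) = max (qheight \<phi>) (qheight \<psi>)"
| "qheight (Quant q x \<phi>) = (if x \<in> fv \<phi> then Suc (qheight \<phi>) else qheight \<phi>)"

text \<open>Constants are interpreted along with variables, because names of individuals have to
  turn into terms of the original language. With \<open>Con\<close> for \<open>\<kappa>\<close> it
  is plain substitution.\<close>

primrec tm_interp :: "('k \<Rightarrow> ('c, 'f) tm) \<Rightarrow> (nat \<Rightarrow> ('c, 'f) tm) \<Rightarrow> ('k, 'f) tm \<Rightarrow> ('c, 'f) tm" where
  "tm_interp \<kappa> \<sigma> (Var x) = \<sigma> x"
| "tm_interp \<kappa> \<sigma> (Con c) = \<kappa> c"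
| "tm_interp \<kappa> \<sigma> (App f ts) = App f (map (tm_interp \<kappa> \<sigma>) ts)"

text \<open>Dropping the void quantifiers and naming each bound variable by the height of its scope makes
  the images of variants equal, not merely variants.  Inner binders get names with smaller indices
  than outer ones, so that no capture arises.\<close>

primrec normalize ::
    "(nat \<Rightarrow> nat) \<Rightarrow> ('k \<Rightarrow> ('c, 'f) tm) \<Rightarrow> (nat \<Rightarrow> ('c, 'f) tm) \<Rightarrow> ('k, 'f, 'p) fm \<Rightarrow> ('c, 'f, 'p) fm" where
  "normalize b \<kappa> \<sigma> (Atom P ts) = Atom P (map (tm_interp \<kappa> \<sigma>) ts)"
| "normalize b \<kappa> \<sigma> (Unary u \<phi>) = Unary u (normalize b \<kappa> \<sigma> \<phi>)"
| "normalize b \<kappa> \<sigma> (Binary c \<phi> \<psi>) = Binary c (normalize b \<kappa> \<sigma> \<phi>) (normalize b \<kappa> \<sigma> \<psi>)"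
| "normalize b \<kappa> \<sigma> (Quant q x \<phi>) =
     (if x \<in> fv \<phi> then Quant q (b (qheight \<phi>)) (normalize b \<kappa> (\<sigma>(x := Var (b (qheight \<phi>)))) \<phi>)
      else normalize b \<kappa> \<sigma> \<phi>)"

lemma tm_interp_cong:
  "(\<And>x. x \<in> tvars t \<Longrightarrow> \<sigma> x = \<sigma>' x) \<Longrightarrow> (\<And>c. c \<in> set1_tm t \<Longrightarrow> \<kappa> c = \<kappa>' c) \<Longrightarrow>
    tm_interp \<kappa> \<sigma> t = tm_interp \<kappa>' \<sigma>' t"
proof (induction t)
  case (App f ts)
  have "tm_interp \<kappa> \<sigma> t = tm_interp \<kappa>' \<sigma>' t" if "t \<in> set ts" for t
    by (rule App.IH[OF that]) (use App.prems that in auto)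
  then show ?case by simp
qed auto

lemma tvars_tm_interp: "tvars (tm_interp \<kappa> \<sigma> t) = (\<Union>x\<in>tvars t. tvars (\<sigma> x)) \<union> (\<Union>c\<in>set1_tm t. tvars (\<kappa> c))"
  by (induction t) auto

lemma tm_interp_tsubst: "tm_interp \<kappa> \<sigma> (tsubst \<tau> t) = tm_interp \<kappa> (\<lambda>x. tm_interp \<kappa> \<sigma> (\<tau> x)) t"
  by (induction t) auto

lemma tsubst_tm_interp:
  "tsubst \<tau> (tm_interp \<kappa> \<sigma> t) = tm_interp (\<lambda>c. tsubst \<tau> (\<kappa> c)) (\<lambda>x. tsubst \<tau> (\<sigma> x)) t"
  by (induction t) auto

lemma tm_interp_Con [simp]: "tm_interp Con \<sigma> t = tsubst \<sigma> t"
  by (induction t) auto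

lemma tm_interp_map: "tm_interp \<kappa> \<sigma> (map_tm g (\<lambda>f. f) t) = tm_interp (\<lambda>c. \<kappa> (g c)) \<sigma> t"
  by (induction t) auto

lemma normalize_cong:
  "(\<And>x. x \<in> fv \<phi> \<Longrightarrow> \<sigma> x = \<sigma>' x) \<Longrightarrow> (\<And>c. c \<in> set1_fm \<phi> \<Longrightarrow> \<kappa> c = \<kappa>' c) \<Longrightarrow>
    normalize b \<kappa> \<sigma> \<phi> = normalize b \<kappa>' \<sigma>' \<phi>"
proof (induction \<phi> arbitrary: \<sigma> \<sigma>')
  case (Atom P ts)
  then show ?case by (auto intro!: tm_interp_cong)
next
  case (Unary u \<phi>)
  show ?case using Unary.IH[of \<sigma> \<sigma>'] Unary.prems by simp
next
  case (Binary c \<phi> \<psi>)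
  have "normalize b \<kappa> \<sigma> \<phi> = normalize b \<kappa>' \<sigma>' \<phi>" "normalize b \<kappa> \<sigma> \<psi> = normalize b \<kappa>' \<sigma>' \<psi>"
    by (rule Binary.IH; use Binary.prems in auto)+
  then show ?case by simp
next
  case (Quant q x \<phi>)
  have "normalize b \<kappa> (\<sigma>(x := Var n)) \<phi> = normalize b \<kappa>' (\<sigma>'(x := Var n)) \<phi>" for n
    by (rule Quant.IH) (use Quant.prems in auto)
  moreover have "normalize b \<kappa> \<sigma> \<phi> = normalize b \<kappa>' \<sigma>' \<phi>" if "x \<notin> fv \<phi>"
    by (rule Quant.IH) (use Quant.prems that in auto)
  ultimately show ?case by simp
qed

lemma tvars_map_tm [simp]: "tvars (map_tm g h t) = tvars t"
  by (induction t) auto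

lemma fv_map_fm [simp]: "fv (map_fm g h k \<phi>) = fv \<phi>"
  by (induction \<phi>) auto

lemma qheight_map_fm [simp]: "qheight (map_fm g h k \<phi>) = qheight \<phi>"
  by (induction \<phi>) auto

lemma normalize_map_fm: "normalize b \<kappa> \<sigma> (map_fm g id id \<phi>) = normalize b (\<lambda>c. \<kappa> (g c)) \<sigma> \<phi>"
  by (induction \<phi> arbitrary: \<sigma>) (simp_all add: tm_interp_map id_def)

lemma qheight_psubst: "no_capture \<tau> \<phi> \<Longrightarrow> qheight (psubst \<tau> \<phi>) = qheight \<phi>"
proof (induction \<phi> arbitrary: \<tau>)
  case (Quant q x \<phi>)
  then show ?case by (auto simp: fv_psubst split: if_splits)
qed auto

text \<open>A substitution becomes a change of environment. Without capture, the terms put below a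
  binder \<open>x\<close> do not mention \<open>x\<close>, so rebinding \<open>x\<close> in the
  environment leaves their interpretation alone.\<close>

lemma normalize_psubst:
  "no_capture \<tau> \<phi> \<Longrightarrow> normalize b \<kappa> \<sigma> (psubst \<tau> \<phi>) = normalize b \<kappa> (\<lambda>x. tm_interp \<kappa> \<sigma> (\<tau> x)) \<phi>"
proof (induction \<phi> arbitrary: \<sigma> \<tau>)
  case (Atom P ts)
  then show ?case by (simp add: tm_interp_tsubst)
next
  case (Quant q x \<phi>)
  let ?\<tau> = "\<tau>(x := Var x)"
  have nc: "no_capture ?\<tau> \<phi>" and x: "\<forall>y\<in>fv \<phi> - {x}. x \<notin> tvars (\<tau> y)" using Quant.prems by auto
  have fv: "x \<in> fv (psubst ?\<tau> \<phi>) \<longleftrightarrow> x \<in> fv \<phi>"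
    using x by (auto simp: fv_psubst[OF nc] split: if_splits)
  show ?case
  proof (cases "x \<in> fv \<phi>")
    case True
    have "normalize b \<kappa> (\<sigma>(x := Var n)) (psubst ?\<tau> \<phi>) =
        normalize b \<kappa> ((\<lambda>x. tm_interp \<kappa> \<sigma> (\<tau> x))(x := Var n)) \<phi>" for n
      unfolding Quant.IH[OF nc] using x by (intro normalize_cong) (auto intro!: tm_interp_cong)
    then show ?thesis using True fv nc by (simp add: qheight_psubst)
  next
    case False
    have "normalize b \<kappa> \<sigma> (psubst ?\<tau> \<phi>) = normalize b \<kappa> (\<lambda>x. tm_interp \<kappa> \<sigma> (\<tau> x)) \<phi>"
      unfolding Quant.IH[OF nc] using False by (intro normalize_cong) auto
    then show ?thesis using fv False by simp
  qed
qed auto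

lemma normalize_subst:
  "free_for t x \<phi> \<Longrightarrow> normalize b \<kappa> \<sigma> (subst \<phi> x t) = normalize b \<kappa> (\<sigma>(x := tm_interp \<kappa> \<sigma> t)) \<phi>"
  unfolding subst_def normalize_psubst[OF no_capture_subst] by (intro normalize_cong) auto

lemma fv_subst: "free_for t x \<phi> \<Longrightarrow> fv (subst \<phi> x t) = fv \<phi> - {x} \<union> (if x \<in> fv \<phi> then tvars t else {})"
  unfolding subst_def by (subst fv_psubst[OF no_capture_subst]) (auto split: if_splits)

text \<open>Free variables and heights are carried through the induction because
  \<open>normalize\<close> decides from them whether a quantifier stays and which name it
  gets.\<close>

lemma variant_normalize:
  "variant \<phi> \<phi>' \<Longrightarrow> fv \<phi> = fv \<phi>' \<and> qheight \<phi> = qheight \<phi>' \<and> (\<forall>\<sigma>. normalize b \<kappa> \<sigma> \<phi> = normalize b \<kappa> \<sigma> \<phi>')"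
proof (induction \<phi> \<phi>' rule: variant.induct)
  case (rename y \<phi> x q)
  have qh: "qheight (subst \<phi> x (Var y)) = qheight \<phi>"
    unfolding subst_def by (rule qheight_psubst[OF no_capture_subst[OF rename(2)]])
  show ?case
  proof (cases "x \<in> fv \<phi>")
    case True
    have "normalize b \<kappa> (\<sigma>(x := Var n)) \<phi> = normalize b \<kappa> (\<sigma>(y := Var n)) (subst \<phi> x (Var y))" for \<sigma> n
      unfolding normalize_subst[OF rename(2)] using rename(1) by (intro normalize_cong) auto
    then show ?thesis using True rename qh by (auto simp: fv_subst)
  next
    case False
    then show ?thesis using rename qh by (simp add: subst_fresh)
  qed
qed (simp_all del: fun_upd_apply)

lemma fv_normalize:
  "fv (normalize b \<kappa> \<sigma> \<phi>) \<subseteq> (\<Union>x\<in>fv \<phi>. tvars (\<sigma> x)) \<union> (\<Union>c\<in>set1_fm \<phi>. tvars (\<kappa> c))"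
proof (induction \<phi> arbitrary: \<sigma>)
  case (Atom P ts)
  then show ?case by (auto simp: tvars_tm_interp)
next
  case (Quant q x \<phi>)
  show ?case
  proof (cases "x \<in> fv \<phi>")
    case True
    let ?\<sigma> = "\<sigma>(x := Var (b (qheight \<phi>)))"
    have "(\<Union>y\<in>fv \<phi>. tvars (?\<sigma> y)) \<subseteq> insert (b (qheight \<phi>)) (\<Union>y\<in>fv \<phi> - {x}. tvars (\<sigma> y))"
      by (auto split: if_splits)
    then have "fv (normalize b \<kappa> ?\<sigma> \<phi>) \<subseteq>
        insert (b (qheight \<phi>)) (\<Union>y\<in>fv \<phi> - {x}. tvars (\<sigma> y)) \<union> (\<Union>c\<in>set1_fm \<phi>. tvars (\<kappa> c))"
      by (intro order_trans[OF Quant[of ?\<sigma>]]) blast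
    then show ?thesis using True by auto
  next
    case False
    then show ?thesis using Quant[of \<sigma>] by auto
  qed
next
  case (Unary u \<phi>)
  then show ?case by simp
next
  case (Binary c \<phi> \<psi>)
  show ?case using Binary(1)[of \<sigma>] Binary(2)[of \<sigma>] by (simp add: subset_iff) blast
qed

lemma avars_normalize:
  "avars (normalize b \<kappa> \<sigma> \<phi>) \<subseteq> range b \<union> (\<Union>x\<in>fv \<phi>. tvars (\<sigma> x)) \<union> (\<Union>c\<in>set1_fm \<phi>. tvars (\<kappa> c))"
proof (induction \<phi> arbitrary: \<sigma>)
  case (Atom P ts)
  then show ?case by (auto simp: tvars_tm_interp)
next
  case (Quant q x \<phi>)
  show ?case
  proof (cases "x \<in> fv \<phi>")
    case True
    let ?\<sigma> = "\<sigma>(x := Var (b (qheight \<phi>)))"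
    have "(\<Union>y\<in>fv \<phi>. tvars (?\<sigma> y)) \<subseteq> insert (b (qheight \<phi>)) (\<Union>y\<in>fv \<phi> - {x}. tvars (\<sigma> y))"
      by (auto split: if_splits)
    then have "avars (normalize b \<kappa> ?\<sigma> \<phi>) \<subseteq>
        range b \<union> insert (b (qheight \<phi>)) (\<Union>y\<in>fv \<phi> - {x}. tvars (\<sigma> y)) \<union> (\<Union>c\<in>set1_fm \<phi>. tvars (\<kappa> c))"
      by (intro order_trans[OF Quant[of ?\<sigma>]]) blast
    then show ?thesis using True by auto
  next
    case False
    then show ?thesis using Quant[of \<sigma>] by auto
  qed
next
  case (Unary u \<phi>)
  then show ?case by simp
next
  case (Binary c \<phi> \<psi>)
  show ?case using Binary(1)[of \<sigma>] Binary(2)[of \<sigma>] by (simp add: subset_iff) blast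
qed

text \<open>The binders of a normal form are named \<open>b k\<close> with
  \<open>k < qheight \<phi>\<close>; a substitution that fixes these variables passes through all of
  them.\<close>

lemma psubst_normalize:
  "(\<And>k. k < qheight \<phi> \<Longrightarrow> \<tau> (b k) = Var (b k)) \<Longrightarrow>
    psubst \<tau> (normalize b \<kappa> \<sigma> \<phi>) = normalize b (\<lambda>c. tsubst \<tau> (\<kappa> c)) (\<lambda>x. tsubst \<tau> (\<sigma> x)) \<phi>"
proof (induction \<phi> arbitrary: \<sigma>)
  case (Atom P ts)
  then show ?case by (simp add: tsubst_tm_interp)
next
  case (Quant q x \<phi>)
  show ?case
  proof (cases "x \<in> fv \<phi>")
    case True
    then have "\<tau>(b (qheight \<phi>) := Var (b (qheight \<phi>))) = \<tau>" using Quant.prems[of "qheight \<phi>"] by auto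
    moreover have "(\<lambda>y. tsubst \<tau> ((\<sigma>(x := Var (b (qheight \<phi>)))) y)) =
        (\<lambda>y. tsubst \<tau> (\<sigma> y))(x := Var (b (qheight \<phi>)))"
      using Quant.prems[of "qheight \<phi>"] True by auto
    ultimately show ?thesis using True Quant by simp
  next
    case False
    then show ?thesis using Quant by simp
  qed
qed auto

lemma subst_normalize:
  assumes "\<And>k. k < qheight \<phi> \<Longrightarrow> b k \<noteq> m" "\<And>c. c \<in> set1_fm \<phi> \<Longrightarrow> m \<notin> tvars (\<kappa> c)"
  shows "subst (normalize b \<kappa> \<sigma> \<phi>) m t = normalize b \<kappa> (\<lambda>x. tsubst (Var(m := t)) (\<sigma> x)) \<phi>"
proof -
  have "tsubst (Var(m := t)) (\<kappa> c) = \<kappa> c" if "c \<in> set1_fm \<phi>" for c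
    using assms(2)[OF that] by (subst tsubst_cong[of _ _ Var]) auto
  then show ?thesis
    unfolding subst_def using assms(1) by (subst psubst_normalize) (auto intro!: normalize_cong)
qed

lemma free_for_normalize:
  "(\<And>k. k < qheight \<phi> \<Longrightarrow> b k \<notin> tvars t) \<Longrightarrow> free_for t m (normalize b \<kappa> \<sigma> \<phi>)"
  by (induction \<phi> arbitrary: \<sigma>) auto

lemma free_for_fresh: "tvars t \<inter> avars \<phi> = {} \<Longrightarrow> free_for t x \<phi>"
  by (induction \<phi>) auto

lemma avars_subst_Var: "avars (subst \<phi> x (Var y)) \<subseteq> insert y (avars \<phi>)"
proof (induction \<phi>)
  case (Atom P ts)
  then show ?case by (auto simp: tvars_tsubst split: if_splits)
next
  case (Quant q z \<phi>)
  then show ?case by (auto simp: subst_Quant)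
qed auto

text \<open>The outer binder is renamed before its scope is normalized. The renamed scope is not a
  subformula, hence the induction on size; injectivity of \<open>b\<close> keeps the name just
  introduced apart from those still to be used inside.\<close>

lemma variant_normal_form:
  assumes "inj b" "\<And>k. k < qheight \<phi> \<Longrightarrow> b k \<notin> avars \<phi>"
  shows "variant \<phi> (normalize b Con Var \<phi>)"
  using assms(2)
proof (induction "size \<phi>" arbitrary: \<phi> rule: less_induct)
  case less
  show ?case
  proof (cases \<phi>)
    case (Atom P ts)
    then show ?thesis by (auto intro: variant.refl simp: map_idI)
  next
    case (Unary u \<psi>)
    then show ?thesis using less by (auto intro: variant.Unary)
  next
    case (Binary c \<psi> \<chi>)
    then show ?thesis using less by (auto intro: variant.Binary)
  next
    case [simp]: (Quant q x \<psi>)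
    show ?thesis
    proof (cases "x \<in> fv \<psi>")
      case False
      then have "variant \<psi> (normalize b Con Var \<psi>)" using less by auto
      then show ?thesis using False by (auto intro: variant.trans variant.void)
    next
      case True
      let ?m = "b (qheight \<psi>)"
      let ?\<psi> = "subst \<psi> x (Var ?m)"
      have m: "?m \<notin> avars \<psi>" using less.prems[of "qheight \<psi>"] True by auto
      then have ff: "free_for (Var ?m) x \<psi>" by (intro free_for_fresh) auto
      have qh: "qheight ?\<psi> = qheight \<psi>"
        unfolding subst_def by (rule qheight_psubst[OF no_capture_subst[OF ff]])
      have "variant ?\<psi> (normalize b Con Var ?\<psi>)"
      proof (rule less.hyps)
        show "size ?\<psi> < size \<phi>" unfolding subst_def by (subst size_psubst_Var) auto
        fix k assume k: "k < qheight ?\<psi>"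
        then have "b k \<noteq> ?m" using qh injD[OF assms(1)] by fastforce
        then show "b k \<notin> avars ?\<psi>"
          using avars_subst_Var[of \<psi> x ?m] less.prems[of k] k qh True by auto
      qed
      also have "normalize b Con Var ?\<psi> = normalize b Con (Var(x := Var ?m)) \<psi>"
        using normalize_subst[OF ff] by simp
      finally have "variant (Quant q ?m ?\<psi>) (normalize b Con Var \<phi>)"
        using True by (auto intro: variant.Quant)
      moreover have "variant \<phi> (Quant q ?m ?\<psi>)"
        using variant.rename[OF _ ff] m fv_subset_avars by auto
      ultimately show ?thesis by (rule variant.trans[rotated])
    qed
  qed
qed

section \<open>Well-formedness\<close>

lemma Ter_tm_interp:
  "t \<in> Ter \<Theta>' \<Longrightarrow> fsyms \<Theta>' = fsyms \<Theta> \<Longrightarrow> (\<And>x. x \<in> tvars t \<Longrightarrow> \<sigma> x \<in> Ter \<Theta>) \<Longrightarrow>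
    (\<And>c. c \<in> csyms \<Theta>' \<Longrightarrow> \<kappa> c \<in> Ter \<Theta>) \<Longrightarrow> tm_interp \<kappa> \<sigma> t \<in> Ter \<Theta>"
proof (induction t rule: Ter.induct)
  case (3 f ts)
  have "tm_interp \<kappa> \<sigma> t \<in> Ter \<Theta>" if "t \<in> set ts" for t
    using that 3 by (metis UN_I list.set_map tvars.simps(3))
  then show ?case using 3 by (auto intro!: Ter.intros)
qed (auto intro!: Ter.intros)

text \<open>The two signatures may differ in their constants: the diagram language is to be
  interpreted in the original one.\<close>

lemma For_normalize:
  "\<phi> \<in> For \<Theta>' \<Longrightarrow> fsyms \<Theta>' = fsyms \<Theta> \<Longrightarrow> psyms \<Theta>' = psyms \<Theta> \<Longrightarrow>
    (\<And>x. x \<in> fv \<phi> \<Longrightarrow> \<sigma> x \<in> Ter \<Theta>) \<Longrightarrow>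
    (\<And>c. c \<in> csyms \<Theta>' \<Longrightarrow> \<kappa> c \<in> Ter \<Theta>) \<Longrightarrow> normalize b \<kappa> \<sigma> \<phi> \<in> For \<Theta>"
proof (induction \<phi> arbitrary: \<sigma> rule: For.induct)
  case (1 P ts)
  have "tm_interp \<kappa> \<sigma> t \<in> Ter \<Theta>" if "t \<in> set ts" for t
    using that 1 by (intro Ter_tm_interp[of t \<Theta>']) auto
  then show ?case using 1(1,4) by (auto intro!: For.intros)
next
  case (2 \<phi> u)
  show ?case using 2(2)[of \<sigma>] 2(3-) by (simp add: For.intros)
next
  case (3 \<phi> \<psi> c)
  show ?case using 3(3,4)[of \<sigma>] 3(5-) by (simp add: For.intros)
next
  case (4 \<phi> q x)
  have "normalize b \<kappa> (\<sigma>(x := Var n)) \<phi> \<in> For \<Theta>" for n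
    by (rule 4(2)) (use 4(3-) in \<open>auto intro: Ter.intros\<close>)
  moreover have "normalize b \<kappa> \<sigma> \<phi> \<in> For \<Theta>" if "x \<notin> fv \<phi>"
    by (rule 4(2)) (use 4(3-) that in auto)
  ultimately show ?case by (auto intro: For.intros)
qed

inductive_simps For_simps [simp]:
  "Atom P ts \<in> For \<Theta>" "Unary u \<phi> \<in> For \<Theta>" "Binary c \<phi> \<psi> \<in> For \<Theta>" "Quant q x \<phi> \<in> For \<Theta>"

inductive_simps Ter_simps [simp]:
  "Var x \<in> Ter \<Theta>" "Con c \<in> Ter \<Theta>" "App f ts \<in> Ter \<Theta>"

lemma Ter_tsubst: "(\<And>x. x \<in> tvars t \<Longrightarrow> \<sigma> x \<in> Ter \<Theta>) \<Longrightarrow> tsubst \<sigma> t \<in> Ter \<Theta> \<longleftrightarrow> t \<in> Ter \<Theta>"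
  by (induction t) auto

lemma For_psubst: "(\<And>x. x \<in> fv \<phi> \<Longrightarrow> \<sigma> x \<in> Ter \<Theta>) \<Longrightarrow> psubst \<sigma> \<phi> \<in> For \<Theta> \<longleftrightarrow> \<phi> \<in> For \<Theta>"
proof (induction \<phi> arbitrary: \<sigma>)
  case (Atom P ts)
  then have "tsubst \<sigma> t \<in> Ter \<Theta> \<longleftrightarrow> t \<in> Ter \<Theta>" if "t \<in> set ts" for t
    using that by (intro Ter_tsubst) auto
  then show ?case by auto
next
  case (Quant q x \<phi>)
  have "psubst (\<sigma>(x := Var x)) \<phi> \<in> For \<Theta> \<longleftrightarrow> \<phi> \<in> For \<Theta>"
    by (rule Quant.IH) (use Quant.prems in auto)
  then show ?case by simp
qed auto

lemma For_subst: "t \<in> Ter \<Theta> \<Longrightarrow> subst \<phi> x t \<in> For \<Theta> \<longleftrightarrow> \<phi> \<in> For \<Theta>"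
  unfolding subst_def by (rule For_psubst) auto

section \<open>Derivations\<close>

lemma EqSym_sig [simp]: "EqSym \<in> psyms (with_eq \<Theta>) (Suc (Suc 0))"
  by (simp add: with_eq_def numeral_2_eq_2)

definition odd_terms :: "('c, 'f, 'p) sig \<Rightarrow> ('c, 'f) tm set" where
  "odd_terms \<Theta> = {t \<in> Ter \<Theta>. \<forall>x\<in>tvars t. odd x}"

abbreviation nf :: "('k \<Rightarrow> ('c, 'f) tm) \<Rightarrow> (nat \<Rightarrow> ('c, 'f) tm) \<Rightarrow> ('k, 'f, 'p) fm \<Rightarrow> ('c, 'f, 'p) fm" where
  "nf \<equiv> normalize (\<lambda>k. 2 * k)"

lemma odd_terms_Ter: "t \<in> odd_terms \<Theta> \<Longrightarrow> t \<in> Ter \<Theta>"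
  by (simp add: odd_terms_def)

lemma odd_terms_even: "t \<in> odd_terms \<Theta> \<Longrightarrow> 2 * k \<notin> tvars t"
  by (auto simp: odd_terms_def)

lemma ex_fresh_odd: "finite X \<Longrightarrow> \<exists>y::nat. odd y \<and> y \<notin> X"
proof -
  assume "finite X"
  then obtain n where "\<forall>x\<in>X. x \<le> n" using finite_nat_set_iff_bounded_le by blast
  then have "odd (2 * n + 1) \<and> 2 * n + 1 \<notin> X" by fastforce
  then show ?thesis by blast
qed

lemma set1_tm_Ter: "t \<in> Ter \<Theta> \<Longrightarrow> set1_tm t \<subseteq> csyms \<Theta>"
  by (induction t rule: Ter.induct) auto

lemma set1_fm_For: "\<phi> \<in> For \<Theta> \<Longrightarrow> set1_fm \<phi> \<subseteq> csyms \<Theta>"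
  by (induction \<phi> rule: For.induct) (use set1_tm_Ter in fastforce)+

locale qmbc_theory =
  fixes \<Theta> :: "('c, 'f, 'p) sig" and \<Gamma> :: "('c, 'f, 'p eqsym) fm set"
  assumes premises_For: "\<Gamma> \<subseteq> For (with_eq \<Theta>)"
begin

abbreviation derives (\<open>\<turnstile> _\<close> [60] 60) where "\<turnstile> \<phi> \<equiv> qmbc_derives \<Theta> \<Gamma> \<phi>"
abbreviation wff :: "('c, 'f, 'p eqsym) fm set" where "wff \<equiv> For (with_eq \<Theta>)"
abbreviation OT :: "('c, 'f) tm set" where "OT \<equiv> odd_terms (with_eq \<Theta>)"

lemma derives_wff: "\<turnstile> \<phi> \<Longrightarrow> \<phi> \<in> wff"
  by (induction rule: qmbc_derives.induct) (use premises_For in auto)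

section \<open>Propositional derivations and consistency\<close>

lemma MP: "\<turnstile> \<alpha> \<^bold>\<longrightarrow> \<beta> \<Longrightarrow> \<turnstile> \<alpha> \<Longrightarrow> \<turnstile> \<beta>"
  by (rule qmbc_derives.MP)

lemma imp_wff: "\<turnstile> \<alpha> \<^bold>\<longrightarrow> \<beta> \<Longrightarrow> \<alpha> \<in> wff \<and> \<beta> \<in> wff"
  using derives_wff by fastforce

lemma weaken: "\<turnstile> \<beta> \<Longrightarrow> \<alpha> \<in> wff \<Longrightarrow> \<turnstile> \<alpha> \<^bold>\<longrightarrow> \<beta>"
  by (rule MP[OF qmbc_derives.axiom[OF A1]]) (use derives_wff in auto)

text \<open>Modus ponens below an antecedent. The quantifier rules generalize over free variables of
  premises, so there is no unrestricted deduction theorem, and hypotheses are kept as antecedents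
  throughout.\<close>

lemma imp_S:
  assumes "\<turnstile> \<alpha> \<^bold>\<longrightarrow> (\<beta> \<^bold>\<longrightarrow> \<gamma>)" "\<turnstile> \<alpha> \<^bold>\<longrightarrow> \<beta>"
  shows "\<turnstile> \<alpha> \<^bold>\<longrightarrow> \<gamma>"
  by (rule MP[OF MP[OF qmbc_derives.axiom[OF A2] assms(1)] assms(2)])
    (use assms[THEN derives_wff] in auto)

lemma imp_refl: "\<alpha> \<in> wff \<Longrightarrow> \<turnstile> \<alpha> \<^bold>\<longrightarrow> \<alpha>"
  by (rule imp_S[of _ "\<alpha> \<^bold>\<longrightarrow> \<alpha>"]) (auto intro!: qmbc_derives.axiom A1)

lemma imp_trans: "\<turnstile> \<alpha> \<^bold>\<longrightarrow> \<beta> \<Longrightarrow> \<turnstile> \<beta> \<^bold>\<longrightarrow> \<gamma> \<Longrightarrow> \<turnstile> \<alpha> \<^bold>\<longrightarrow> \<gamma>"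
  by (rule imp_S[OF weaken]) (use imp_wff in auto)

lemma conj_left: "\<alpha> \<in> wff \<Longrightarrow> \<beta> \<in> wff \<Longrightarrow> \<turnstile> (\<alpha> \<^bold>\<and> \<beta>) \<^bold>\<longrightarrow> \<alpha>"
  and conj_right: "\<alpha> \<in> wff \<Longrightarrow> \<beta> \<in> wff \<Longrightarrow> \<turnstile> (\<alpha> \<^bold>\<and> \<beta>) \<^bold>\<longrightarrow> \<beta>"
  by (auto intro!: qmbc_derives.axiom A4 A5)

lemma conj_intro: "\<turnstile> \<gamma> \<^bold>\<longrightarrow> \<alpha> \<Longrightarrow> \<turnstile> \<gamma> \<^bold>\<longrightarrow> \<beta> \<Longrightarrow> \<turnstile> \<gamma> \<^bold>\<longrightarrow> (\<alpha> \<^bold>\<and> \<beta>)"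
  by (rule imp_S[OF imp_trans[OF _ qmbc_derives.axiom[OF A3]]]) (use imp_wff in auto)

lemma uncurry: "\<turnstile> \<alpha> \<^bold>\<longrightarrow> (\<beta> \<^bold>\<longrightarrow> \<gamma>) \<Longrightarrow> \<turnstile> (\<alpha> \<^bold>\<and> \<beta>) \<^bold>\<longrightarrow> \<gamma>"
  by (rule imp_S[OF imp_trans[OF conj_left] conj_right]) (use derives_wff in fastforce)+

lemma curry: "\<turnstile> (\<alpha> \<^bold>\<and> \<beta>) \<^bold>\<longrightarrow> \<gamma> \<Longrightarrow> \<alpha> \<in> wff \<Longrightarrow> \<beta> \<in> wff \<Longrightarrow> \<turnstile> \<alpha> \<^bold>\<longrightarrow> (\<beta> \<^bold>\<longrightarrow> \<gamma>)"
proof -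
  assume *: "\<turnstile> (\<alpha> \<^bold>\<and> \<beta>) \<^bold>\<longrightarrow> \<gamma>" and wff: "\<alpha> \<in> wff" "\<beta> \<in> wff"
  have "\<turnstile> \<alpha> \<^bold>\<longrightarrow> (\<beta> \<^bold>\<longrightarrow> (\<alpha> \<^bold>\<and> \<beta>))"
    using wff by (auto intro!: qmbc_derives.axiom A3)
  moreover have "\<turnstile> (\<beta> \<^bold>\<longrightarrow> (\<alpha> \<^bold>\<and> \<beta>)) \<^bold>\<longrightarrow> (\<beta> \<^bold>\<longrightarrow> \<gamma>)"
    by (rule MP[OF qmbc_derives.axiom[OF A2] weaken[OF *]]) (use wff imp_wff[OF *] in auto)
  ultimately show ?thesis by (rule imp_trans)
qed

lemma disj_elim: "\<turnstile> \<alpha> \<^bold>\<longrightarrow> \<gamma> \<Longrightarrow> \<turnstile> \<beta> \<^bold>\<longrightarrow> \<gamma> \<Longrightarrow> \<turnstile> (\<alpha> \<^bold>\<or> \<beta>) \<^bold>\<longrightarrow> \<gamma>"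
  by (rule MP[OF MP[OF qmbc_derives.axiom[OF A8]]]) (use imp_wff in auto)

lemma disj_left: "\<alpha> \<in> wff \<Longrightarrow> \<beta> \<in> wff \<Longrightarrow> \<turnstile> \<alpha> \<^bold>\<longrightarrow> (\<alpha> \<^bold>\<or> \<beta>)"
  and disj_right: "\<alpha> \<in> wff \<Longrightarrow> \<beta> \<in> wff \<Longrightarrow> \<turnstile> \<beta> \<^bold>\<longrightarrow> (\<alpha> \<^bold>\<or> \<beta>)"
  by (auto intro!: qmbc_derives.axiom A6 A7)

lemma swap_imp: "\<turnstile> \<alpha> \<^bold>\<longrightarrow> (\<beta> \<^bold>\<longrightarrow> \<gamma>) \<Longrightarrow> \<turnstile> \<beta> \<^bold>\<longrightarrow> (\<alpha> \<^bold>\<longrightarrow> \<gamma>)"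
proof -
  assume *: "\<turnstile> \<alpha> \<^bold>\<longrightarrow> (\<beta> \<^bold>\<longrightarrow> \<gamma>)"
  then have wff: "\<alpha> \<in> wff" "\<beta> \<in> wff" using derives_wff by fastforce+
  have "\<turnstile> (\<beta> \<^bold>\<and> \<alpha>) \<^bold>\<longrightarrow> (\<alpha> \<^bold>\<and> \<beta>)" using wff by (intro conj_intro conj_left conj_right)
  then show ?thesis using uncurry[OF *] wff by (blast intro: curry imp_trans)
qed

text \<open>A9 takes the place of excluded middle: \<open>\<alpha> \<longrightarrow> \<beta>\<close>
  with \<open>falsum\<close> for \<open>\<beta>\<close> acts as the classical negation of
  \<open>\<alpha>\<close>, whereas \<open>\<not>\<alpha>\<close> may hold together with
  \<open>\<alpha>\<close>.\<close>

lemma by_cases: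
  assumes "\<turnstile> (\<gamma> \<^bold>\<and> \<alpha>) \<^bold>\<longrightarrow> \<delta>" "\<turnstile> (\<gamma> \<^bold>\<and> (\<alpha> \<^bold>\<longrightarrow> \<beta>)) \<^bold>\<longrightarrow> \<delta>"
  shows "\<turnstile> \<gamma> \<^bold>\<longrightarrow> \<delta>"
proof -
  have wff: "\<alpha> \<in> wff" "\<beta> \<in> wff" "\<gamma> \<in> wff" using assms[THEN imp_wff] by auto
  have "\<turnstile> (\<alpha> \<^bold>\<or> (\<alpha> \<^bold>\<longrightarrow> \<beta>)) \<^bold>\<longrightarrow> (\<gamma> \<^bold>\<longrightarrow> \<delta>)"
    using wff by (intro disj_elim swap_imp[OF curry[OF assms(1)]] swap_imp[OF curry[OF assms(2)]]) auto
  then show ?thesis by (rule MP) (use wff in \<open>auto intro!: qmbc_derives.axiom A9\<close>)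
qed

text \<open>By A11 a contradiction is explosive only in the presence of \<open>\<circ>\<close>,
  hence the three conjuncts. An equation is taken for \<open>e\<close> because the signature may
  have no other predicate symbol.\<close>

definition falsum :: "('c, 'f, 'p eqsym) fm" where
  "falsum = (let e = Var 0 \<^bold>\<approx> Var 0 in e \<^bold>\<and> ((\<^bold>\<not> e) \<^bold>\<and> (\<^bold>\<circ> e)))"

lemma falsum_wff [simp]: "falsum \<in> wff"
  by (simp add: falsum_def Let_def)

lemma falsum_elim: "\<alpha> \<in> wff \<Longrightarrow> \<turnstile> falsum \<^bold>\<longrightarrow> \<alpha>"
proof -
  assume \<alpha>: "\<alpha> \<in> wff"
  define e where "e = (Var 0 \<^bold>\<approx> Var 0 :: ('c, 'f, 'p eqsym) fm)"
  have e: "e \<in> wff" by (simp add: e_def)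
  have falsum: "falsum = e \<^bold>\<and> ((\<^bold>\<not> e) \<^bold>\<and> (\<^bold>\<circ> e))" by (simp add: falsum_def e_def Let_def)
  have 1: "\<turnstile> falsum \<^bold>\<longrightarrow> e" "\<turnstile> falsum \<^bold>\<longrightarrow> \<^bold>\<not> e" "\<turnstile> falsum \<^bold>\<longrightarrow> \<^bold>\<circ> e"
    unfolding falsum using e by (auto intro: conj_left imp_trans[OF conj_right conj_left] imp_trans[OF conj_right conj_right])
  have "\<turnstile> \<^bold>\<circ> e \<^bold>\<longrightarrow> (e \<^bold>\<longrightarrow> (\<^bold>\<not> e \<^bold>\<longrightarrow> \<alpha>))"
    using e \<alpha> by (auto intro!: qmbc_derives.axiom A11)
  then show ?thesis using imp_S[OF imp_S[OF imp_trans[OF 1(3)] 1(1)] 1(2)] by blast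
qed

text \<open>Inconsistent formulas have to be left out: below a least condition every nonempty
  downward closed set would be dense, and at most two regular sets would remain.\<close>

definition consistent :: "('c, 'f, 'p eqsym) fm set" where
  "consistent = {\<phi> \<in> wff. \<not> \<turnstile> \<phi> \<^bold>\<longrightarrow> falsum}"

lemma consistent_wff: "\<phi> \<in> consistent \<Longrightarrow> \<phi> \<in> wff"
  by (simp add: consistent_def)

text \<open>Separativity of the order: a condition that does not imply \<open>\<phi>\<close> has an
  extension incompatible with \<open>\<phi>\<close>. The regularity of \<open>val\<close> rests on
  this.\<close>

lemma consistent_refute:
  assumes "\<alpha> \<in> consistent" "\<phi> \<in> wff" "\<not> \<turnstile> \<alpha> \<^bold>\<longrightarrow> \<phi>"
  shows "\<alpha> \<^bold>\<and> (\<phi> \<^bold>\<longrightarrow> falsum) \<in> consistent"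
proof (rule ccontr)
  assume "\<alpha> \<^bold>\<and> (\<phi> \<^bold>\<longrightarrow> falsum) \<notin> consistent"
  then have "\<turnstile> (\<alpha> \<^bold>\<and> (\<phi> \<^bold>\<longrightarrow> falsum)) \<^bold>\<longrightarrow> falsum"
    using assms by (simp add: consistent_def)
  then have "\<turnstile> (\<alpha> \<^bold>\<and> (\<phi> \<^bold>\<longrightarrow> falsum)) \<^bold>\<longrightarrow> \<phi>"
    using falsum_elim assms(2) imp_trans by blast
  moreover have "\<turnstile> (\<alpha> \<^bold>\<and> \<phi>) \<^bold>\<longrightarrow> \<phi>"
    using assms by (auto intro: conj_right consistent_wff)
  ultimately show False using assms(3) by_cases by blast
qed

lemma inconsistent_conj:
  assumes "\<alpha> \<in> wff" "\<phi> \<in> wff" "\<psi> \<in> wff" "\<alpha> \<^bold>\<and> \<phi> \<notin> consistent"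
  shows "\<turnstile> \<alpha> \<^bold>\<longrightarrow> (\<phi> \<^bold>\<longrightarrow> \<psi>)"
  by (rule curry[OF imp_trans[OF _ falsum_elim]]) (use assms in \<open>auto simp: consistent_def\<close>)

section \<open>The embedding of the Lindenbaum algebra into its completion\<close>

sublocale forcing consistent "\<lambda>\<alpha> \<beta>. \<turnstile> \<alpha> \<^bold>\<longrightarrow> \<beta>"
  by unfold_locales (auto intro: imp_refl imp_trans consistent_wff)

definition val :: "('c, 'f, 'p eqsym) fm \<Rightarrow> ('c, 'f, 'p eqsym) fm set" where
  "val \<phi> = {\<alpha> \<in> consistent. \<turnstile> \<alpha> \<^bold>\<longrightarrow> \<phi>}"

lemma val_denseI:
  assumes "\<alpha> \<in> consistent" "\<phi> \<in> wff"
    and "\<And>\<beta>. \<beta> \<in> consistent \<Longrightarrow> \<turnstile> \<beta> \<^bold>\<longrightarrow> \<alpha> \<Longrightarrow> \<exists>\<gamma>\<in>consistent. \<turnstile> \<gamma> \<^bold>\<longrightarrow> \<beta> \<and> \<turnstile> \<gamma> \<^bold>\<longrightarrow> \<phi>"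
  shows "\<turnstile> \<alpha> \<^bold>\<longrightarrow> \<phi>"
proof (rule ccontr)
  assume "\<not> \<turnstile> \<alpha> \<^bold>\<longrightarrow> \<phi>"
  then have \<beta>: "\<alpha> \<^bold>\<and> (\<phi> \<^bold>\<longrightarrow> falsum) \<in> consistent"
    using assms consistent_refute by blast
  moreover have "\<turnstile> \<alpha> \<^bold>\<and> (\<phi> \<^bold>\<longrightarrow> falsum) \<^bold>\<longrightarrow> \<alpha>"
    using assms by (intro conj_left) (auto intro: consistent_wff)
  ultimately obtain \<gamma> where \<gamma>: "\<gamma> \<in> consistent" "\<turnstile> \<gamma> \<^bold>\<longrightarrow> (\<alpha> \<^bold>\<and> (\<phi> \<^bold>\<longrightarrow> falsum))" "\<turnstile> \<gamma> \<^bold>\<longrightarrow> \<phi>"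
    using assms(3) by blast
  have "\<turnstile> \<alpha> \<^bold>\<and> (\<phi> \<^bold>\<longrightarrow> falsum) \<^bold>\<longrightarrow> (\<phi> \<^bold>\<longrightarrow> falsum)"
    using assms by (intro conj_right) (auto intro: consistent_wff)
  then have "\<turnstile> \<gamma> \<^bold>\<longrightarrow> falsum"
    using imp_S[OF imp_trans[OF \<gamma>(2)] \<gamma>(3)] by blast
  then show False using \<gamma>(1) by (simp add: consistent_def)
qed

lemma regular_val: "\<phi> \<in> wff \<Longrightarrow> regular (val \<phi>)"
proof (rule regularI)
  fix \<alpha> assume "\<phi> \<in> wff" "\<alpha> \<in> consistent"
    "\<And>\<beta>. \<beta> \<in> consistent \<Longrightarrow> \<turnstile> \<beta> \<^bold>\<longrightarrow> \<alpha> \<Longrightarrow> \<exists>\<gamma>\<in>consistent. \<turnstile> \<gamma> \<^bold>\<longrightarrow> \<beta> \<and> \<gamma> \<in> val \<phi>"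
  then show "\<alpha> \<in> val \<phi>" unfolding val_def by (auto intro: val_denseI)
qed (auto simp: val_def intro: imp_trans)

lemma val_mono: "\<turnstile> \<phi> \<^bold>\<longrightarrow> \<psi> \<Longrightarrow> val \<phi> \<subseteq> val \<psi>"
  by (auto simp: val_def intro: imp_trans)

lemma val_top: "\<phi> \<in> wff \<Longrightarrow> val \<phi> = consistent \<longleftrightarrow> \<turnstile> \<phi>"
proof
  assume \<phi>: "\<phi> \<in> wff" and *: "val \<phi> = consistent"
  let ?e = "falsum \<^bold>\<longrightarrow> falsum"
  have e: "\<turnstile> ?e" by (rule imp_refl) simp
  have "\<turnstile> ?e \<^bold>\<longrightarrow> \<phi>"
  proof (cases "?e \<in> consistent")
    case True
    then show ?thesis using * by (auto simp: val_def)
  next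
    \<comment> \<open>Here \<open>\<Gamma>\<close> is inconsistent: there are no conditions, top and
      bottom of the algebra coincide, and every formula is derivable.\<close>
    case False
    then show ?thesis using \<phi> falsum_elim imp_trans by (auto simp: consistent_def)
  qed
  then show "\<turnstile> \<phi>" using e MP by blast
next
  assume "\<turnstile> \<phi>"
  then show "val \<phi> = consistent" using weaken consistent_wff by (auto simp: val_def)
qed

lemma val_conj: "\<phi> \<in> wff \<Longrightarrow> \<psi> \<in> wff \<Longrightarrow> val (\<phi> \<^bold>\<and> \<psi>) = val \<phi> \<inter> val \<psi>"
  by (auto simp: val_def intro: conj_intro imp_trans conj_left conj_right)

text \<open>The last two assumptions make \<open>\<chi>\<close> a least upper bound of
  \<open>A\<close> for provable implication, and the embedding preserves it: if a condition
  \<open>\<beta>\<close> implying \<open>\<chi>\<close> had no extension in any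
  \<open>val \<phi>\<close>, then \<open>\<beta> \<longrightarrow> falsum\<close> would be an upper
  bound of \<open>A\<close>. Disjunction and the existential quantifier are both instances.\<close>

lemma dense_val_Union:
  assumes "\<And>\<phi>. \<phi> \<in> A \<Longrightarrow> \<phi> \<in> wff" "\<chi> \<in> wff" "\<And>\<phi>. \<phi> \<in> A \<Longrightarrow> \<turnstile> \<phi> \<^bold>\<longrightarrow> \<chi>"
    and "\<And>\<alpha>. \<alpha> \<in> wff \<Longrightarrow> (\<And>\<phi>. \<phi> \<in> A \<Longrightarrow> \<turnstile> \<phi> \<^bold>\<longrightarrow> \<alpha>) \<Longrightarrow> \<turnstile> \<chi> \<^bold>\<longrightarrow> \<alpha>"
  shows "val \<chi> = regularization (\<Union>\<phi>\<in>A. val \<phi>)"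
proof
  have "(\<Union>\<phi>\<in>A. val \<phi>) \<subseteq> val \<chi>" using assms(3) val_mono by blast
  then show "regularization (\<Union>\<phi>\<in>A. val \<phi>) \<subseteq> val \<chi>"
    using regular_val[OF assms(2)] by (rule regularization_least)
  show "val \<chi> \<subseteq> regularization (\<Union>\<phi>\<in>A. val \<phi>)"
  proof
    fix \<alpha> assume \<alpha>: "\<alpha> \<in> val \<chi>"
    have "\<exists>\<gamma>\<in>consistent. \<turnstile> \<gamma> \<^bold>\<longrightarrow> \<beta> \<and> \<gamma> \<in> (\<Union>\<phi>\<in>A. val \<phi>)"
      if \<beta>: "\<beta> \<in> consistent" "\<turnstile> \<beta> \<^bold>\<longrightarrow> \<alpha>" for \<beta>
    proof (rule ccontr)
      assume no: "\<not> ?thesis"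
      have "\<turnstile> \<phi> \<^bold>\<longrightarrow> (\<beta> \<^bold>\<longrightarrow> falsum)" if "\<phi> \<in> A" for \<phi>
      proof (rule swap_imp, rule inconsistent_conj)
        show \<beta>\<phi>: "\<beta> \<in> wff" "\<phi> \<in> wff" using \<beta> assms(1) that consistent_wff by auto
        show "\<beta> \<^bold>\<and> \<phi> \<notin> consistent"
          using no that conj_left[OF \<beta>\<phi>] conj_right[OF \<beta>\<phi>] by (auto simp: val_def)
      qed simp
      then have "\<turnstile> \<chi> \<^bold>\<longrightarrow> (\<beta> \<^bold>\<longrightarrow> falsum)" using \<beta> by (intro assms(4)) (auto intro: consistent_wff)
      moreover have "\<turnstile> \<beta> \<^bold>\<longrightarrow> \<chi>" using \<alpha> \<beta> by (auto simp: val_def intro: imp_trans)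
      ultimately have "\<turnstile> \<beta> \<^bold>\<longrightarrow> falsum"
        by (rule imp_S[OF imp_trans[rotated] imp_refl]) (use \<beta> consistent_wff in auto)
      then show False using \<beta> by (simp add: consistent_def)
    qed
    then show "\<alpha> \<in> regularization (\<Union>\<phi>\<in>A. val \<phi>)"
      using \<alpha> by (auto simp: regularization_def val_def)
  qed
qed

lemma val_disj:
  assumes "\<phi> \<in> wff" "\<psi> \<in> wff"
  shows "val (\<phi> \<^bold>\<or> \<psi>) = regularization (val \<phi> \<union> val \<psi>)"
  using assms by (subst dense_val_Union[of "{\<phi>, \<psi>}"]) (auto intro: disj_left disj_right disj_elim)

lemma val_impl:
  assumes "\<phi> \<in> wff" "\<psi> \<in> wff"
  shows "val (\<phi> \<^bold>\<longrightarrow> \<psi>) =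
    {\<alpha> \<in> consistent. \<forall>\<beta>\<in>consistent. \<turnstile> \<beta> \<^bold>\<longrightarrow> \<alpha> \<longrightarrow> \<beta> \<in> val \<phi> \<longrightarrow> \<beta> \<in> val \<psi>}" (is "_ = ?r")
proof
  show "val (\<phi> \<^bold>\<longrightarrow> \<psi>) \<subseteq> ?r"
    by (auto simp: val_def intro: imp_S[OF imp_trans])
  show "?r \<subseteq> val (\<phi> \<^bold>\<longrightarrow> \<psi>)"
  proof
    fix \<alpha> assume \<alpha>: "\<alpha> \<in> ?r"
    then have wff: "\<alpha> \<in> wff" by (auto intro: consistent_wff)
    have "\<turnstile> \<alpha> \<^bold>\<longrightarrow> (\<phi> \<^bold>\<longrightarrow> \<psi>)"
    \<comment> \<open>The conjunction, if consistent, is the weakest condition below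
      \<open>\<alpha>\<close> that implies \<open>\<phi>\<close>, so testing it decides the
      implication.\<close>
    proof (cases "\<alpha> \<^bold>\<and> \<phi> \<in> consistent")
      case True
      then have "\<turnstile> (\<alpha> \<^bold>\<and> \<phi>) \<^bold>\<longrightarrow> \<psi>"
        using \<alpha> conj_left[OF wff assms(1)] conj_right[OF wff assms(1)] by (auto simp: val_def)
      then show ?thesis using wff assms by (intro curry)
    qed (use wff assms inconsistent_conj in blast)
    then show "\<alpha> \<in> val (\<phi> \<^bold>\<longrightarrow> \<psi>)" using \<alpha> by (simp add: val_def)
  qed
qed

lemma val_bin: "\<phi> \<in> wff \<Longrightarrow> \<psi> \<in> wff \<Longrightarrow> val (Binary c \<phi> \<psi>) = ba_op regulars c (val \<phi>) (val \<psi>)"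
  using impl_regulars[of "val \<phi>" "val \<psi>"]
  by (cases c) (simp_all add: val_conj val_disj val_impl regular_val meet_regulars join_regulars)

subsection \<open>Quantifiers and equality\<close>

text \<open>The rule for \<open>\<forall>\<close> acts on implications whose antecedent lacks
  \<open>x\<close>; a closed theorem supplies such an antecedent.\<close>

lemma generalization: "\<turnstile> \<phi> \<Longrightarrow> \<turnstile> \<^bold>\<forall>x. \<phi>"
proof -
  assume "\<turnstile> \<phi>"
  let ?e = "\<^bold>\<forall>0. (Var 0 \<^bold>\<approx> Var 0) :: ('c, 'f, 'p eqsym) fm"
  have e: "\<turnstile> ?e" by (rule qmbc_derives.axiom[OF AxEq1]) simp
  then have "\<turnstile> ?e \<^bold>\<longrightarrow> \<phi>" using \<open>\<turnstile> \<phi>\<close> derives_wff by (intro weaken)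
  then have "\<turnstile> ?e \<^bold>\<longrightarrow> (\<^bold>\<forall>x. \<phi>)" by (rule qmbc_derives.All_In) simp
  then show ?thesis using e MP by blast
qed

lemma all_subst: "\<phi> \<in> wff \<Longrightarrow> t \<in> Ter (with_eq \<Theta>) \<Longrightarrow> free_for t x \<phi> \<Longrightarrow> \<turnstile> (\<^bold>\<forall>x. \<phi>) \<^bold>\<longrightarrow> subst \<phi> x t"
  by (rule qmbc_derives.axiom[OF Ax13]) (auto simp: For_subst)

lemma subst_ex: "\<phi> \<in> wff \<Longrightarrow> t \<in> Ter (with_eq \<Theta>) \<Longrightarrow> free_for t x \<phi> \<Longrightarrow> \<turnstile> subst \<phi> x t \<^bold>\<longrightarrow> (\<^bold>\<exists>x. \<phi>)"
  by (rule qmbc_derives.axiom[OF Ax12]) (auto simp: For_subst)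

lemma instantiate: "\<turnstile> \<phi> \<Longrightarrow> t \<in> Ter (with_eq \<Theta>) \<Longrightarrow> free_for t x \<phi> \<Longrightarrow> \<turnstile> subst \<phi> x t"
  by (rule MP[OF all_subst generalization]) (auto intro: derives_wff)

lemma variant_imp: "variant \<phi> \<psi> \<Longrightarrow> \<phi> \<in> wff \<Longrightarrow> \<psi> \<in> wff \<Longrightarrow> \<turnstile> \<phi> \<^bold>\<longrightarrow> \<psi>"
  by (rule qmbc_derives.axiom[OF Ax14]) auto

lemma eq_refl: "t \<in> Ter (with_eq \<Theta>) \<Longrightarrow> \<turnstile> t \<^bold>\<approx> t"
proof -
  assume t: "t \<in> Ter (with_eq \<Theta>)"
  have "\<turnstile> \<^bold>\<forall>0. (Var 0 \<^bold>\<approx> Var 0)" by (rule qmbc_derives.axiom[OF AxEq1]) simp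
  from MP[OF all_subst this] have "\<turnstile> subst (Var 0 \<^bold>\<approx> Var 0) 0 t" using t by auto
  then show ?thesis by simp
qed

end

text \<open>Instantiated in two ways: with the language of the calculus and \<open>Con\<close>, to
  pass between formulas and their normal forms, and with the diagram language and
  \<open>interp\<close>, for the canonical valuation.\<close>

locale term_interpretation = qmbc_theory \<Theta> \<Gamma>
  for \<Theta> :: "('c, 'f, 'p) sig" and \<Gamma> +
  fixes \<Xi> :: "('k, 'f, 'p eqsym) sig" and \<kappa> :: "'k \<Rightarrow> ('c, 'f) tm"
  assumes fsyms_eq: "fsyms \<Xi> = fsyms (with_eq \<Theta>)"
    and psyms_eq: "psyms \<Xi> = psyms (with_eq \<Theta>)"
    and constants: "c \<in> csyms \<Xi> \<Longrightarrow> \<kappa> c \<in> OT"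
begin

lemma nf_wff: "\<phi> \<in> For \<Xi> \<Longrightarrow> (\<And>x. x \<in> fv \<phi> \<Longrightarrow> \<sigma> x \<in> Ter (with_eq \<Theta>)) \<Longrightarrow> nf \<kappa> \<sigma> \<phi> \<in> wff"
  by (rule For_normalize[of _ \<Xi>]) (auto simp: fsyms_eq psyms_eq intro: odd_terms_Ter constants)

lemma constants_odd: "\<phi> \<in> For \<Xi> \<Longrightarrow> c \<in> set1_fm \<phi> \<Longrightarrow> \<kappa> c \<in> OT"
  using set1_fm_For constants by blast

text \<open>Opens a binder of a normal form: the inner binders lie below
  \<open>2 * qheight \<phi>\<close>, and the other terms involved have odd variables, so
  \<open>m\<close> is free exactly where \<open>x\<close> was.\<close>

lemma subst_nf:
  assumes "\<phi> \<in> For \<Xi>" "even m" "m \<ge> 2 * qheight \<phi>"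
    and "\<And>y. y \<in> fv \<phi> - {x} \<Longrightarrow> \<sigma> y \<in> OT"
  shows "subst (nf \<kappa> (\<sigma>(x := Var m)) \<phi>) m t = nf \<kappa> (\<sigma>(x := t)) \<phi>"
proof -
  have "subst (nf \<kappa> (\<sigma>(x := Var m)) \<phi>) m t =
      nf \<kappa> (\<lambda>y. tsubst (Var(m := t)) ((\<sigma>(x := Var m)) y)) \<phi>"
  proof (rule subst_normalize)
    fix c assume "c \<in> set1_fm \<phi>"
    then show "m \<notin> tvars (\<kappa> c)"
      using assms(2) constants_odd[OF assms(1)] by (auto simp: odd_terms_def)
  qed (use assms(3) in auto)
  also have "\<dots> = nf \<kappa> (\<sigma>(x := t)) \<phi>"
  proof (rule normalize_cong)
    fix y assume y: "y \<in> fv \<phi>"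
    show "tsubst (Var(m := t)) ((\<sigma>(x := Var m)) y) = (\<sigma>(x := t)) y"
    proof (cases "y = x")
      case False
      then have "m \<notin> tvars (\<sigma> y)" using y assms(2,4) by (auto simp: odd_terms_def)
      then have "tsubst (Var(m := t)) (\<sigma> y) = tsubst Var (\<sigma> y)" by (intro tsubst_cong) auto
      then show ?thesis using False by simp
    qed simp
  qed simp
  finally show ?thesis .
qed

text \<open>Here parity separates the placeholder from the binders, and freshness separates it from
  the environment and the constants.\<close>

lemma subst_nf_odd:
  assumes "odd w" "\<And>c. c \<in> set1_fm \<phi> \<Longrightarrow> w \<notin> tvars (\<kappa> c)"
    and "\<And>y. y \<in> fv \<phi> - {x} \<Longrightarrow> w \<notin> tvars (\<sigma> y)"
  shows "subst (nf \<kappa> (\<sigma>(x := Var w)) \<phi>) w t = nf \<kappa> (\<sigma>(x := t)) \<phi>"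
proof -
  have "subst (nf \<kappa> (\<sigma>(x := Var w)) \<phi>) w t =
      nf \<kappa> (\<lambda>y. tsubst (Var(w := t)) ((\<sigma>(x := Var w)) y)) \<phi>"
    by (rule subst_normalize) (use assms in auto)
  also have "\<dots> = nf \<kappa> (\<sigma>(x := t)) \<phi>"
  proof (rule normalize_cong)
    fix y assume y: "y \<in> fv \<phi>"
    show "tsubst (Var(w := t)) ((\<sigma>(x := Var w)) y) = (\<sigma>(x := t)) y"
    proof (cases "y = x")
      case False
      then have "tsubst (Var(w := t)) (\<sigma> y) = tsubst Var (\<sigma> y)"
        using assms(3) y by (intro tsubst_cong) auto
      then show ?thesis using False by simp
    qed simp
  qed simp
  finally show ?thesis .
qed

lemma free_for_nf: "t \<in> OT \<Longrightarrow> free_for t m (nf \<kappa> \<sigma> \<phi>)"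
  by (rule free_for_normalize) (rule odd_terms_even)

lemma fresh_variable:
  assumes "finite X"
  obtains w where "odd w" "w \<notin> X" "\<And>c. c \<in> set1_fm \<phi> \<Longrightarrow> w \<notin> tvars (\<kappa> c)"
    "\<And>y. y \<in> fv \<phi> - {x} \<Longrightarrow> w \<notin> tvars (\<sigma> y)"
proof -
  have "finite (X \<union> (\<Union>c\<in>set1_fm \<phi>. tvars (\<kappa> c)) \<union> (\<Union>y\<in>fv \<phi>. tvars (\<sigma> y)))" using assms by simp
  from ex_fresh_odd[OF this] that show thesis by blast
qed

lemma nf_quant_elim:
  assumes "\<phi> \<in> For \<Xi>" "\<And>y. y \<in> fv \<phi> - {x} \<Longrightarrow> \<sigma> y \<in> OT" "t \<in> OT"
  shows "\<turnstile> nf \<kappa> \<sigma> (\<^bold>\<forall>x. \<phi>) \<^bold>\<longrightarrow> nf \<kappa> (\<sigma>(x := t)) \<phi>"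
    and "\<turnstile> nf \<kappa> (\<sigma>(x := t)) \<phi> \<^bold>\<longrightarrow> nf \<kappa> \<sigma> (\<^bold>\<exists>x. \<phi>)"
proof -
  have wff: "nf \<kappa> (\<sigma>(x := s)) \<phi> \<in> wff" if "s \<in> Ter (with_eq \<Theta>)" for s
    using assms that by (intro nf_wff) (auto intro: odd_terms_Ter)
  have t: "t \<in> Ter (with_eq \<Theta>)" using assms(3) by (rule odd_terms_Ter)
  \<comment> \<open>\<open>2 * qheight \<phi>\<close> is the name that \<open>nf\<close> gives to
    the bound \<open>x\<close>, so this is the scope as it appears in the normal form.\<close>
  let ?A = "nf \<kappa> (\<sigma>(x := Var (2 * qheight \<phi>))) \<phi>"
  have void: "nf \<kappa> (\<sigma>(x := t)) \<phi> = nf \<kappa> \<sigma> \<phi>" if "x \<notin> fv \<phi>"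
    using that by (intro normalize_cong) auto
  have A: "subst ?A (2 * qheight \<phi>) t = nf \<kappa> (\<sigma>(x := t)) \<phi>"
    using assms by (intro subst_nf) auto
  have "?A \<in> wff" using wff by simp
  note all_subst[OF this t free_for_nf[OF assms(3)], where x = "2 * qheight \<phi>", unfolded A]
    and subst_ex[OF this t free_for_nf[OF assms(3)], where x = "2 * qheight \<phi>", unfolded A]
  then show "\<turnstile> nf \<kappa> \<sigma> (\<^bold>\<forall>x. \<phi>) \<^bold>\<longrightarrow> nf \<kappa> (\<sigma>(x := t)) \<phi>"
    and "\<turnstile> nf \<kappa> (\<sigma>(x := t)) \<phi> \<^bold>\<longrightarrow> nf \<kappa> \<sigma> (\<^bold>\<exists>x. \<phi>)"
    using wff[OF t] void by (auto intro: imp_refl simp del: fun_upd_apply)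
qed

text \<open>The generalization rules bind an odd eigenvariable, a normal form binds an even name.
  The renaming between them is legitimate because all free variables of the scope are odd.\<close>

lemma nf_rename:
  assumes "\<phi> \<in> For \<Xi>" "\<And>y. y \<in> fv \<phi> - {x} \<Longrightarrow> \<sigma> y \<in> OT" "x \<in> fv \<phi>" "odd w"
    "\<And>c. c \<in> set1_fm \<phi> \<Longrightarrow> w \<notin> tvars (\<kappa> c)" "\<And>y. y \<in> fv \<phi> - {x} \<Longrightarrow> w \<notin> tvars (\<sigma> y)"
  shows "variant (Quant q w (nf \<kappa> (\<sigma>(x := Var w)) \<phi>)) (nf \<kappa> \<sigma> (Quant q x \<phi>))"
proof -
  let ?m = "2 * qheight \<phi>"
  let ?A = "nf \<kappa> (\<sigma>(x := Var w)) \<phi>"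
  have "odd y" if y: "y \<in> fv ?A" for y
  proof -
    consider z where "z \<in> fv \<phi>" "y \<in> tvars ((\<sigma>(x := Var w)) z)"
      | c where "c \<in> set1_fm \<phi>" "y \<in> tvars (\<kappa> c)"
      using subsetD[OF fv_normalize y] by auto
    then show ?thesis
    proof cases
      case 1
      then show ?thesis using assms(2)[of z] assms(4) by (auto simp: odd_terms_def split: if_splits)
    next
      case 2
      then show ?thesis using constants_odd[OF assms(1)] by (auto simp: odd_terms_def)
    qed
  qed
  then have "?m \<notin> fv ?A" by fastforce
  moreover have "free_for (Var ?m) w ?A"
    by (rule free_for_normalize) auto
  ultimately have "variant (Quant q w ?A) (Quant q ?m (subst ?A w (Var ?m)))"
    by (rule variant.rename)
  moreover have "subst ?A w (Var ?m) = nf \<kappa> (\<sigma>(x := Var ?m)) \<phi>"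
    by (rule subst_nf_odd) (use assms in auto)
  ultimately show ?thesis using assms(3) by simp
qed

lemma nf_quant_intro:
  assumes "\<phi> \<in> For \<Xi>" "\<And>y. y \<in> fv \<phi> - {x} \<Longrightarrow> \<sigma> y \<in> OT" "\<alpha> \<in> wff"
  shows "(\<And>t. t \<in> OT \<Longrightarrow> \<turnstile> \<alpha> \<^bold>\<longrightarrow> nf \<kappa> (\<sigma>(x := t)) \<phi>) \<Longrightarrow> \<turnstile> \<alpha> \<^bold>\<longrightarrow> nf \<kappa> \<sigma> (\<^bold>\<forall>x. \<phi>)"
    and "(\<And>t. t \<in> OT \<Longrightarrow> \<turnstile> nf \<kappa> (\<sigma>(x := t)) \<phi> \<^bold>\<longrightarrow> \<alpha>) \<Longrightarrow> \<turnstile> nf \<kappa> \<sigma> (\<^bold>\<exists>x. \<phi>) \<^bold>\<longrightarrow> \<alpha>"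
proof -
  obtain w where w: "odd w" "w \<notin> fv \<alpha>" "\<And>c. c \<in> set1_fm \<phi> \<Longrightarrow> w \<notin> tvars (\<kappa> c)"
    "\<And>y. y \<in> fv \<phi> - {x} \<Longrightarrow> w \<notin> tvars (\<sigma> y)"
    using fresh_variable[of "fv \<alpha>" \<phi> x \<sigma>] by auto
  let ?A = "nf \<kappa> (\<sigma>(x := Var w)) \<phi>"
  have w_OT: "Var w \<in> OT" using w by (simp add: odd_terms_def)
  have A: "?A \<in> wff" using assms by (intro nf_wff) (auto intro: odd_terms_Ter)
  have void: "?A = nf \<kappa> \<sigma> (Quant q x \<phi>)" if "x \<notin> fv \<phi>" for q
    using that by (auto intro!: normalize_cong)
  have Q: "nf \<kappa> \<sigma> (Quant q x \<phi>) \<in> wff" for q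
    using assms by (intro nf_wff) (auto intro: odd_terms_Ter)
  have var: "variant (Quant q w ?A) (nf \<kappa> \<sigma> (Quant q x \<phi>))" if "x \<in> fv \<phi>" for q
    using assms that w by (intro nf_rename) auto
  show "\<turnstile> \<alpha> \<^bold>\<longrightarrow> nf \<kappa> \<sigma> (\<^bold>\<forall>x. \<phi>)" if "\<And>t. t \<in> OT \<Longrightarrow> \<turnstile> \<alpha> \<^bold>\<longrightarrow> nf \<kappa> (\<sigma>(x := t)) \<phi>"
  proof (cases "x \<in> fv \<phi>")
    case True
    have "\<turnstile> \<alpha> \<^bold>\<longrightarrow> (\<^bold>\<forall>w. ?A)" using that[OF w_OT] w(2) by (rule qmbc_derives.All_In)
    moreover have "\<turnstile> (\<^bold>\<forall>w. ?A) \<^bold>\<longrightarrow> nf \<kappa> \<sigma> (\<^bold>\<forall>x. \<phi>)"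
      by (rule variant_imp[OF var[OF True] _ Q]) (use A in simp)
    ultimately show ?thesis by (rule imp_trans)
  next
    case False
    then show ?thesis using that[OF w_OT] void by metis
  qed
  show "\<turnstile> nf \<kappa> \<sigma> (\<^bold>\<exists>x. \<phi>) \<^bold>\<longrightarrow> \<alpha>" if "\<And>t. t \<in> OT \<Longrightarrow> \<turnstile> nf \<kappa> (\<sigma>(x := t)) \<phi> \<^bold>\<longrightarrow> \<alpha>"
  proof (cases "x \<in> fv \<phi>")
    case True
    have "\<turnstile> nf \<kappa> \<sigma> (\<^bold>\<exists>x. \<phi>) \<^bold>\<longrightarrow> (\<^bold>\<exists>w. ?A)"
      by (rule variant_imp[OF variant.sym[OF var[OF True]] Q]) (use A in simp)
    moreover have "\<turnstile> (\<^bold>\<exists>w. ?A) \<^bold>\<longrightarrow> \<alpha>" using that[OF w_OT] w(2) by (rule qmbc_derives.Ex_In)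
    ultimately show ?thesis by (rule imp_trans)
  next
    case False
    then show ?thesis using that[OF w_OT] void by metis
  qed
qed

text \<open>AxEq2 speaks of variables only. Two fresh ones stand for \<open>s\<close> and
  \<open>t\<close> and are instantiated one after the other; since \<open>w'\<close> does not occur
  in \<open>s\<close>, the second step leaves the result of the first intact.\<close>

lemma nf_leibniz:
  assumes "\<phi> \<in> For \<Xi>" "\<And>y. y \<in> fv \<phi> - {z} \<Longrightarrow> \<sigma> y \<in> OT" "s \<in> OT" "t \<in> OT"
  shows "\<turnstile> (s \<^bold>\<approx> t) \<^bold>\<longrightarrow> (nf \<kappa> (\<sigma>(z := s)) \<phi> \<^bold>\<longrightarrow> nf \<kappa> (\<sigma>(z := t)) \<phi>)"
proof -
  obtain w where w: "odd w" "w \<notin> tvars s \<union> tvars t" "\<And>c. c \<in> set1_fm \<phi> \<Longrightarrow> w \<notin> tvars (\<kappa> c)"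
    "\<And>y. y \<in> fv \<phi> - {z} \<Longrightarrow> w \<notin> tvars (\<sigma> y)"
    using fresh_variable[of "tvars s \<union> tvars t" \<phi> z \<sigma>] by auto
  obtain w' where w': "odd w'" "w' \<notin> insert w (tvars s \<union> tvars t)"
    "\<And>c. c \<in> set1_fm \<phi> \<Longrightarrow> w' \<notin> tvars (\<kappa> c)" "\<And>y. y \<in> fv \<phi> - {z} \<Longrightarrow> w' \<notin> tvars (\<sigma> y)"
    using fresh_variable[of "insert w (tvars s \<union> tvars t)" \<phi> z \<sigma>] by auto
  let ?A = "\<lambda>t. nf \<kappa> (\<sigma>(z := t)) \<phi>"
  have OT: "Var w \<in> OT" "Var w' \<in> OT" using w w' by (auto simp: odd_terms_def)
  have A: "?A t \<in> wff" if "t \<in> OT" for t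
    using assms that by (intro nf_wff) (auto intro: odd_terms_Ter)
  have sub_w: "subst (?A (Var w)) w u = ?A u" for u
    using w by (intro subst_nf_odd) auto
  have sub_w': "subst (?A (Var w')) w' u = ?A u" for u
    using w' by (intro subst_nf_odd) auto
  have id: "subst (?A u) v r = ?A u" if "v \<notin> tvars u" "odd v"
    "\<And>c. c \<in> set1_fm \<phi> \<Longrightarrow> v \<notin> tvars (\<kappa> c)" "\<And>y. y \<in> fv \<phi> - {z} \<Longrightarrow> v \<notin> tvars (\<sigma> y)" for u v r
  proof (rule subst_fresh)
    have "v \<notin> (\<Union>y\<in>fv \<phi>. tvars ((\<sigma>(z := u)) y)) \<union> (\<Union>c\<in>set1_fm \<phi>. tvars (\<kappa> c))"
      using that by (auto split: if_splits)
    then show "v \<notin> fv (?A u)" by (rule contra_subsetD[OF fv_normalize])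
  qed
  have "\<turnstile> (Var w \<^bold>\<approx> Var w') \<^bold>\<longrightarrow> (?A (Var w) \<^bold>\<longrightarrow> ?A (Var w'))"
  proof (rule qmbc_derives.axiom[OF AxEq2])
    show "free_for (Var w') w (?A (Var w))" by (rule free_for_nf[OF OT(2)])
    then show "some_repl w w' (?A (Var w)) (?A (Var w'))"
      using some_repl_subst sub_w by metis
  qed (use A OT in auto)
  from instantiate[OF this odd_terms_Ter[OF assms(3)], of w]
  have "\<turnstile> (s \<^bold>\<approx> Var w') \<^bold>\<longrightarrow> (?A s \<^bold>\<longrightarrow> ?A (Var w'))"
    using w w' id[of w "Var w'"] by (simp add: sub_w free_for_nf[OF assms(3)] fun_upd_same fun_upd_other del: fun_upd_apply)
  from instantiate[OF this odd_terms_Ter[OF assms(4)], of w']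
  show ?thesis
    using w' id[of w' s]
    by (simp add: free_for_nf[OF assms(4)] sub_w' tsubst_fresh fun_upd_same fun_upd_other del: fun_upd_apply)
qed

text \<open>Leibniz' law changes one variable at a time; \<open>A\<close> collects the free
  variables whose values have already been switched.\<close>

lemma nf_eq_cong:
  assumes "\<phi> \<in> For \<Xi>" "\<And>y. y \<in> fv \<phi> \<Longrightarrow> \<sigma> y \<in> OT" "\<And>y. y \<in> fv \<phi> \<Longrightarrow> \<sigma>' y \<in> OT"
    and "\<And>y. y \<in> fv \<phi> \<Longrightarrow> \<turnstile> \<sigma> y \<^bold>\<approx> \<sigma>' y"
  shows "\<turnstile> nf \<kappa> \<sigma> \<phi> \<^bold>\<longrightarrow> nf \<kappa> \<sigma>' \<phi>"
proof -
  let ?\<sigma> = "\<lambda>A y. if y \<in> A then \<sigma>' y else \<sigma> y"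
  have "\<turnstile> nf \<kappa> \<sigma> \<phi> \<^bold>\<longrightarrow> nf \<kappa> (?\<sigma> A) \<phi>" if "finite A" "A \<subseteq> fv \<phi>" for A
    using that
  proof (induction A)
    case empty
    then show ?case using assms by (auto intro!: imp_refl nf_wff intro: odd_terms_Ter)
  next
    case (insert x A)
    have "\<turnstile> (\<sigma> x \<^bold>\<approx> \<sigma>' x) \<^bold>\<longrightarrow> (nf \<kappa> ((?\<sigma> A)(x := \<sigma> x)) \<phi> \<^bold>\<longrightarrow> nf \<kappa> ((?\<sigma> A)(x := \<sigma>' x)) \<phi>)"
      using assms insert by (intro nf_leibniz) auto
    moreover have "(?\<sigma> A)(x := \<sigma> x) = ?\<sigma> A" "(?\<sigma> A)(x := \<sigma>' x) = ?\<sigma> (insert x A)"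
      using insert by auto
    ultimately show ?case using insert assms(4)[of x] by (auto intro: imp_trans MP)
  qed
  moreover have "nf \<kappa> (?\<sigma> (fv \<phi>)) \<phi> = nf \<kappa> \<sigma>' \<phi>"
    by (rule normalize_cong) auto
  ultimately show ?thesis by (metis finite_fv subset_refl)
qed

end

subsection \<open>Derivability through normal forms\<close>

context qmbc_theory
begin

lemma base_interpretation: "term_interpretation \<Theta> \<Gamma> (with_eq \<Theta>) Con"
  by unfold_locales (auto simp: odd_terms_def)

text \<open>A formula is derivable iff its universal closure \<open>C\<close> is.  Since \<open>C\<close> is closed, it is linked to its
  normal form by two steps of \<open>variant_normal_form\<close>, the first one renaming the bound variables to
  large odd numbers, away from the even names used by \<open>nf\<close>.\<close>

lemma closed_variant_nf:
  assumes "fv \<phi> = {}"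
  shows "variant \<phi> (nf Con \<sigma> \<phi>)"
proof -
  obtain n where n: "\<forall>x\<in>avars \<phi>. x < n"
    using finite_nat_set_iff_bounded[of "avars \<phi>"] by auto
  define b where "b = (\<lambda>k. 2 * (k + n) + 1)"
  define \<psi> where "\<psi> = normalize b Con Var \<phi>"
  have "inj b" by (auto simp: b_def inj_on_def)
  moreover have "b k \<notin> avars \<phi>" for k using n by (fastforce simp: b_def)
  ultimately have 1: "variant \<phi> \<psi>"
    unfolding \<psi>_def by (rule variant_normal_form)
  have "avars \<psi> \<subseteq> range b"
    using avars_normalize[of b Con Var \<phi>] assms by (simp add: \<psi>_def)
  moreover have "2 * k \<notin> range b" for k by (auto simp: b_def) presburger
  ultimately have "2 * k \<notin> avars \<psi>" for k by blast
  then have "variant \<psi> (nf Con Var \<psi>)"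
    by (intro variant_normal_form) (auto simp: inj_on_def)
  also have "nf Con Var \<psi> = nf Con Var \<phi>" using variant_normalize[OF 1] by metis
  also have "\<dots> = nf Con \<sigma> \<phi>" using assms by (intro normalize_cong) auto
  finally show ?thesis using 1 by (rule variant.trans[rotated])
qed

lemma derives_foldr_all: "\<turnstile> foldr (Quant Forall) xs \<phi> \<longleftrightarrow> \<turnstile> \<phi>"
proof (induction xs)
  case (Cons x xs)
  have "\<turnstile> \<psi>" if "\<turnstile> \<^bold>\<forall>x. \<psi>" for \<psi>
  proof -
    have "free_for (Var x) x \<psi>" by (induction \<psi>) auto
    then have "\<turnstile> (\<^bold>\<forall>x. \<psi>) \<^bold>\<longrightarrow> subst \<psi> x (Var x)"
      using derives_wff[OF that] by (intro all_subst) auto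
    then show ?thesis using that MP by (auto simp: subst_def fun_upd_idem)
  qed
  then have "\<turnstile> (\<^bold>\<forall>x. foldr (Quant Forall) xs \<phi>) \<longleftrightarrow> \<turnstile> foldr (Quant Forall) xs \<phi>"
    using generalization by metis
  then show ?case using Cons by simp
qed simp

lemma fv_foldr_Quant [simp]: "fv (foldr (Quant q) xs \<phi>) = fv \<phi> - set xs"
  by (induction xs) auto

lemma For_foldr_Quant [simp]: "foldr (Quant q) xs \<phi> \<in> For \<Xi> \<longleftrightarrow> \<phi> \<in> For \<Xi>"
  by (induction xs) auto

lemma derives_nf_foldr_all:
  assumes "\<phi> \<in> wff" "\<And>y. \<sigma> y \<in> OT"
  shows "\<turnstile> nf Con \<sigma> (foldr (Quant Forall) xs \<phi>) \<longleftrightarrow>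
    (\<forall>\<tau>. (\<forall>y. \<tau> y \<in> OT) \<longrightarrow> (\<forall>y. y \<notin> set xs \<longrightarrow> \<tau> y = \<sigma> y) \<longrightarrow> \<turnstile> nf Con \<tau> \<phi>)"
  using assms(2)
proof (induction xs arbitrary: \<sigma>)
  case Nil
  have "\<tau> = \<sigma>" if "\<forall>y. y \<notin> set [] \<longrightarrow> \<tau> y = \<sigma> y" for \<tau> using that by auto
  then show ?case using Nil by (metis foldr_Nil id_apply)
next
  case (Cons x xs)
  interpret term_interpretation \<Theta> \<Gamma> "with_eq \<Theta>" Con by (rule base_interpretation)
  let ?\<psi> = "foldr (Quant Forall) xs \<phi>"
  have "\<turnstile> nf Con \<sigma> (\<^bold>\<forall>x. ?\<psi>) \<longleftrightarrow> (\<forall>t\<in>OT. \<turnstile> nf Con (\<sigma>(x := t)) ?\<psi>)"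
  proof
    assume "\<turnstile> nf Con \<sigma> (\<^bold>\<forall>x. ?\<psi>)"
    then show "\<forall>t\<in>OT. \<turnstile> nf Con (\<sigma>(x := t)) ?\<psi>"
      using MP[OF nf_quant_elim(1)] assms(1) Cons.prems by auto
  next
    assume *: "\<forall>t\<in>OT. \<turnstile> nf Con (\<sigma>(x := t)) ?\<psi>"
    \<comment> \<open>\<open>nf_quant_intro\<close> works below an antecedent; a theorem serves as
      one and is detached afterwards.\<close>
    have "\<turnstile> (falsum \<^bold>\<longrightarrow> falsum) \<^bold>\<longrightarrow> nf Con \<sigma> (\<^bold>\<forall>x. ?\<psi>)"
      using assms(1) Cons.prems * by (intro nf_quant_intro(1) weaken) auto
    then show "\<turnstile> nf Con \<sigma> (\<^bold>\<forall>x. ?\<psi>)" using MP imp_refl[OF falsum_wff] by blast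
  qed
  also have "\<dots> \<longleftrightarrow> (\<forall>t\<in>OT. \<forall>\<tau>. (\<forall>y. \<tau> y \<in> OT) \<longrightarrow> (\<forall>y. y \<notin> set xs \<longrightarrow> \<tau> y = (\<sigma>(x := t)) y) \<longrightarrow> \<turnstile> nf Con \<tau> \<phi>)"
    using Cons by (intro ball_cong refl Cons.IH) auto
  also have "\<dots> \<longleftrightarrow> (\<forall>\<tau>. (\<forall>y. \<tau> y \<in> OT) \<longrightarrow> (\<forall>y. y \<notin> set (x # xs) \<longrightarrow> \<tau> y = \<sigma> y) \<longrightarrow> \<turnstile> nf Con \<tau> \<phi>)"
  proof (intro iffI allI impI ballI)
    fix \<tau> assume *: "\<forall>t\<in>OT. \<forall>\<tau>. (\<forall>y. \<tau> y \<in> OT) \<longrightarrow> (\<forall>y. y \<notin> set xs \<longrightarrow> \<tau> y = (\<sigma>(x := t)) y) \<longrightarrow> \<turnstile> nf Con \<tau> \<phi>"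
      and \<tau>: "\<forall>y. \<tau> y \<in> OT" "\<forall>y. y \<notin> set (x # xs) \<longrightarrow> \<tau> y = \<sigma> y"
    have "\<forall>y. y \<notin> set xs \<longrightarrow> \<tau> y = (\<sigma>(x := \<tau> x)) y" using \<tau>(2) by auto
    then show "\<turnstile> nf Con \<tau> \<phi>" using * \<tau>(1) by blast
  next
    fix t \<tau> assume *: "\<forall>\<tau>. (\<forall>y. \<tau> y \<in> OT) \<longrightarrow> (\<forall>y. y \<notin> set (x # xs) \<longrightarrow> \<tau> y = \<sigma> y) \<longrightarrow> \<turnstile> nf Con \<tau> \<phi>"
      and \<tau>: "\<forall>y. \<tau> y \<in> OT" "\<forall>y. y \<notin> set xs \<longrightarrow> \<tau> y = (\<sigma>(x := t)) y"
    have "\<forall>y. y \<notin> set (x # xs) \<longrightarrow> \<tau> y = \<sigma> y" using \<tau>(2) by auto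
    then show "\<turnstile> nf Con \<tau> \<phi>" using * \<tau>(1) by blast
  qed
  finally show ?case by simp
qed

text \<open>Free variables of \<open>\<phi>\<close> may be even and clash with the binders of a
  normal form. Derivability is therefore moved through the universal closure and read off again at
  odd terms.\<close>

lemma derives_iff_nf:
  assumes "\<phi> \<in> wff"
  shows "\<turnstile> \<phi> \<longleftrightarrow> (\<forall>\<sigma>. (\<forall>y. \<sigma> y \<in> OT) \<longrightarrow> \<turnstile> nf Con \<sigma> \<phi>)"
proof -
  interpret term_interpretation \<Theta> \<Gamma> "with_eq \<Theta>" Con by (rule base_interpretation)
  obtain xs where xs: "set xs = fv \<phi>" using finite_list[OF finite_fv] by blast
  let ?C = "foldr (Quant Forall) xs \<phi>"
  \<comment> \<open>A default for variables that the quantifier prefix does not bind;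
    \<open>Var 1\<close> is the first variable that is an odd term.\<close>
  define \<sigma>0 :: "nat \<Rightarrow> ('c, 'f) tm" where "\<sigma>0 = (\<lambda>_. Var 1)"
  have \<sigma>0: "\<sigma>0 y \<in> OT" for y by (simp add: \<sigma>0_def odd_terms_def)
  have wff: "?C \<in> wff" "nf Con \<sigma>0 ?C \<in> wff"
    using assms \<sigma>0 by (auto intro!: nf_wff intro: odd_terms_Ter)
  have var: "variant ?C (nf Con \<sigma>0 ?C)" using xs by (intro closed_variant_nf) simp
  have "\<turnstile> \<phi> \<longleftrightarrow> \<turnstile> ?C" by (simp add: derives_foldr_all)
  also have "\<dots> \<longleftrightarrow> \<turnstile> nf Con \<sigma>0 ?C"
    using MP variant_imp[OF var wff] variant_imp[OF variant.sym[OF var] wff(2,1)] by blast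
  also have "\<dots> \<longleftrightarrow> (\<forall>\<sigma>. (\<forall>y. \<sigma> y \<in> OT) \<longrightarrow> \<turnstile> nf Con \<sigma> \<phi>)"
  proof -
    have "\<turnstile> nf Con \<sigma> \<phi>" if "\<forall>y. \<sigma> y \<in> OT"
      "\<forall>\<tau>. (\<forall>y. \<tau> y \<in> OT) \<longrightarrow> (\<forall>y. y \<notin> set xs \<longrightarrow> \<tau> y = \<sigma>0 y) \<longrightarrow> \<turnstile> nf Con \<tau> \<phi>" for \<sigma>
    proof -
      let ?\<tau> = "\<lambda>y. if y \<in> set xs then \<sigma> y else \<sigma>0 y"
      have "\<turnstile> nf Con ?\<tau> \<phi>" using that \<sigma>0 by simp
      moreover have "nf Con ?\<tau> \<phi> = nf Con \<sigma> \<phi>" using xs by (intro normalize_cong) auto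
      ultimately show ?thesis by metis
    qed
    then show ?thesis unfolding derives_nf_foldr_all[OF assms \<sigma>0] by blast
  qed
  finally show ?thesis .
qed

section \<open>The canonical model\<close>

definition snapshot_of :: "('c, 'f, 'p eqsym) fm \<Rightarrow> ('c, 'f, 'p eqsym) fm set snapshot" where
  "snapshot_of \<phi> = (val \<phi>, val (\<^bold>\<not> \<phi>), val (\<^bold>\<circ> \<phi>))"

text \<open>The largest swap structure over the algebra: each multioperation returns every snapshot
  with the prescribed first coordinate. On connectives a valuation then only has to get first
  coordinates right.\<close>

definition swap_model :: "('c, 'f, 'p eqsym) fm set multialgebra" where
  "swap_model = \<lparr>msupp = snapshots regulars,
     mun = (\<lambda>u x. {z \<in> snapshots regulars. crd1 z = (case u of Neg \<Rightarrow> crd2 x | Circ \<Rightarrow> crd3 x)}),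
     mbin = (\<lambda>c x y. {z \<in> snapshots regulars. crd1 z = ba_op regulars c (crd1 x) (crd1 y)})\<rparr>"

lemma snapshots_regulars:
  "(X, Y, Z) \<in> snapshots regulars \<longleftrightarrow> regular X \<and> regular Y \<and> regular Z \<and>
     regularization (X \<union> Y) = consistent \<and> X \<inter> Y \<inter> Z = {}"
  by (auto simp: snapshots_def join_regulars meet_regulars regular_Int top_regulars bottom_regulars)

lemma ex_snapshot:
  assumes "regular X"
  shows "{z \<in> snapshots regulars. crd1 z = X} \<noteq> {}"
proof -
  have "regularization (X \<union> consistent) = consistent"
    using regular_subset[OF assms] regularization_least[of "X \<union> consistent" consistent]
      subset_regularization[of "X \<union> consistent"] regular_carrier by blast
  \<comment> \<open>Top in the second place satisfies the join condition and bottom in the third the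
    meet condition, whatever \<open>X\<close> is.\<close>
  then have "(X, consistent, {}) \<in> snapshots regulars"
    using assms by (simp add: snapshots_regulars regular_carrier regular_empty)
  then have "(X, consistent, {}) \<in> {z \<in> snapshots regulars. crd1 z = X}" by simp
  then show ?thesis by blast
qed

lemma swap_structure_model: "swap_structure regulars swap_model"
proof
  show "msupp swap_model \<noteq> {}"
    using ex_snapshot[OF regular_empty] unfolding swap_model_def multialgebra.simps by blast
  have reg: "regular (crd1 x)" "regular (crd2 x)" "regular (crd3 x)" if "x \<in> snapshots regulars" for x
    using that by (auto simp: snapshots_def)
  have "regular (ba_op regulars c (crd1 x) (crd1 y))"
    if "x \<in> snapshots regulars" "y \<in> snapshots regulars" for c x y
    using that by (cases c) (simp_all add: reg meet_regulars join_regulars compl_regulars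
        regular_Int regular_regularization regular_pseudocomplement)
  then show "mbin swap_model c x y \<noteq> {} \<and> mbin swap_model c x y \<subseteq>
      {z \<in> msupp swap_model. crd1 z = ba_op regulars c (crd1 x) (crd1 y)}"
    if "x \<in> msupp swap_model" "y \<in> msupp swap_model" for c x y
    using that ex_snapshot unfolding swap_model_def multialgebra.simps by blast
  show "mun swap_model Neg x \<noteq> {} \<and> mun swap_model Neg x \<subseteq> {z \<in> msupp swap_model. crd1 z = crd2 x}"
    if "x \<in> msupp swap_model" for x
    using that ex_snapshot[OF reg(2)] unfolding swap_model_def multialgebra.simps unop.case by blast
  show "mun swap_model Circ x \<noteq> {} \<and> mun swap_model Circ x \<subseteq> {z \<in> msupp swap_model. crd1 z = crd3 x}"
    if "x \<in> msupp swap_model" for x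
    using that ex_snapshot[OF reg(3)] unfolding swap_model_def multialgebra.simps unop.case by blast
qed (simp add: swap_model_def)

text \<open>A10 yields the join condition on snapshots, A11 the meet condition.\<close>

lemma snapshot_of_snapshots: "\<phi> \<in> wff \<Longrightarrow> snapshot_of \<phi> \<in> snapshots regulars"
proof -
  assume \<phi>: "\<phi> \<in> wff"
  have "\<turnstile> \<phi> \<^bold>\<or> \<^bold>\<not> \<phi>" using \<phi> by (auto intro!: qmbc_derives.axiom A10)
  then have "val (\<phi> \<^bold>\<or> \<^bold>\<not> \<phi>) = consistent" using val_top \<phi> by auto
  then have "regularization (val \<phi> \<union> val (\<^bold>\<not> \<phi>)) = consistent" using \<phi> by (simp add: val_disj)
  moreover have False if "\<alpha> \<in> val \<phi>" "\<alpha> \<in> val (\<^bold>\<not> \<phi>)" "\<alpha> \<in> val (\<^bold>\<circ> \<phi>)" for \<alpha>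
  proof -
    have "\<turnstile> \<^bold>\<circ> \<phi> \<^bold>\<longrightarrow> (\<phi> \<^bold>\<longrightarrow> (\<^bold>\<not> \<phi> \<^bold>\<longrightarrow> falsum))"
      using \<phi> by (auto intro!: qmbc_derives.axiom A11)
    moreover have "\<turnstile> \<alpha> \<^bold>\<longrightarrow> \<phi>" "\<turnstile> \<alpha> \<^bold>\<longrightarrow> \<^bold>\<not> \<phi>" "\<turnstile> \<alpha> \<^bold>\<longrightarrow> \<^bold>\<circ> \<phi>"
      using that by (simp_all add: val_def)
    ultimately have "\<turnstile> \<alpha> \<^bold>\<longrightarrow> falsum"
      by (meson imp_S imp_trans)
    then show False using that(1) by (simp add: val_def consistent_def)
  qed
  ultimately show ?thesis
    unfolding snapshot_of_def snapshots_regulars using \<phi> by (auto simp: regular_val)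
qed

lemma crd1_snapshot_of [simp]: "crd1 (snapshot_of \<phi>) = val \<phi>"
  by (simp add: snapshot_of_def)

lemma designated_snapshot_of: "\<phi> \<in> wff \<Longrightarrow> snapshot_of \<phi> \<in> designated regulars swap_model \<longleftrightarrow> \<turnstile> \<phi>"
  by (simp add: designated_def swap_model_def snapshot_of_snapshots top_regulars val_top)

end

context term_interpretation
begin

text \<open>Leibniz' law is applied to \<open>\<phi>\<close>, \<open>\<not>\<phi>\<close> and
  \<open>\<circ>\<phi>\<close> separately, since equivalence in the first coordinate would not carry
  over to the other two.\<close>

lemma snapshot_of_nf_cong:
  assumes "\<phi> \<in> For \<Xi>" "\<And>y. y \<in> fv \<phi> \<Longrightarrow> \<sigma> y \<in> OT" "\<And>y. y \<in> fv \<phi> \<Longrightarrow> \<sigma>' y \<in> OT"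
    and "\<And>y. y \<in> fv \<phi> \<Longrightarrow> \<turnstile> \<sigma> y \<^bold>\<approx> \<sigma>' y" "\<And>y. y \<in> fv \<phi> \<Longrightarrow> \<turnstile> \<sigma>' y \<^bold>\<approx> \<sigma> y"
  shows "snapshot_of (nf \<kappa> \<sigma> \<phi>) = snapshot_of (nf \<kappa> \<sigma>' \<phi>)"
proof -
  have "val (nf \<kappa> \<sigma> \<psi>) = val (nf \<kappa> \<sigma>' \<psi>)" if "\<psi> = \<phi> \<or> (\<exists>u. \<psi> = Unary u \<phi>)" for \<psi>
    using that assms by (intro subset_antisym val_mono nf_eq_cong) auto
  from this[of \<phi>] this[of "Unary _ \<phi>"] show ?thesis by (auto simp: snapshot_of_def)
qed

end

section \<open>Provable equality as a congruence, and the term model\<close>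

context qmbc_theory
begin

lemma eq_sym:
  assumes "\<turnstile> s \<^bold>\<approx> t" "s \<in> OT" "t \<in> OT"
  shows "\<turnstile> t \<^bold>\<approx> s"
proof -
  interpret term_interpretation \<Theta> \<Gamma> "with_eq \<Theta>" Con by (rule base_interpretation)
  \<comment> \<open>The left side of an equation is exchanged, from the reflexivity instance
    \<open>s \<approx> s\<close> to \<open>t \<approx> s\<close>.\<close>
  have "\<turnstile> nf Con (\<lambda>y. s) (Var 0 \<^bold>\<approx> Var 1) \<^bold>\<longrightarrow> nf Con (\<lambda>y. if y = 0 then t else s) (Var 0 \<^bold>\<approx> Var 1)"
    using assms eq_refl[OF odd_terms_Ter] by (intro nf_eq_cong) auto
  then show ?thesis using MP eq_refl[OF odd_terms_Ter] assms by auto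
qed

lemma eq_trans:
  assumes "\<turnstile> s \<^bold>\<approx> t" "\<turnstile> t \<^bold>\<approx> u" "s \<in> OT" "t \<in> OT" "u \<in> OT"
  shows "\<turnstile> s \<^bold>\<approx> u"
proof -
  interpret term_interpretation \<Theta> \<Gamma> "with_eq \<Theta>" Con by (rule base_interpretation)
  have "\<turnstile> nf Con (\<lambda>y. if y = 0 then s else t) (Var 0 \<^bold>\<approx> Var 1) \<^bold>\<longrightarrow>
      nf Con (\<lambda>y. if y = 0 then s else u) (Var 0 \<^bold>\<approx> Var 1)"
    using assms eq_refl[OF odd_terms_Ter] by (intro nf_eq_cong) auto
  then show ?thesis using MP assms by auto
qed

lemma eq_App:
  assumes "f \<in> fsyms \<Theta> (length ts)" "length ts' = length ts" "set ts \<subseteq> OT" "set ts' \<subseteq> OT"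
    and "\<And>i. i < length ts \<Longrightarrow> \<turnstile> ts ! i \<^bold>\<approx> ts' ! i"
  shows "\<turnstile> App f ts \<^bold>\<approx> App f ts'"
proof -
  interpret term_interpretation \<Theta> \<Gamma> "with_eq \<Theta>" Con by (rule base_interpretation)
  let ?n = "length ts"
  \<comment> \<open>The two sides get disjoint blocks of variables, so that only the right block is
    changed from \<open>ts\<close> to \<open>ts'\<close>.\<close>
  let ?\<phi> = "App f (map Var [0..<?n]) \<^bold>\<approx> App f (map (\<lambda>i. Var (?n + i)) [0..<?n])"
  let ?\<sigma> = "\<lambda>us i. if i < ?n then ts ! i else us ! (i - ?n)"
  have app: "App f ts \<in> Ter (with_eq \<Theta>)"
    using assms(1,3) odd_terms_Ter by (auto simp: with_eq_def)
  have nth: "ts ! i \<in> OT" "ts' ! i \<in> OT" if "i < ?n" for i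
    using that assms(2-4) nth_mem by (fastforce simp: subset_iff)+
  have *: "\<turnstile> nf Con (?\<sigma> ts) ?\<phi> \<^bold>\<longrightarrow> nf Con (?\<sigma> ts') ?\<phi>"
  proof (rule nf_eq_cong)
    show "?\<phi> \<in> wff" using assms(1) by (auto simp: with_eq_def numeral_2_eq_2)
  qed (use nth assms(5) eq_refl[OF odd_terms_Ter] in auto)
  have **: "nf Con (?\<sigma> us) ?\<phi> = App f ts \<^bold>\<approx> App f us" if "length us = ?n" for us
    using that by (auto intro!: nth_equalityI)
  show ?thesis by (rule MP[OF *[unfolded **[OF HOL.refl] **[OF assms(2)]] eq_refl[OF app]])
qed

lemma snapshot_of_Atom_cong:
  assumes "P \<in> psyms (with_eq \<Theta>) (length ts)" "length ts' = length ts" "set ts \<subseteq> OT" "set ts' \<subseteq> OT"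
    and "\<And>i. i < length ts \<Longrightarrow> \<turnstile> ts ! i \<^bold>\<approx> ts' ! i"
  shows "snapshot_of (Atom P ts) = snapshot_of (Atom P ts')"
proof -
  interpret term_interpretation \<Theta> \<Gamma> "with_eq \<Theta>" Con by (rule base_interpretation)
  let ?n = "length ts"
  let ?\<phi> = "Atom P (map Var [0..<?n])"
  have nth: "ts ! i \<in> OT" "ts' ! i \<in> OT" if "i < ?n" for i
    using that assms(2-4) nth_mem by (fastforce simp: subset_iff)+
  have *: "snapshot_of (nf Con (\<lambda>i. ts ! i) ?\<phi>) = snapshot_of (nf Con (\<lambda>i. ts' ! i) ?\<phi>)"
  proof (rule snapshot_of_nf_cong)
    show "?\<phi> \<in> wff" using assms(1) by auto
  qed (use nth assms(5) eq_sym in auto)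
  have **: "nf Con (\<lambda>i. us ! i) ?\<phi> = Atom P us" if "length us = ?n" for us
    using that by (auto intro!: nth_equalityI)
  show ?thesis by (rule *[unfolded **[OF HOL.refl] **[OF assms(2)]])
qed

text \<open>The class of \<open>t\<close> is coded as a set of equations, because the domains of the structures have to consist
  of sets of formulas.\<close>

definition cls :: "('c, 'f) tm \<Rightarrow> ('c, 'f, 'p eqsym) fm set" where
  "cls t = {Var 0 \<^bold>\<approx> s | s. s \<in> OT \<and> \<turnstile> t \<^bold>\<approx> s}"

definition rep :: "('c, 'f, 'p eqsym) fm set \<Rightarrow> ('c, 'f) tm" where
  "rep a = (SOME t. t \<in> OT \<and> cls t = a)"

lemma cls_eq_iff: "s \<in> OT \<Longrightarrow> t \<in> OT \<Longrightarrow> cls s = cls t \<longleftrightarrow> \<turnstile> s \<^bold>\<approx> t"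
proof
  assume st: "s \<in> OT" "t \<in> OT" and "cls s = cls t"
  moreover have "Var 0 \<^bold>\<approx> t \<in> cls t" using eq_refl[OF odd_terms_Ter] st by (auto simp: cls_def)
  ultimately have "Var 0 \<^bold>\<approx> t \<in> cls s" by simp
  then show "\<turnstile> s \<^bold>\<approx> t" by (auto simp: cls_def)
qed (auto simp: cls_def intro: eq_trans eq_sym)

lemma rep_OT: "a \<in> cls ` OT \<Longrightarrow> rep a \<in> OT" and cls_rep: "a \<in> cls ` OT \<Longrightarrow> cls (rep a) = a"
  unfolding rep_def by (rule someI2_ex; auto)+

lemma rep_cls_eq: "t \<in> OT \<Longrightarrow> \<turnstile> t \<^bold>\<approx> rep (cls t)"
  using cls_eq_iff[of t "rep (cls t)"] rep_OT cls_rep by auto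

text \<open>Functions and predicates act on chosen representatives; \<open>eq_App\<close> and
  \<open>snapshot_of_Atom_cong\<close> show that provably equal arguments give the same
  result.\<close>

definition term_model :: "('c, 'f, 'p eqsym, ('c, 'f, 'p) universe, ('c, 'f, 'p) universe) fostruct" where
  "term_model = \<lparr>univ = cls ` OT, cint = (\<lambda>c. cls (Con c)),
     fint = (\<lambda>f as. cls (App f (map rep as))), pint = (\<lambda>P as. snapshot_of (Atom P (map rep as)))\<rparr>"

lemma univ_term_model [simp]: "univ term_model = cls ` OT"
  by (simp add: term_model_def)

lemma App_OT: "f \<in> fsyms \<Theta> (length ts) \<Longrightarrow> set ts \<subseteq> OT \<Longrightarrow> App f ts \<in> OT"
  by (auto simp: odd_terms_def with_eq_def)

lemma rep_set_OT: "set as \<subseteq> cls ` OT \<Longrightarrow> set (map rep as) \<subseteq> OT"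
  using rep_OT by auto

lemma fo_structure_term_model: "fo_structure (with_eq \<Theta>) swap_model term_model"
proof
  have "Var 1 \<in> OT" by (simp add: odd_terms_def)
  then show "univ term_model \<noteq> {}" by auto
  show "cint term_model c \<in> univ term_model" if "c \<in> csyms (with_eq \<Theta>)" for c
    using that by (auto simp: term_model_def odd_terms_def)
  show "fint term_model f as \<in> univ term_model"
    if "f \<in> fsyms (with_eq \<Theta>) (length as)" "set as \<subseteq> univ term_model" for f as
    using that App_OT[of f "map rep as"] rep_set_OT by (auto simp: term_model_def with_eq_def)
  show "pint term_model P as \<in> msupp swap_model"
    if "P \<in> psyms (with_eq \<Theta>) (length as)" "set as \<subseteq> univ term_model" for P as
  proof -
    have "Atom P (map rep as) \<in> wff" using that rep_set_OT[of as] odd_terms_Ter by auto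
    then show ?thesis using snapshot_of_snapshots by (simp add: term_model_def swap_model_def)
  qed
qed

lemma standard_equality_term_model: "standard_equality regulars swap_model term_model"
  unfolding standard_equality_def
proof (intro ballI)
  fix a b assume ab: "a \<in> univ term_model" "b \<in> univ term_model"
  then have "rep a \<in> OT" "rep b \<in> OT" using rep_OT by auto
  moreover from this have "rep a \<^bold>\<approx> rep b \<in> wff" by (auto intro: odd_terms_Ter)
  ultimately show "pint term_model EqSym [a, b] \<in> designated regulars swap_model \<longleftrightarrow> a = b"
    using ab cls_eq_iff[of "rep a" "rep b"] cls_rep[of a] cls_rep[of b]
    by (simp add: term_model_def designated_snapshot_of)
qed

section \<open>The canonical valuation\<close>

abbreviation diagram :: "('c + ('c, 'f, 'p) universe, 'f, 'p eqsym) sig" where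
  "diagram \<equiv> diag_sig (with_eq \<Theta>) (univ term_model)"

abbreviation interp :: "'c + ('c, 'f, 'p) universe \<Rightarrow> ('c, 'f) tm" where
  "interp \<equiv> case_sum Con rep"

text \<open>Evaluating the normal form gives variants the same snapshot. \<open>Var 1\<close> is a
  default value of the environment, with an odd variable so that the laws for odd terms
  apply.\<close>

definition canonical :: "('c + ('c, 'f, 'p) universe, 'f, 'p eqsym) fm \<Rightarrow> ('c, 'f, 'p) universe snapshot" where
  "canonical \<phi> = snapshot_of (nf interp (\<lambda>_. Var 1) \<phi>)"

lemma diagram_interpretation: "term_interpretation \<Theta> \<Gamma> diagram interp"
proof
  fix c assume "c \<in> csyms diagram"
  then consider d where "c = Inl d" "d \<in> csyms (with_eq \<Theta>)" | a where "c = Inr a" "a \<in> cls ` OT"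
    by (auto simp: diag_sig_def)
  then show "interp c \<in> OT"
  proof cases
    case 1
    then show ?thesis by (simp add: odd_terms_def)
  next
    case 2
    then show ?thesis using rep_OT by simp
  qed
qed (simp_all add: diag_sig_def)

lemma assignmentsD: "\<mu> \<in> assignments term_model \<Longrightarrow> \<mu> x \<in> cls ` OT"
  by (auto simp: assignments_def)

lemma nf_inst: "nf interp \<sigma> (inst \<mu> \<phi>) = nf interp (\<lambda>x. rep (\<mu> x)) \<phi>"
  unfolding inst_def by (subst normalize_psubst[OF no_capture_closed]) auto

text \<open>Reading a term syntactically and evaluating it in the model agree only up to provable
  equality, because each function application passes to a newly chosen representative.\<close>

lemma teval_eq:
  assumes "t \<in> Ter diagram" "\<mu> \<in> assignments term_model"
  shows "teval (expansion term_model) \<mu> t \<in> cls ` OT \<and> tm_interp interp (\<lambda>x. rep (\<mu> x)) t \<in> OT \<and>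
    \<turnstile> tm_interp interp (\<lambda>x. rep (\<mu> x)) t \<^bold>\<approx> rep (teval (expansion term_model) \<mu> t)"
  using assms(1)
proof (induction t rule: Ter.induct)
  case (1 x)
  have "\<mu> x \<in> cls ` OT" using assms(2) by (rule assignmentsD)
  then show ?case using rep_OT[of "\<mu> x"] eq_refl[OF odd_terms_Ter] by simp
next
  case (2 c)
  then consider d where "c = Inl d" "d \<in> csyms (with_eq \<Theta>)" | a where "c = Inr a" "a \<in> cls ` OT"
    by (auto simp: diag_sig_def)
  then show ?case
  proof cases
    case 1
    then have "Con d \<in> OT" by (simp add: odd_terms_def)
    then show ?thesis using 1 rep_cls_eq by (simp add: expansion_def term_model_def)
  next
    case 2
    then show ?thesis using rep_OT[of a] eq_refl[OF odd_terms_Ter] by (simp add: expansion_def)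
  qed
next
  case (3 f ts)
  let ?t = "tm_interp interp (\<lambda>x. rep (\<mu> x))"
  let ?e = "teval (expansion term_model) \<mu>"
  have f: "f \<in> fsyms \<Theta> (length ts)" using 3(1) by (simp add: diag_sig_def with_eq_def)
  have IH: "?e t \<in> cls ` OT" "?t t \<in> OT" "\<turnstile> ?t t \<^bold>\<approx> rep (?e t)" if "t \<in> set ts" for t
    using 3(2) that by auto
  have 1: "App f (map ?t ts) \<in> OT" using f IH(2) by (intro App_OT) auto
  have 2: "App f (map (\<lambda>t. rep (?e t)) ts) \<in> OT" using f rep_OT[OF IH(1)] by (intro App_OT) auto
  have "\<turnstile> App f (map ?t ts) \<^bold>\<approx> App f (map (\<lambda>t. rep (?e t)) ts)"
    using f IH rep_OT[OF IH(1)] by (intro eq_App) auto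
  then have "\<turnstile> App f (map ?t ts) \<^bold>\<approx> rep (cls (App f (map (\<lambda>t. rep (?e t)) ts)))"
    using 1 2 rep_cls_eq[OF 2] rep_OT[of "cls _"] by (blast intro: eq_trans)
  then show ?case using 1 2 by (simp add: expansion_def term_model_def comp_def)
qed

text \<open>Both sides are normal forms of \<open>\<phi>\<close> in environments that differ at
  \<open>z\<close> by provably equal terms. Applied to compound formulas this gives the three
  substitution clauses of a valuation.\<close>

lemma canonical_subst:
  assumes "\<phi> \<in> For diagram" "t \<in> Ter diagram" "free_for t z \<phi>" "\<mu> \<in> assignments term_model"
    and "b = teval (expansion term_model) \<mu> t"
  shows "canonical (inst \<mu> (subst \<phi> z t)) = canonical (inst \<mu> (subst \<phi> z (name b)))"
proof -
  interpret term_interpretation \<Theta> \<Gamma> diagram interp by (rule diagram_interpretation)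
  let ?\<sigma> = "\<lambda>x. rep (\<mu> x)"
  let ?t = "tm_interp interp ?\<sigma> t"
  have t: "b \<in> cls ` OT" "?t \<in> OT" "\<turnstile> ?t \<^bold>\<approx> rep b" using teval_eq[OF assms(2,4)] assms(5) by auto
  have b: "rep b \<in> OT" using t(1) by (rule rep_OT)
  have \<sigma>: "?\<sigma> x \<in> OT" for x using assignmentsD[OF assms(4)] by (rule rep_OT)
  have "free_for (name b) z \<phi>" by (rule free_for_fresh) simp
  then have "nf interp ?\<sigma> (subst \<phi> z (name b)) = nf interp (?\<sigma>(z := rep b)) \<phi>"
    by (simp add: normalize_subst)
  moreover have "nf interp ?\<sigma> (subst \<phi> z t) = nf interp (?\<sigma>(z := ?t)) \<phi>"
    using assms(3) by (simp add: normalize_subst)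
  moreover have "snapshot_of (nf interp (?\<sigma>(z := ?t)) \<phi>) = snapshot_of (nf interp (?\<sigma>(z := rep b)) \<phi>)"
    using assms(1) t b \<sigma> eq_sym eq_refl[OF odd_terms_Ter] by (intro snapshot_of_nf_cong) auto
  ultimately show ?thesis by (simp add: canonical_def nf_inst)
qed

text \<open>The quantifier clauses range over individuals, the quantifier laws over odd terms. Each
  odd term is provably equal to the representative of its class, so both families have the same
  values.\<close>

lemma canonical_quant:
  assumes "\<phi> \<in> For diagram" "fv \<phi> \<subseteq> {x}"
  shows "(\<lambda>a. crd1 (canonical (subst \<phi> x (name a)))) ` univ term_model =
    (\<lambda>t. val (nf interp ((\<lambda>_. Var 1)(x := t)) \<phi>)) ` OT" (is "?f ` _ = ?g ` _")
proof -
  interpret term_interpretation \<Theta> \<Gamma> diagram interp by (rule diagram_interpretation)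
  have f: "?f a = ?g (rep a)" for a
  proof -
    have "free_for (name a) x \<phi>" by (rule free_for_fresh) simp
    then show ?thesis by (simp add: canonical_def normalize_subst)
  qed
  have g: "?g (rep (cls t)) = ?g t" if t: "t \<in> OT" for t
  proof -
    have r: "rep (cls t) \<in> OT" using t by (auto intro: rep_OT)
    have "snapshot_of (nf interp ((\<lambda>_. Var 1)(x := rep (cls t))) \<phi>) =
        snapshot_of (nf interp ((\<lambda>_. Var 1)(x := t)) \<phi>)"
      using assms t r rep_cls_eq[OF t] eq_sym[OF rep_cls_eq[OF t]] by (intro snapshot_of_nf_cong) auto
    then show ?thesis by (metis crd1_snapshot_of)
  qed
  have "?f ` univ term_model = (\<lambda>t. ?f (cls t)) ` OT" by (simp add: image_image)
  also have "\<dots> = ?g ` OT" using f g by (intro image_cong) auto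
  finally show ?thesis .
qed

lemma canonical_valuation: "qmbc_eq_valuation \<Theta> regulars swap_model term_model canonical"
proof -
  interpret term_interpretation \<Theta> \<Gamma> diagram interp by (rule diagram_interpretation)
  let ?\<sigma> = "\<lambda>_ :: nat. Var 1 :: ('c, 'f) tm"
  have wff: "nf interp ?\<sigma> \<phi> \<in> wff" if "\<phi> \<in> For diagram" for \<phi>
    using that by (intro nf_wff) auto
  have Var_1: "Var 1 \<in> OT" by (simp add: odd_terms_def)
  have snapshot: "canonical \<phi> \<in> snapshots regulars" if "\<phi> \<in> For diagram" for \<phi>
    unfolding canonical_def by (rule snapshot_of_snapshots[OF wff[OF that]])
  show ?thesis
  proof
    fix \<phi> assume "\<phi> \<in> Sen diagram"
    then show "canonical \<phi> \<in> msupp swap_model" using snapshot by (simp add: Sen_def swap_model_def)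
  next
    fix P ts \<mu>
    assume *: "Atom P ts \<in> Sen diagram" "\<mu> \<in> assignments term_model"
    let ?t = "tm_interp interp (\<lambda>x. rep (\<mu> x))"
    let ?e = "teval (expansion term_model) \<mu>"
    have ts: "P \<in> psyms (with_eq \<Theta>) (length ts)" "\<And>t. t \<in> set ts \<Longrightarrow> t \<in> Ter diagram"
      "\<And>t. t \<in> set ts \<Longrightarrow> tvars t = {}" using * by (auto simp: Sen_def diag_sig_def)
    have IH: "?e t \<in> cls ` OT" "?t t \<in> OT" "\<turnstile> ?t t \<^bold>\<approx> rep (?e t)" if "t \<in> set ts" for t
      using teval_eq[OF ts(2)[OF that] *(2)] by auto
    have "map (tm_interp interp ?\<sigma>) ts = map ?t ts"
      using ts(3) by (auto intro!: tm_interp_cong)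
    then have "canonical (Atom P ts) = snapshot_of (Atom P (map ?t ts))"
      by (simp only: canonical_def normalize.simps)
    also have "\<dots> = snapshot_of (Atom P (map (\<lambda>t. rep (?e t)) ts))"
      using ts(1) IH rep_OT[OF IH(1)] by (intro snapshot_of_Atom_cong) auto
    finally show "canonical (Atom P ts) = pint term_model P (map ?e ts)"
      by (simp add: term_model_def comp_def)
  next
    fix u \<phi> assume "\<phi> \<in> Sen diagram"
    then have "canonical (Unary u \<phi>) \<in> snapshots regulars"
      using snapshot[of "Unary u \<phi>"] by (simp add: Sen_def)
    then show "canonical (Unary u \<phi>) \<in> mun swap_model u (canonical \<phi>)"
      by (cases u) (simp_all add: swap_model_def canonical_def snapshot_of_def)
  next
    fix c \<phi> \<psi> assume *: "\<phi> \<in> Sen diagram" "\<psi> \<in> Sen diagram"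
    then have "canonical (Binary c \<phi> \<psi>) \<in> snapshots regulars"
      using snapshot[of "Binary c \<phi> \<psi>"] by (simp add: Sen_def)
    then show "canonical (Binary c \<phi> \<psi>) \<in> mbin swap_model c (canonical \<phi>) (canonical \<psi>)"
      using * wff by (simp add: swap_model_def canonical_def val_bin Sen_def)
  next
    fix x \<phi> assume "(\<^bold>\<forall>x. \<phi>) \<in> Sen diagram"
    then have \<phi>: "\<phi> \<in> For diagram" "fv \<phi> \<subseteq> {x}" by (auto simp: Sen_def)
    note elim = nf_quant_elim[where \<sigma> = ?\<sigma> and x = x, OF \<phi>(1) Var_1]
    note intro = nf_quant_intro[where \<sigma> = ?\<sigma> and x = x, OF \<phi>(1) Var_1]
    have wff': "nf interp (?\<sigma>(x := t)) \<phi> \<in> wff" if "t \<in> OT" for t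
      using \<phi> that by (intro nf_wff) (auto intro: odd_terms_Ter)
    have "val (nf interp ?\<sigma> (\<^bold>\<forall>x. \<phi>)) = consistent \<inter> (\<Inter>t\<in>OT. val (nf interp (?\<sigma>(x := t)) \<phi>))"
    proof (intro subset_antisym subsetI)
      fix \<alpha> assume "\<alpha> \<in> val (nf interp ?\<sigma> (\<^bold>\<forall>x. \<phi>))"
      then show "\<alpha> \<in> consistent \<inter> (\<Inter>t\<in>OT. val (nf interp (?\<sigma>(x := t)) \<phi>))"
        using val_mono[OF elim(1)] by (auto simp: val_def simp del: normalize.simps)
    next
      fix \<alpha> assume \<alpha>: "\<alpha> \<in> consistent \<inter> (\<Inter>t\<in>OT. val (nf interp (?\<sigma>(x := t)) \<phi>))"
      then have "\<turnstile> \<alpha> \<^bold>\<longrightarrow> nf interp ?\<sigma> (\<^bold>\<forall>x. \<phi>)"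
        by (intro intro(1)) (auto simp: val_def intro: consistent_wff)
      then show "\<alpha> \<in> val (nf interp ?\<sigma> (\<^bold>\<forall>x. \<phi>))" using \<alpha> by (simp add: val_def)
    qed
    then show "crd1 (canonical (\<^bold>\<forall>x. \<phi>)) =
        \<Sqinter>\<^bsub>regulars\<^esub> ((\<lambda>a. crd1 (canonical (subst \<phi> x (name a)))) ` univ term_model)"
      unfolding canonical_quant[OF \<phi>] using regular_val[OF wff']
      by (subst inf_regulars) (auto simp: canonical_def)
  next
    fix x \<phi> assume "(\<^bold>\<exists>x. \<phi>) \<in> Sen diagram"
    then have \<phi>: "\<phi> \<in> For diagram" "fv \<phi> \<subseteq> {x}" by (auto simp: Sen_def)
    note elim = nf_quant_elim[where \<sigma> = ?\<sigma> and x = x, OF \<phi>(1) Var_1]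
    note intro = nf_quant_intro[where \<sigma> = ?\<sigma> and x = x, OF \<phi>(1) Var_1]
    have wff': "nf interp (?\<sigma>(x := t)) \<phi> \<in> wff" if "t \<in> OT" for t
      using \<phi> that by (intro nf_wff) (auto intro: odd_terms_Ter)
    have "val (nf interp ?\<sigma> (\<^bold>\<exists>x. \<phi>)) =
        regularization (\<Union>\<psi>\<in>(\<lambda>t. nf interp (?\<sigma>(x := t)) \<phi>) ` OT. val \<psi>)"
    proof (rule dense_val_Union)
      show "nf interp ?\<sigma> (\<^bold>\<exists>x. \<phi>) \<in> wff" using \<phi> by (intro wff) simp
      show "\<turnstile> \<psi> \<^bold>\<longrightarrow> nf interp ?\<sigma> (\<^bold>\<exists>x. \<phi>)" if "\<psi> \<in> (\<lambda>t. nf interp (?\<sigma>(x := t)) \<phi>) ` OT" for \<psi>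
        using that elim(2) by blast
      show "\<turnstile> nf interp ?\<sigma> (\<^bold>\<exists>x. \<phi>) \<^bold>\<longrightarrow> \<alpha>"
        if "\<alpha> \<in> wff" "\<And>\<psi>. \<psi> \<in> (\<lambda>t. nf interp (?\<sigma>(x := t)) \<phi>) ` OT \<Longrightarrow> \<turnstile> \<psi> \<^bold>\<longrightarrow> \<alpha>" for \<alpha>
        using that by (intro intro(2)) blast+
    qed (use wff' in blast)
    then show "crd1 (canonical (\<^bold>\<exists>x. \<phi>)) =
        \<Squnion>\<^bsub>regulars\<^esub> ((\<lambda>a. crd1 (canonical (subst \<phi> x (name a)))) ` univ term_model)"
      unfolding canonical_quant[OF \<phi>] using regular_val[OF wff']
      by (subst sup_regulars) (auto simp: canonical_def)
  next
    fix u \<phi> t z \<mu> b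
    assume "\<phi> \<in> For diagram" "t \<in> Ter diagram" "free_for t z \<phi>" "\<mu> \<in> assignments term_model"
      "b = teval (expansion term_model) \<mu> t"
    then show "canonical (inst \<mu> (subst (Unary u \<phi>) z t)) = canonical (inst \<mu> (subst (Unary u \<phi>) z (name b)))"
      by (intro canonical_subst) auto
  next
    fix c \<phi> \<psi> t z \<mu> b
    assume "\<phi> \<in> For diagram" "\<psi> \<in> For diagram" "t \<in> Ter diagram" "free_for t z \<phi>" "free_for t z \<psi>"
      "\<mu> \<in> assignments term_model" "b = teval (expansion term_model) \<mu> t"
    then show "canonical (inst \<mu> (subst (Binary c \<phi> \<psi>) z t)) =
        canonical (inst \<mu> (subst (Binary c \<phi> \<psi>) z (name b)))"
      by (intro canonical_subst) auto
  next
    fix q x \<phi> t z \<mu> b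
    assume "\<phi> \<in> For diagram" "t \<in> Ter diagram" "free_for t z \<phi>" "\<mu> \<in> assignments term_model"
      "b = teval (expansion term_model) \<mu> t" "x \<noteq> z" "x \<notin> tvars t"
    then show "canonical (inst \<mu> (subst (Quant q x \<phi>) z t)) = canonical (inst \<mu> (subst (Quant q x \<phi>) z (name b)))"
      by (intro canonical_subst) auto
  next
    fix \<phi> \<phi>' :: "('c + ('c, 'f, 'p) universe, 'f, 'p eqsym) fm"
    assume "variant \<phi> \<phi>'"
    then show "canonical \<phi> = canonical \<phi>'"
      unfolding canonical_def using variant_normalize by metis
  next
    fix x y \<phi> \<phi>' \<mu>
    assume *: "\<phi> \<in> For diagram" "free_for (Var y) x \<phi>" "some_repl x y \<phi> \<phi>'"
      and \<mu>: "\<mu> \<in> assignments term_model"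
    let ?\<rho> = "\<lambda>x. rep (\<mu> x)"
    have \<rho>: "?\<rho> x \<in> OT" for x using assignmentsD[OF \<mu>] by (rule rep_OT)
    \<comment> \<open>\<open>w\<close> is the marker for \<open>some_repl_obtain\<close>; the two
      formulas then have the same template and differ only in the value of the environment at
      \<open>w\<close>.\<close>
    obtain w where w: "w \<notin> insert x (avars \<phi>)" using ex_new_if_finite[of "insert x (avars \<phi>)"] by auto
    then obtain \<chi> where \<chi>: "\<phi> = subst \<chi> w (Var x)" "\<phi>' = subst \<chi> w (Var y)"
      "free_for (Var x) w \<chi>" "free_for (Var y) w \<chi>"
      using some_repl_obtain[OF *(3,2)] by auto
    then have "\<chi> \<in> For diagram" using *(1) by (simp add: For_subst)
    then have "\<turnstile> (?\<rho> x \<^bold>\<approx> ?\<rho> y) \<^bold>\<longrightarrow> (nf interp (?\<rho>(w := ?\<rho> x)) \<chi> \<^bold>\<longrightarrow> nf interp (?\<rho>(w := ?\<rho> y)) \<chi>)"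
      using \<rho> by (intro nf_leibniz) auto
    then have "\<turnstile> nf interp ?\<rho> ((Var x \<^bold>\<approx> Var y) \<^bold>\<longrightarrow> (\<phi> \<^bold>\<longrightarrow> \<phi>'))"
      using \<chi> by (simp add: normalize_subst)
    then show "canonical (inst \<mu> ((Var x \<^bold>\<approx> Var y) \<^bold>\<longrightarrow> (\<phi> \<^bold>\<longrightarrow> \<phi>'))) \<in> designated regulars swap_model"
      unfolding canonical_def nf_inst using derives_wff designated_snapshot_of by blast
  qed
qed

section \<open>From designated values back to derivations\<close>

lemma canonical_embed:
  assumes "\<phi> \<in> wff" "\<mu> \<in> assignments term_model"
  shows "canonical (inst \<mu> (embed \<phi>)) \<in> designated regulars swap_model \<longleftrightarrow>
    \<turnstile> nf Con (\<lambda>x. rep (\<mu> x)) \<phi>"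
proof -
  interpret term_interpretation \<Theta> \<Gamma> "with_eq \<Theta>" Con by (rule base_interpretation)
  have "nf Con (\<lambda>x. rep (\<mu> x)) \<phi> \<in> wff"
    using assms rep_OT[OF assignmentsD[OF assms(2)]] by (auto intro!: nf_wff intro: odd_terms_Ter)
  then show ?thesis
    by (simp add: canonical_def nf_inst embed_def normalize_map_fm designated_snapshot_of)
qed

lemma completeness:
  assumes "\<phi> \<in> wff" "consequence_over \<Theta> regulars swap_model term_model \<Gamma> \<phi>"
  shows "\<turnstile> \<phi>"
proof -
  interpret term_interpretation \<Theta> \<Gamma> "with_eq \<Theta>" Con by (rule base_interpretation)
  have "canonical (inst \<mu> (embed \<gamma>)) \<in> designated regulars swap_model"
    if "\<gamma> \<in> \<Gamma>" "\<mu> \<in> assignments term_model" for \<gamma> \<mu>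
  proof -
    have "\<turnstile> \<gamma>" using that by (intro qmbc_derives.premise)
    then show ?thesis
      using that derives_wff[of \<gamma>] rep_OT[OF assignmentsD[OF that(2)]]
      by (simp add: canonical_embed derives_iff_nf)
  qed
  then have "\<forall>\<mu>\<in>assignments term_model. canonical (inst \<mu> (embed \<phi>)) \<in> designated regulars swap_model"
    using assms(2) canonical_valuation unfolding consequence_over_def by blast
  then have *: "\<turnstile> nf Con (\<lambda>x. rep (\<mu> x)) \<phi>" if "\<mu> \<in> assignments term_model" for \<mu>
    using assms(1) that canonical_embed by blast
  \<comment> \<open>Assignments reach only environments of chosen representatives; an arbitrary odd
    environment is provably equal, value by value, to the one that picks the representatives of its
    classes.\<close>
  have "\<turnstile> nf Con \<sigma> \<phi>" if \<sigma>: "\<forall>y. \<sigma> y \<in> OT" for \<sigma>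
  proof -
    have r: "rep (cls (\<sigma> y)) \<in> OT" for y using \<sigma> by (auto intro: rep_OT)
    have "\<turnstile> nf Con (\<lambda>y. rep (cls (\<sigma> y))) \<phi>"
      using \<sigma> by (intro *) (auto simp: assignments_def)
    moreover have "\<turnstile> nf Con (\<lambda>y. rep (cls (\<sigma> y))) \<phi> \<^bold>\<longrightarrow> nf Con \<sigma> \<phi>"
      using assms(1) \<sigma> r by (intro nf_eq_cong) (auto intro: eq_sym rep_cls_eq)
    ultimately show ?thesis using MP by blast
  qed
  then show ?thesis using assms(1) by (simp add: derives_iff_nf)
qed

end

theorem corollary10p15:
  fixes \<Theta> :: "('c, 'f, 'p) sig"
    and \<Gamma> :: "('c, 'f, 'p eqsym) fm set"
    and \<phi> :: "('c, 'f, 'p eqsym) fm"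
  assumes "signature \<Theta>"
    and "\<Gamma> \<union> {\<phi>} \<subseteq> For (with_eq \<Theta>)"
    and "qmbc_consequence TYPE(('c, 'f, 'p) universe) TYPE(('c, 'f, 'p) universe) \<Theta> \<Gamma> \<phi>"
  shows "qmbc_derives \<Theta> \<Gamma> \<phi>"
proof -
  interpret qmbc_theory \<Theta> \<Gamma>
    using assms(2) by unfold_locales simp
  \<comment> \<open>Truth values and individuals are both sets of formulas, so one type instantiates
    both parameters of the consequence relation.\<close>
  have "consequence_over \<Theta> regulars swap_model term_model \<Gamma> \<phi>"
    using assms(3) regulars.complete_boolean_lattice_axioms swap_structure_model
      fo_structure_term_model standard_equality_term_model
    unfolding qmbc_consequence_def by blast
  then show ?thesis using assms(2) by (intro completeness) simp
qed

end
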